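(* Let $\mathcal{H}$ be a complex Hilbert space, let $A,B$ be bounded self-adjoint operators on $\mathcal{H}$ with spectral decompositions $A=\sum_a a\,P_A(a)$ and $B=\sum_b b\,P_B(b)$, where $P_A(a)$, $P_B(b)$ are the projections onto the eigenspaces, and let $\rho$ be a density operator on $\mathcal{H}$. 1. If $A$ and $B$ commute in $\rho$, then for every ordering the quasiprobability distribution $\mathrm{Pr}_{A,B}(\cdot,\rho)$ equals the joint probability distribution $\mu(a,b)=\mathrm{Tr}[P_A(a)P_B(b)\rho]$ (that is, $\mathrm{Pr}_{A,B}(\cdot,\rho)=\sum_{a,b}\mu(a,b)\,\delta_{(a,b)}$) and is non-negative, and the multivariable quantum characteristic function $\mathscr{C}_{A,B}(\cdot,\rho)$ for that ordering is positive definite. 2. For the Kirkwood–Dirac ordering, the following two conditions hold together if and only if $A$ and $B$ commute in $\rho$: (i) $\mathrm{Pr}^{\mathrm{KD}}_{A,B}(\cdot,\rho)$ is non-negative; and (ii) $\mathrm{Pr}^{\mathrm{KD}}_{A,B}(\cdot,\rho)$ reproduces all polynomial moments, i.e. for every polynomial $p$ in two non-commuting variables, $$\mathrm{Tr}[p(A,B)\rho]=\big\langle \mathrm{Pr}^{\mathrm{KD}}_{A,B}(\cdot,\rho),\,p(x,y)\big\rangle ,$$ where on the right-hand side $p$ is evaluated on the commuting real variables $x,y$.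
   Context: A density operator is a positive semidefinite trace-class operator of trace one. State-dependent commutativity: $A$ and $B$ commute in the state $\rho$ if $P_A(a)P_B(b)\rho=P_B(b)P_A(a)\rho$ for all eigenvalues $a$ of $A$ and $b$ of $B$. For a pure state $\rho=|\psi\rangle\langle\psi|$ this says $P_A(a)P_B(b)|\psi\rangle=P_B(b)P_A(a)|\psi\rangle$ for all $a,b$. Orderings: an ordering is given by an integer $N\ge1$ and a weight $w:S_2\to\mathbb{C}$ with $\sum_\sigma w(\sigma)=1$ and $\sum_\sigma|w(\sigma)|=1$, through $$\tilde f_{A,B}(\theta_1,\theta_2)=\Big[w(\mathrm{id})\,e^{\frac{i\theta_1}{N}A}e^{\frac{i\theta_2}{N}B}+w(\tau)\,e^{\frac{i\theta_2}{N}B}e^{\frac{i\theta_1}{N}A}\Big]^N,$$ where $\tau$ is the transposition in $S_2$; or it is the limiting case $N\to\infty$ (Wigner ordering), $\tilde f_{A,B}(\theta_1,\theta_2)=e^{i(\theta_1A+\theta_2B)}$. The Kirkwood–Dirac (KD) ordering is $N=1$, $w(\mathrm{id})=1$, $w(\tau)=0$, i.e. $\tilde f^{\mathrm{KD}}_{A,B}(\theta_1,\theta_2)=e^{i\theta_1A}e^{i\theta_2B}$. For a given ordering, the multivariable quantum characteristic function is $\mathscr{C}_{A,B}(\bm\theta,\rho)=\mathrm{Tr}[\tilde f_{A,B}(\bm\theta)\rho]$, $\bm\theta=(\theta_1,\theta_2)\in\mathbb{R}^2$, and the quasiprobability distribution $\mathrm{Pr}_{A,B}(\cdot,\rho)$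 is the unique compactly supported (complex-valued) distribution on $\mathbb{R}^2$ whose Fourier transform is this function: $\mathscr{C}_{A,B}(\bm\theta,\rho)=\langle \mathrm{Pr}_{A,B}(\cdot,\rho),e^{i\bm\theta\cdot(\,\cdot\,)}\rangle$ for all $\bm\theta\in\mathbb{R}^2$. A compactly supported distribution $u$ is non-negative if $\langle u,\varphi\rangle\ge0$ for every $\varphi\in C^\infty(\mathbb{R}^2)$ with $\varphi\ge0$. A continuous function $g:\mathbb{R}^2\to\mathbb{C}$ is positive definite if $\sum_{j,k=1}^m c_j\overline{c_k}\,g(\bm t_j-\bm t_k)\ge0$ for all finite families $\bm t_1,\dots,\bm t_m\in\mathbb{R}^2$, $c_1,\dots,c_m\in\mathbb{C}$. $\delta_{(a,b)}$ is the Dirac measure at $(a,b)$. *)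

theory Defs
  imports "HOL-Analysis.Analysis" "HOL-Library.Poly_Mapping"
begin

section \<open>Complex Hilbert spaces and operators\<close>

text \<open>The complex structure sits on top of a complete real inner product space: the norm and
  the real inner product are the ones induced by \<open>cinner\<close>, which is linear in its second
  argument. Operators are plain functions.\<close>

class chilbert_space = real_inner + complete_space +
  fixes scaleC :: "complex \<Rightarrow> 'a \<Rightarrow> 'a"  (infixr \<open>*\<^sub>C\<close> 75)
    and cinner :: "'a \<Rightarrow> 'a \<Rightarrow> complex"
  assumes scaleC_add_right: "c *\<^sub>C (x + y) = c *\<^sub>C x + c *\<^sub>C y"
    and scaleC_add_left: "(c + d) *\<^sub>C x = c *\<^sub>C x + d *\<^sub>C x"
    and scaleC_scaleC: "c *\<^sub>C d *\<^sub>C x = (c * d) *\<^sub>C x"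
    and scaleR_scaleC: "r *\<^sub>R x = complex_of_real r *\<^sub>C x"
    and cinner_commute: "cinner x y = cnj (cinner y x)"
    and cinner_add_right: "cinner x (y + z) = cinner x y + cinner x z"
    and cinner_scaleC_right: "cinner x (c *\<^sub>C y) = c * cinner x y"
    and inner_eq_Re_cinner: "inner x y = Re (cinner x y)"

instantiation complex :: chilbert_space
begin
definition scaleC_complex :: "complex \<Rightarrow> complex \<Rightarrow> complex" where "scaleC_complex c x = c * x"
definition cinner_complex :: "complex \<Rightarrow> complex \<Rightarrow> complex" where "cinner_complex x y = cnj x * y"
instance
  by standard
    (auto simp: scaleC_complex_def cinner_complex_def algebra_simps inner_complex_def scaleR_conv_of_real)
end

definition bounded_clinear :: "('a::chilbert_space \<Rightarrow> 'a) \<Rightarrow> bool" where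
  "bounded_clinear T \<longleftrightarrow> bounded_linear T \<and> (\<forall>c x. T (c *\<^sub>C x) = c *\<^sub>C T x)"

definition selfadjoint_op :: "('a::chilbert_space \<Rightarrow> 'a) \<Rightarrow> bool" where
  "selfadjoint_op T \<longleftrightarrow> bounded_clinear T \<and> (\<forall>x y. cinner (T x) y = cinner x (T y))"

definition positive_op :: "('a::chilbert_space \<Rightarrow> 'a) \<Rightarrow> bool" where
  "positive_op T \<longleftrightarrow> bounded_clinear T \<and> (\<forall>x. cinner x (T x) \<in> \<real>\<^sub>\<ge>\<^sub>0)"

definition is_onb :: "'a::chilbert_space set \<Rightarrow> bool" where
  "is_onb E \<longleftrightarrow> (\<forall>e\<in>E. \<forall>f\<in>E. cinner e f = (if e = f then 1 else 0)) \<and>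
     (\<forall>x. (\<forall>e\<in>E. cinner e x = 0) \<longrightarrow> x = 0)"

text \<open>\<open>|T|\<close> is the positive \<open>S\<close> with \<open>S\<^sup>2 = T\<^sup>* T\<close>; the equation is written in weak form, which
  avoids the adjoint of \<open>T\<close>.\<close>

definition abs_op :: "('a::chilbert_space \<Rightarrow> 'a) \<Rightarrow> 'a \<Rightarrow> 'a" where
  "abs_op T = (THE S. positive_op S \<and> (\<forall>x y. cinner x (S (S y)) = cinner (T x) (T y)))"

definition trace_class :: "('a::chilbert_space \<Rightarrow> 'a) \<Rightarrow> bool" where
  "trace_class T \<longleftrightarrow> bounded_clinear T \<and>
     (\<exists>E. is_onb E \<and> (\<lambda>e. cinner e (abs_op T e)) summable_on E)"

text \<open>The trace is only meaningful for trace-class operators, for which it does not depend on the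
  chosen orthonormal basis.\<close>

definition trace_op :: "('a::chilbert_space \<Rightarrow> 'a) \<Rightarrow> complex" where
  "trace_op T = (\<Sum>\<^sub>\<infinity>e\<in>(SOME E. is_onb E). cinner e (T e))"

definition density_operator :: "('a::chilbert_space \<Rightarrow> 'a) \<Rightarrow> bool" where
  "density_operator \<rho> \<longleftrightarrow> positive_op \<rho> \<and> trace_class \<rho> \<and> trace_op \<rho> = 1"

definition exp_op :: "('a::chilbert_space \<Rightarrow> 'a) \<Rightarrow> 'a \<Rightarrow> 'a" where
  "exp_op T x = suminf (\<lambda>n. (T ^^ n) x /\<^sub>R fact n)"


section \<open>Spectral decompositions\<close>

text \<open>Eigenvalues are taken in the reals: the operators considered are self-adjoint.\<close>

definition eigenspace :: "('a::chilbert_space \<Rightarrow> 'a) \<Rightarrow> real \<Rightarrow> 'a set" where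
  "eigenspace A a = {x. A x = complex_of_real a *\<^sub>C x}"

definition eigenvalues :: "('a::chilbert_space \<Rightarrow> 'a) \<Rightarrow> real set" where
  "eigenvalues A = {a. \<exists>x\<in>eigenspace A a. x \<noteq> 0}"

definition orth_proj :: "'a::chilbert_space set \<Rightarrow> 'a \<Rightarrow> 'a" where
  "orth_proj M x = (THE y. y \<in> M \<and> (\<forall>z\<in>M. cinner z (x - y) = 0))"

definition eigenproj :: "('a::chilbert_space \<Rightarrow> 'a) \<Rightarrow> real \<Rightarrow> 'a \<Rightarrow> 'a" where
  "eigenproj A a = orth_proj (eigenspace A a)"

text \<open>\<open>A = \<Sum>a. a P\<^sub>A(a)\<close>, summed over the eigenvalues in the strong operator topology. There may be
  infinitely many eigenvalues. The resolution of the identity \<open>\<Sum>a. P\<^sub>A(a) = 1\<close> is a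
  consequence, because a vector orthogonal to all eigenspaces is then in the kernel of \<open>A\<close>.\<close>

definition has_spectral_decomposition :: "('a::chilbert_space \<Rightarrow> 'a) \<Rightarrow> bool" where
  "has_spectral_decomposition A \<longleftrightarrow>
     (\<forall>x. ((\<lambda>a. complex_of_real a *\<^sub>C eigenproj A a x) has_sum A x) (eigenvalues A))"

definition commute_in_state ::
  "('a::chilbert_space \<Rightarrow> 'a) \<Rightarrow> ('a \<Rightarrow> 'a) \<Rightarrow> ('a \<Rightarrow> 'a) \<Rightarrow> bool" where
  "commute_in_state A B \<rho> \<longleftrightarrow> (\<forall>a\<in>eigenvalues A. \<forall>b\<in>eigenvalues B.
     eigenproj A a \<circ> eigenproj B b \<circ> \<rho> = eigenproj B b \<circ> eigenproj A a \<circ> \<rho>)"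

definition joint_prob ::
  "('a::chilbert_space \<Rightarrow> 'a) \<Rightarrow> ('a \<Rightarrow> 'a) \<Rightarrow> ('a \<Rightarrow> 'a) \<Rightarrow> real \<times> real \<Rightarrow> complex" where
  "joint_prob A B \<rho> = (\<lambda>(a, b). trace_op (eigenproj A a \<circ> eigenproj B b \<circ> \<rho>))"


section \<open>Orderings and characteristic functions\<close>

text \<open>\<open>Product N w\<^sub>1 w\<^sub>2\<close> has weights \<open>w(id) = w\<^sub>1\<close> and \<open>w(\<tau>) = w\<^sub>2\<close> on \<open>S\<^sub>2 = {id, \<tau>}\<close>.\<close>

datatype op_ordering = Product nat complex complex | Wigner

fun valid_ordering :: "op_ordering \<Rightarrow> bool" where
  "valid_ordering (Product N w\<^sub>1 w\<^sub>2) \<longleftrightarrow> N \<ge> 1 \<and> w\<^sub>1 + w\<^sub>2 = 1 \<and> cmod w\<^sub>1 + cmod w\<^sub>2 = 1"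
| "valid_ordering Wigner \<longleftrightarrow> True"

definition KD :: op_ordering where
  "KD = Product 1 1 0"

definition unitary_exp :: "real \<Rightarrow> ('a::chilbert_space \<Rightarrow> 'a) \<Rightarrow> 'a \<Rightarrow> 'a" where
  "unitary_exp s A = exp_op (\<lambda>x. (\<i> * complex_of_real s) *\<^sub>C A x)"

fun ordered_exp :: "op_ordering \<Rightarrow> ('a::chilbert_space \<Rightarrow> 'a) \<Rightarrow> ('a \<Rightarrow> 'a) \<Rightarrow> real \<times> real \<Rightarrow> 'a \<Rightarrow> 'a" where
  "ordered_exp (Product N w\<^sub>1 w\<^sub>2) A B (s, t) =
     (\<lambda>x. w\<^sub>1 *\<^sub>C unitary_exp (s / real N) A (unitary_exp (t / real N) B x) +
          w\<^sub>2 *\<^sub>C unitary_exp (t / real N) B (unitary_exp (s / real N) A x)) ^^ N"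
| "ordered_exp Wigner A B (s, t) =
     exp_op (\<lambda>x. \<i> *\<^sub>C (complex_of_real s *\<^sub>C A x + complex_of_real t *\<^sub>C B x))"

definition charfun ::
  "op_ordering \<Rightarrow> ('a::chilbert_space \<Rightarrow> 'a) \<Rightarrow> ('a \<Rightarrow> 'a) \<Rightarrow> ('a \<Rightarrow> 'a) \<Rightarrow> real \<times> real \<Rightarrow> complex" where
  "charfun \<omega> A B \<rho> \<theta> = trace_op (ordered_exp \<omega> A B \<theta> \<circ> \<rho>)"

definition positive_definite :: "(real \<times> real \<Rightarrow> complex) \<Rightarrow> bool" where
  "positive_definite g \<longleftrightarrow> continuous_on UNIV g \<and>
     (\<forall>m (t :: nat \<Rightarrow> real \<times> real) c.
        (\<Sum>j<m. \<Sum>k<m. c j * cnj (c k) * g (t j - t k)) \<in> \<real>\<^sub>\<ge>\<^sub>0)"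


section \<open>Compactly supported distributions on the plane\<close>

definition partial1 :: "(real \<times> real \<Rightarrow> complex) \<Rightarrow> real \<times> real \<Rightarrow> complex" where
  "partial1 f = (\<lambda>(x, y). vector_derivative (\<lambda>s. f (s, y)) (at x))"

definition partial2 :: "(real \<times> real \<Rightarrow> complex) \<Rightarrow> real \<times> real \<Rightarrow> complex" where
  "partial2 f = (\<lambda>(x, y). vector_derivative (\<lambda>s. f (x, s)) (at y))"

primrec Ck :: "nat \<Rightarrow> (real \<times> real \<Rightarrow> complex) \<Rightarrow> bool" where
  "Ck 0 f \<longleftrightarrow> continuous_on UNIV f"
| "Ck (Suc k) f \<longleftrightarrow> f differentiable_on UNIV \<and> Ck k (partial1 f) \<and> Ck k (partial2 f)"

definition smooth :: "(real \<times> real \<Rightarrow> complex) \<Rightarrow> bool" where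
  "smooth f \<longleftrightarrow> (\<forall>k. Ck k f)"

text \<open>Compactly supported distributions are the continuous linear functionals on \<open>C\<^sup>\<infinity>\<close> with its
  usual Frechet topology. To make such a functional a unique HOL function, it is given the value 0
  off the smooth functions.\<close>

definition cs_distribution :: "((real \<times> real \<Rightarrow> complex) \<Rightarrow> complex) \<Rightarrow> bool" where
  "cs_distribution u \<longleftrightarrow>
     (\<forall>f g. smooth f \<longrightarrow> smooth g \<longrightarrow> u (\<lambda>z. f z + g z) = u f + u g) \<and>
     (\<forall>c f. smooth f \<longrightarrow> u (\<lambda>z. c * f z) = c * u f) \<and>
     (\<exists>K n C. compact K \<and> K \<noteq> {} \<and> (\<forall>f. smooth f \<longrightarrow>
        cmod (u f) \<le> C * (\<Sum>i\<le>n. \<Sum>j\<le>n. SUP z\<in>K. cmod ((partial1 ^^ i) ((partial2 ^^ j) f) z)))) \<and>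
     (\<forall>f. \<not> smooth f \<longrightarrow> u f = 0)"

definition nonneg_distribution :: "((real \<times> real \<Rightarrow> complex) \<Rightarrow> complex) \<Rightarrow> bool" where
  "nonneg_distribution u \<longleftrightarrow>
     (\<forall>f. smooth f \<longrightarrow> (\<forall>z. f z \<in> \<real>\<^sub>\<ge>\<^sub>0) \<longrightarrow> u f \<in> \<real>\<^sub>\<ge>\<^sub>0)"

text \<open>\<open>\<theta> \<bullet> z\<close> is the Euclidean inner product of the plane.\<close>

definition fourier :: "((real \<times> real \<Rightarrow> complex) \<Rightarrow> complex) \<Rightarrow> real \<times> real \<Rightarrow> complex" where
  "fourier u \<theta> = u (\<lambda>z. exp (\<i> * complex_of_real (\<theta> \<bullet> z)))"

definition quasiprob ::
  "op_ordering \<Rightarrow> ('a::chilbert_space \<Rightarrow> 'a) \<Rightarrow> ('a \<Rightarrow> 'a) \<Rightarrow> ('a \<Rightarrow> 'a) \<Rightarrow>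
     (real \<times> real \<Rightarrow> complex) \<Rightarrow> complex" where
  "quasiprob \<omega> A B \<rho> = (THE u. cs_distribution u \<and> (\<forall>\<theta>. fourier u \<theta> = charfun \<omega> A B \<rho> \<theta>))"


section \<open>Non-commutative polynomials in two variables\<close>

text \<open>Finite complex linear combinations of words in two letters.\<close>

datatype letter = LX | LY

type_synonym ncpoly = "letter list \<Rightarrow>\<^sub>0 complex"

definition word_op :: "('a \<Rightarrow> 'a) \<Rightarrow> ('a \<Rightarrow> 'a) \<Rightarrow> letter list \<Rightarrow> 'a \<Rightarrow> 'a" where
  "word_op A B w = foldr (\<lambda>l T. (case l of LX \<Rightarrow> A | LY \<Rightarrow> B) \<circ> T) w id"

definition ncpoly_op ::
  "ncpoly \<Rightarrow> ('a::chilbert_space \<Rightarrow> 'a) \<Rightarrow> ('a \<Rightarrow> 'a) \<Rightarrow> 'a \<Rightarrow> 'a" where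
  "ncpoly_op p A B x = (\<Sum>w\<in>Poly_Mapping.keys p. Poly_Mapping.lookup p w *\<^sub>C word_op A B w x)"

definition ncpoly_fun :: "ncpoly \<Rightarrow> real \<times> real \<Rightarrow> complex" where
  "ncpoly_fun p = (\<lambda>(x, y). \<Sum>w\<in>Poly_Mapping.keys p. Poly_Mapping.lookup p w *
     (\<Prod>l\<leftarrow>w. complex_of_real (case l of LX \<Rightarrow> x | LY \<Rightarrow> y)))"

definition reproduces_moments ::
  "((real \<times> real \<Rightarrow> complex) \<Rightarrow> complex) \<Rightarrow>
     ('a::chilbert_space \<Rightarrow> 'a) \<Rightarrow> ('a \<Rightarrow> 'a) \<Rightarrow> ('a \<Rightarrow> 'a) \<Rightarrow> bool" where
  "reproduces_moments u A B \<rho> \<longleftrightarrow>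
     (\<forall>p. trace_op (ncpoly_op p A B \<circ> \<rho>) = u (ncpoly_fun p))"

end

theory Submission
  imports Defs
begin

text \<open>Write \<open>\<rho> = S\<^sup>2\<close> with \<open>S\<close> self-adjoint. Then \<open>Tr(T \<rho>) = \<Sum>e. \<langle>S e, T S e\<rangle>\<close> over an orthonormal
  basis, and \<open>A\<close> and \<open>B\<close> commute in \<open>\<rho>\<close> iff \<open>P\<^sub>A(a) P\<^sub>B(b) v = P\<^sub>B(b) P\<^sub>A(a) v\<close> for all the vectors
  \<open>v = S e\<close>. In that case \<open>v\<close> is the orthogonal sum of the joint eigenvectors \<open>P\<^sub>A(a) P\<^sub>B(b) v\<close>, on
  which every ordering of the exponentials acts as \<open>exp (i (s a + t b))\<close> and every polynomial as its
  commutative evaluation at \<open>(a, b)\<close>; so the characteristic function is the Fourier transform of the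
  measure \<open>\<mu>\<close>, and it determines the distribution because polynomials are dense in the smooth
  functions.

  Conversely, the four products of \<open>A\<^sup>k\<close> and \<open>B\<^sup>l\<close> in the expansion of \<open>C\<^sup>* C\<close>, where
  \<open>C = A\<^sup>k B\<^sup>l - B\<^sup>l A\<^sup>k\<close>, have the same commutative image, so that the moment condition gives
  \<open>Tr(C\<^sup>* C \<rho>) = 0\<close>, i.e. \<open>C S = 0\<close>. Spectral projections are strong limits of polynomials, whence \<open>A\<close>
  and \<open>B\<close> commute in \<open>\<rho>\<close>.\<close>

section \<open>Complex Hilbert spaces\<close>

text \<open>The formula \<open>Tr(T \<rho>) = \<Sum>e. \<langle>S e, T S e\<rangle>\<close> is an
  instance of \<open>Tr(T S S) = Tr(S T S)\<close>; it is obtained by interchanging two infinite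
  sums, and so is the passage from the vectors \<open>S e\<close> to the weights
  \<open>joint_prob\<close>, because both the basis and the spectra may be infinite.

  The definite description in \<open>quasiprob\<close> becomes usable only after a distribution with
  the right Fourier transform has been exhibited and shown to be unique. Under commutation the
  candidate is the sum against \<open>joint_prob\<close>. For uniqueness, the Taylor polynomials of
  a plane wave converge to it together with all derivatives on every square, so along a ray the
  Fourier transform is a power series whose coefficients are directional moments. These determine
  all monomial moments, and density of the polynomials does the rest.

  The converse is proved for an arbitrary functional \<open>u\<close> with the moment property,
  since without commutation no explicit formula for the distribution is at hand.\<close>

instance chilbert_space \<subseteq> banach ..

lemma one_scaleC [simp]: "1 *\<^sub>C x = x"
  using scaleR_scaleC[of 1 x] by simp

lemma cinner_add_left: "cinner (x + y) z = cinner x z + cinner y z"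
  by (metis cinner_add_right cinner_commute complex_cnj_add)

lemma cinner_scaleC_left: "cinner (c *\<^sub>C x) y = cnj c * cinner x y"
  by (metis cinner_commute cinner_scaleC_right complex_cnj_mult)

lemma cinner_self: "cinner x x = complex_of_real ((norm x)\<^sup>2)"
proof -
  have "Im (cinner x x) = 0"
    using cinner_commute[of x x] by (metis cnj.simps(2) equal_neg_zero)
  moreover have "Re (cinner x x) = (norm x)\<^sup>2"
    by (simp add: inner_eq_Re_cinner[symmetric] dot_square_norm)
  ultimately show ?thesis by (simp add: complex_eq_iff)
qed

lemma mult_cnj_eq_norm: "z * cnj z = (complex_of_real (cmod z))\<^sup>2"
  by (metis complex_norm_square of_real_power)

lemma norm_scaleC: "norm (c *\<^sub>C x) = cmod c * norm x"
proof -
  have "complex_of_real ((norm (c *\<^sub>C x))\<^sup>2) = complex_of_real ((cmod c * norm x)\<^sup>2)"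
    unfolding cinner_self[symmetric] cinner_scaleC_left cinner_scaleC_right
    by (simp add: cinner_self power_mult_distrib mult_cnj_eq_norm[symmetric] algebra_simps)
  then show ?thesis
    by (simp only: of_real_eq_iff) (simp add: power2_eq_iff_nonneg)
qed

text \<open>A factor of modulus 1 turns the complex inner product into its modulus, so the real
  inequality applies to \<open>x\<close> and \<open>c *\<^sub>C y\<close>.\<close>

lemma cinner_cauchy_schwarz: "cmod (cinner x y) \<le> norm x * norm y"
proof -
  obtain c where c: "cmod c = 1" "c * cinner x y = cmod (cinner x y)"
  proof (cases "cinner x y = 0")
    case False
    let ?c = "cnj (cinner x y) / cmod (cinner x y)"
    have "?c * cinner x y = cmod (cinner x y)"
      using False complex_norm_square[of "cinner x y"]
      by (simp add: field_simps power2_eq_square)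
    then show ?thesis using False by (intro that[of ?c]) (auto simp: norm_divide)
  qed (use that[of 1] in auto)
  have "cmod (cinner x y) = inner x (c *\<^sub>C y)"
    by (simp add: inner_eq_Re_cinner cinner_scaleC_right c(2))
  also have "\<dots> \<le> norm x * norm (c *\<^sub>C y)" by (rule norm_cauchy_schwarz)
  finally show ?thesis by (simp add: norm_scaleC c(1))
qed

lemma bounded_bilinear_cinner: "bounded_bilinear (cinner :: 'a::chilbert_space \<Rightarrow> _)"
proof
  show "cinner (r *\<^sub>R x) y = r *\<^sub>R cinner x y" for r and x y :: 'a
    by (simp add: scaleR_scaleC[where 'a='a] cinner_scaleC_left scaleR_conv_of_real)
  show "cinner x (r *\<^sub>R y) = r *\<^sub>R cinner x y" for r and x y :: 'a
    by (simp add: scaleR_scaleC[where 'a='a] cinner_scaleC_right scaleR_conv_of_real)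
  show "\<exists>K. \<forall>x y :: 'a. norm (cinner x y) \<le> norm x * norm y * K"
    using cinner_cauchy_schwarz by (intro exI[of _ 1]) auto
qed (simp_all add: cinner_add_left cinner_add_right)

interpretation cinner: bounded_bilinear cinner
  by (rule bounded_bilinear_cinner)

lemma bounded_bilinear_scaleC: "bounded_bilinear (scaleC :: complex \<Rightarrow> 'a::chilbert_space \<Rightarrow> 'a)"
proof
  show "(r *\<^sub>R c) *\<^sub>C x = r *\<^sub>R c *\<^sub>C x" for r c and x :: 'a
    by (simp add: scaleR_scaleC[where 'a='a] scaleC_scaleC scaleR_conv_of_real)
  show "c *\<^sub>C r *\<^sub>R x = r *\<^sub>R c *\<^sub>C x" for r c and x :: 'a
    by (simp add: scaleR_scaleC[where 'a='a] scaleC_scaleC mult.commute)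
  show "\<exists>K. \<forall>c (x :: 'a). norm (c *\<^sub>C x) \<le> cmod c * norm x * K"
    by (intro exI[of _ 1]) (simp add: norm_scaleC)
qed (simp_all add: scaleC_add_left scaleC_add_right)

interpretation scaleC: bounded_bilinear scaleC
  by (rule bounded_bilinear_scaleC)

declare cinner.zero_left [simp] cinner.zero_right [simp]
  scaleC.zero_left [simp] scaleC.zero_right [simp]

lemma cinner_self_eq_0 [simp]: "cinner x x = 0 \<longleftrightarrow> x = 0"
  by (simp add: cinner_self)

section \<open>Pythagoras, Bessel and expansions along orthogonal families\<close>

lemma norm_add_orthogonal:
  assumes "cinner x y = 0"
  shows "(norm (x + y))\<^sup>2 = (norm x)\<^sup>2 + (norm y)\<^sup>2"
  using norm_add_Pythagorean[of x y] assms by (simp add: orthogonal_def inner_eq_Re_cinner)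

lemma norm_sum_orthogonal:
  assumes "finite F" "\<And>i j. i \<in> F \<Longrightarrow> j \<in> F \<Longrightarrow> i \<noteq> j \<Longrightarrow> cinner (w i) (w j) = 0"
  shows "(norm (\<Sum>i\<in>F. w i))\<^sup>2 = (\<Sum>i\<in>F. (norm (w i))\<^sup>2)"
  using assms
proof (induction F rule: finite_induct)
  case (insert i F)
  have "cinner (w i) (\<Sum>j\<in>F. w j) = 0"
    using insert.prems insert.hyps(2) by (subst cinner.sum_right) (auto intro!: sum.neutral)
  then show ?case using insert by (simp add: norm_add_orthogonal)
qed simp

text \<open>The last assumption says that \<open>w i\<close> is the projection of \<open>x\<close>
  onto its own line. In this form the lemma and its infinite versions below serve basis components,
  spectral components and joint spectral components alike.\<close>

lemma bessel_finite:
  assumes "finite F" "\<And>i j. i \<in> F \<Longrightarrow> j \<in> F \<Longrightarrow> i \<noteq> j \<Longrightarrow> cinner (w i) (w j) = 0"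
    and "\<And>i. i \<in> F \<Longrightarrow> cinner (w i) x = complex_of_real ((norm (w i))\<^sup>2)"
  shows "(\<Sum>i\<in>F. (norm (w i))\<^sup>2) \<le> (norm x)\<^sup>2"
proof -
  let ?s = "\<Sum>i\<in>F. w i"
  have n: "(norm ?s)\<^sup>2 = (\<Sum>i\<in>F. (norm (w i))\<^sup>2)"
    using assms(1,2) by (rule norm_sum_orthogonal)
  have "cinner ?s x = cinner ?s ?s"
    unfolding cinner_self[of ?s] n using assms(3) by (simp add: cinner.sum_left)
  then have "cinner ?s (x - ?s) = 0" by (simp add: cinner.diff_right)
  from norm_add_orthogonal[OF this] have "(norm x)\<^sup>2 = (norm ?s)\<^sup>2 + (norm (x - ?s))\<^sup>2" by simp
  then show ?thesis using n by simp
qed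

text \<open>By Bessel the squared norms are summable, and by Pythagoras they control the distance
  between nested partial sums, so the net of finite partial sums is Cauchy. The norms themselves may
  fail to be summable.\<close>

lemma orthogonal_summable:
  fixes w :: "'i \<Rightarrow> 'a::chilbert_space"
  assumes orth: "\<And>i j. i \<in> I \<Longrightarrow> j \<in> I \<Longrightarrow> i \<noteq> j \<Longrightarrow> cinner (w i) (w j) = 0"
    and x: "\<And>i. i \<in> I \<Longrightarrow> cinner (w i) x = complex_of_real ((norm (w i))\<^sup>2)"
  shows "w summable_on I"
proof -
  have "(\<lambda>i. (norm (w i))\<^sup>2) summable_on I"
  proof (rule nonneg_bdd_above_summable_on)
    show "bdd_above (sum (\<lambda>i. (norm (w i))\<^sup>2) ` {F. F \<subseteq> I \<and> finite F})"
      using assms by (auto intro!: bdd_aboveI2[of _ _ "(norm x)\<^sup>2"] bessel_finite)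
  qed auto
  then obtain L where L: "(sum (\<lambda>i. (norm (w i))\<^sup>2) \<longlongrightarrow> L) (finite_subsets_at_top I)"
    unfolding summable_on_def has_sum_def by blast
  have sq: "(norm (sum w F - sum w G))\<^sup>2 = sum (\<lambda>i. (norm (w i))\<^sup>2) F - sum (\<lambda>i. (norm (w i))\<^sup>2) G"
    if "finite F" "G \<subseteq> F" "F \<subseteq> I" for F G
  proof -
    have G: "finite G" using that finite_subset by blast
    have "sum w F - sum w G = sum w (F - G)" using that G by (simp add: sum_diff)
    moreover have "(norm (sum w (F - G)))\<^sup>2 = sum (\<lambda>i. (norm (w i))\<^sup>2) (F - G)"
      using that orth by (intro norm_sum_orthogonal) (simp_all add: subset_iff)
    ultimately show ?thesis using that G by (simp add: sum_diff)
  qed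
  have "\<exists>P. eventually P (finite_subsets_at_top I) \<and>
              (\<forall>F F'. P F \<and> P F' \<longrightarrow> dist (sum w F) (sum w F') < e)" if "e > 0" for e
  proof -
    \<comment> \<open>Two sums of squares within \<open>d\<close> of their limit differ by less than
      \<open>2 * d = (e/2)\<^sup>2\<close>.\<close>
    define d where "d = (e/2)\<^sup>2 / 2"
    have "d > 0" using that by (simp add: d_def)
    then have "eventually (\<lambda>F. dist (sum (\<lambda>i. (norm (w i))\<^sup>2) F) L < d) (finite_subsets_at_top I)"
      using L by (simp add: tendsto_iff)
    then obtain G where "finite G \<and> G \<subseteq> I \<and>
        (\<forall>F. finite F \<and> G \<subseteq> F \<and> F \<subseteq> I \<longrightarrow> dist (sum (\<lambda>i. (norm (w i))\<^sup>2) F) L < d)"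
      unfolding eventually_finite_subsets_at_top by (rule exE)
    then have G: "finite G" "G \<subseteq> I" and
      close: "\<And>F. finite F \<Longrightarrow> G \<subseteq> F \<Longrightarrow> F \<subseteq> I \<Longrightarrow> dist (sum (\<lambda>i. (norm (w i))\<^sup>2) F) L < d"
      by simp_all
    have near: "dist (sum w F) (sum w G) < e/2" if F: "finite F" "G \<subseteq> F" "F \<subseteq> I" for F
    proof -
      have "(norm (sum w F - sum w G))\<^sup>2 < 2 * d"
        using close[OF F] close[OF G(1) order.refl G(2)] sq[OF F] by (simp add: dist_real_def)
      then have "(norm (sum w F - sum w G))\<^sup>2 < (e/2)\<^sup>2" by (simp add: d_def)
      then show ?thesis unfolding dist_norm by (rule power2_less_imp_less) (use \<open>e > 0\<close> in simp)
    qed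
    show ?thesis
    proof (intro exI conjI allI impI)
      show "eventually (\<lambda>F. finite F \<and> G \<subseteq> F \<and> F \<subseteq> I) (finite_subsets_at_top I)"
        using G unfolding eventually_finite_subsets_at_top by blast
      show "dist (sum w F) (sum w F') < e"
        if "(finite F \<and> G \<subseteq> F \<and> F \<subseteq> I) \<and> finite F' \<and> G \<subseteq> F' \<and> F' \<subseteq> I" for F F'
        using near[of F] near[of F'] that by (metis dist_commute dist_triangle_half_r)
    qed
  qed
  then have "cauchy_filter (filtermap (sum w) (finite_subsets_at_top I))"
    by (simp add: cauchy_filter_metric_filtermap)
  moreover have "complete (UNIV::'a set)"
    by (meson Cauchy_convergent UNIV_I complete_def convergent_def)
  ultimately obtain y where "(sum w \<longlongrightarrow> y) (finite_subsets_at_top I)"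
    using complete_uniform[where S=UNIV] by (force simp add: filterlim_def)
  then show ?thesis
    using summable_on_def has_sum_def by blast
qed

text \<open>In general the sum \<open>y\<close> differs from \<open>x\<close>; only the
  orthogonality of the remainder to every \<open>w i\<close> is available. The completeness argument
  giving \<open>x = y\<close> is left to each application.\<close>

lemma orthogonal_has_sum:
  fixes w :: "'i \<Rightarrow> 'a::chilbert_space"
  assumes orth: "\<And>i j. i \<in> I \<Longrightarrow> j \<in> I \<Longrightarrow> i \<noteq> j \<Longrightarrow> cinner (w i) (w j) = 0"
    and x: "\<And>i. i \<in> I \<Longrightarrow> cinner (w i) x = complex_of_real ((norm (w i))\<^sup>2)"
  obtains y where "(w has_sum y) I" "\<And>i. i \<in> I \<Longrightarrow> cinner (w i) (x - y) = 0"
proof -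
  obtain y where y: "(w has_sum y) I"
    using orthogonal_summable[of I w x] assms by (auto simp: summable_on_def)
  have "cinner (w i) (x - y) = 0" if "i \<in> I" for i
  proof -
    have "((\<lambda>j. cinner (w i) (w j)) has_sum cinner (w i) y) I"
      by (rule has_sum_bounded_linear[OF cinner.bounded_linear_right y])
    moreover have "((\<lambda>j. cinner (w i) (w j)) has_sum cinner (w i) (w i)) {i}"
      by (simp add: has_sum_finiteI)
    then have "((\<lambda>j. cinner (w i) (w j)) has_sum cinner (w i) (w i)) I"
      by (rule has_sum_cong_neutral[THEN iffD1, rotated -1]) (use that orth in auto)
    ultimately show ?thesis
      using x[OF that] by (auto simp: cinner.diff_right cinner_self dest: has_sum_unique)
  qed
  then show ?thesis using that y by blast
qed

lemma onb_expansion: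
  assumes "is_onb E"
  shows "((\<lambda>e. cinner e x *\<^sub>C e) has_sum x) E"
proof -
  have on: "cinner e f = (if e = f then 1 else 0)" if "e \<in> E" "f \<in> E" for e f
    using assms that by (auto simp: is_onb_def)
  have n: "norm e = 1" if "e \<in> E" for e
    using on[OF that that] that
    by (simp add: cinner_self power2_eq_1_iff del: of_real_power) (smt (verit) norm_ge_zero)
  obtain y where y: "((\<lambda>e. cinner e x *\<^sub>C e) has_sum y) E"
     "\<And>e. e \<in> E \<Longrightarrow> cinner (cinner e x *\<^sub>C e) (x - y) = 0"
    by (rule orthogonal_has_sum[of E "\<lambda>e. cinner e x *\<^sub>C e" x])
       (auto simp: on n cinner_scaleC_left cinner_scaleC_right norm_scaleC mult_cnj_eq_norm power_mult_distrib mult.commute)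
  \<comment> \<open>If the coefficient of \<open>e\<close> vanishes, its component is the zero
    vector and orthogonality to it says nothing. In that case \<open>e\<close> is orthogonal to
    every component, hence to \<open>y\<close>.\<close>
  have "cinner e (x - y) = 0" if e: "e \<in> E" for e
  proof (cases "cinner e x = 0")
    case True
    have "((\<lambda>f. cinner e (cinner f x *\<^sub>C f)) has_sum cinner e y) E"
      by (rule has_sum_bounded_linear[OF cinner.bounded_linear_right y(1)])
    moreover have "((\<lambda>f. cinner e (cinner f x *\<^sub>C f)) has_sum 0) E"
      using True by (intro has_sum_0) (auto simp: cinner_scaleC_right on e)
    ultimately show ?thesis using True by (auto simp: cinner.diff_right dest: has_sum_unique)
  next
    case False
    then show ?thesis using y(2)[OF e] by (simp add: cinner_scaleC_left)
  qed
  then have "x - y = 0" using assms unfolding is_onb_def by blast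
  then show ?thesis using y(1) by simp
qed

lemma parseval:
  assumes "is_onb E"
  shows "((\<lambda>e. cinner x e * cinner e y) has_sum cinner x y) E"
  using has_sum_bounded_linear[OF cinner.bounded_linear_right[of x] onb_expansion[OF assms, of y]]
  by (simp add: cinner_scaleC_right mult.commute)

lemma parseval_norm:
  assumes "is_onb E"
  shows "((\<lambda>e. (cmod (cinner e x))\<^sup>2) has_sum (norm x)\<^sup>2) E"
proof -
  have "cinner x e * cinner e x = complex_of_real ((cmod (cinner e x))\<^sup>2)" for e
    by (subst cinner_commute) (simp add: complex_norm_square[symmetric] mult.commute del: of_real_power)
  then show ?thesis
    using parseval[OF assms, of x x] by (simp add: cinner_self has_sum_of_real_iff del: of_real_power)
qed

section \<open>Orthogonal projections and spectral decompositions\<close>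

lemma bounded_clinearI:
  assumes "\<And>x y. T (x + y) = T x + T y" "\<And>c x. T (c *\<^sub>C x) = c *\<^sub>C T x"
    and "\<And>x. norm (T x) \<le> norm x * K"
  shows "bounded_clinear T"
  unfolding bounded_clinear_def using assms
  by (auto intro!: bounded_linear_intro[where K=K] simp: scaleR_scaleC)

lemma bounded_clinear_bounded_linear: "bounded_clinear T \<Longrightarrow> bounded_linear T"
  and bounded_clinear_scaleC: "bounded_clinear T \<Longrightarrow> T (c *\<^sub>C x) = c *\<^sub>C T x"
  by (auto simp: bounded_clinear_def)

lemma bounded_clinear_ident: "bounded_clinear (\<lambda>x. x)"
  by (rule bounded_clinearI[where K=1]) auto

lemma bounded_clinear_compose:
  "bounded_clinear S \<Longrightarrow> bounded_clinear T \<Longrightarrow> bounded_clinear (\<lambda>x. S (T x))"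
  by (auto simp: bounded_clinear_def intro: bounded_linear_compose)

lemma bounded_clinear_add:
  "bounded_clinear S \<Longrightarrow> bounded_clinear T \<Longrightarrow> bounded_clinear (\<lambda>x. S x + T x)"
  by (auto simp: bounded_clinear_def bounded_linear_add scaleC_add_right)

lemma bounded_clinear_scale:
  "bounded_clinear T \<Longrightarrow> bounded_clinear (\<lambda>x. c *\<^sub>C T x)"
  by (auto simp: bounded_clinear_def scaleC_scaleC mult.commute
      intro: bounded_linear_compose[OF scaleC.bounded_linear_right])

lemma bounded_clinear_zero: "bounded_clinear (\<lambda>x. 0)"
  by (rule bounded_clinearI[where K=0]) (auto simp: scaleC.zero_right)

lemma bounded_clinear_sum:
  "(\<And>i. i \<in> F \<Longrightarrow> bounded_clinear (T i)) \<Longrightarrow> bounded_clinear (\<lambda>x. \<Sum>i\<in>F. T i x)"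
  by (induction F rule: infinite_finite_induct)
     (auto intro: bounded_clinear_zero bounded_clinear_add)

lemma bounded_clinear_funpow: "bounded_clinear T \<Longrightarrow> bounded_clinear (T ^^ n)"
  by (induction n) (auto simp: id_def o_def intro: bounded_clinear_ident bounded_clinear_compose)

lemma selfadjoint_op_bounded_clinear: "selfadjoint_op A \<Longrightarrow> bounded_clinear A"
  and selfadjoint_op_cinner: "selfadjoint_op A \<Longrightarrow> cinner (A x) y = cinner x (A y)"
  by (auto simp: selfadjoint_op_def)

section \<open>Orthogonal projection onto a closed subspace\<close>

definition closed_csubspace :: "'a::chilbert_space set \<Rightarrow> bool" where
  "closed_csubspace M \<longleftrightarrow> closed M \<and> 0 \<in> M \<and> (\<forall>x\<in>M. \<forall>y\<in>M. x + y \<in> M) \<and> (\<forall>c. \<forall>x\<in>M. c *\<^sub>C x \<in> M)"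

lemma closed_csubspace_diff:
  assumes "closed_csubspace M" "x \<in> M" "y \<in> M"
  shows "x - y \<in> M"
proof -
  have "x + (-1) *\<^sub>C y \<in> M" using assms by (auto simp: closed_csubspace_def)
  moreover have "(-1) *\<^sub>C y = - y" using scaleC.minus_left[of 1 y] by simp
  ultimately show ?thesis by simp
qed

text \<open>The witness \<open>?t\<close> minimises the distance from \<open>r\<close> to the line
  of \<open>z\<close>; the squared minimum is smaller than \<open>(norm r)\<^sup>2\<close> by
  \<open>(inner r z)\<^sup>2 / (norm z)\<^sup>2\<close>, which must therefore vanish.\<close>

lemma orthogonal_if_nearest:
  fixes r z :: "'a::real_inner"
  assumes "\<And>t :: real. (norm r)\<^sup>2 \<le> (norm (r - t *\<^sub>R z))\<^sup>2"
  shows "inner r z = 0"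
proof (cases "z = 0")
  case False
  let ?t = "inner r z / (norm z)\<^sup>2"
  have "(norm (r - ?t *\<^sub>R z))\<^sup>2 = (norm r)\<^sup>2 - (inner r z)\<^sup>2 / (norm z)\<^sup>2"
    using False unfolding power2_norm_eq_inner
    by (simp add: inner_diff_left inner_diff_right inner_commute field_simps power2_eq_square)
  with assms[of ?t] have "(inner r z)\<^sup>2 / (norm z)\<^sup>2 \<le> 0" by simp
  then show ?thesis using False by (simp add: divide_le_0_iff)
qed simp

lemma orthogonal_projection_exists:
  fixes x :: "'a::chilbert_space"
  assumes "closed_csubspace M"
  shows "\<exists>y\<in>M. \<forall>z\<in>M. cinner z (x - y) = 0"
proof -
  have cl: "closed M" and M: "0 \<in> M" "\<And>x y. x \<in> M \<Longrightarrow> y \<in> M \<Longrightarrow> x + y \<in> M"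
    "\<And>c x. x \<in> M \<Longrightarrow> c *\<^sub>C x \<in> M"
    using assms by (auto simp: closed_csubspace_def)
  define \<delta> where "\<delta> = (INF y\<in>M. (norm (x - y))\<^sup>2)"
  have bb: "bdd_below ((\<lambda>y. (norm (x - y))\<^sup>2) ` M)" by (intro bdd_belowI2[where m=0]) auto
  have low: "\<delta> \<le> (norm (x - y))\<^sup>2" if "y \<in> M" for y
    unfolding \<delta>_def using bb that by (rule cINF_lower)
  have "\<exists>y\<in>M. (norm (x - y))\<^sup>2 < \<delta> + 1 / real (Suc n)" for n
  proof -
    have "\<delta> < \<delta> + 1 / real (Suc n)" by simp
    then show ?thesis unfolding \<delta>_def using cINF_less_iff[OF _ bb] M(1) by blast
  qed
  then obtain y where yM: "\<And>n. y n \<in> M" and y: "\<And>n. (norm (x - y n))\<^sup>2 < \<delta> + 1 / real (Suc n)"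
    by metis
  \<comment> \<open>Parallelogram identity: the midpoint lies in \<open>M\<close>, so its squared
    distance to \<open>x\<close> is at least \<open>\<delta>\<close>.\<close>
  have par: "(norm (y n - y m))\<^sup>2 \<le> 2 / real (Suc n) + 2 / real (Suc m)" for n m
  proof -
    let ?mid = "(1/2) *\<^sub>C (y n + y m)"
    have m: "?mid = (1/2::real) *\<^sub>R (y n + y m)" by (simp add: scaleR_scaleC)
    have "(norm (y n - y m))\<^sup>2 = 2 * (norm (x - y n))\<^sup>2 + 2 * (norm (x - y m))\<^sup>2 - 4 * (norm (x - ?mid))\<^sup>2"
      unfolding m power2_norm_eq_inner
      by (simp add: inner_diff_left inner_diff_right inner_add_left inner_add_right inner_commute algebra_simps)
    moreover have "\<delta> \<le> (norm (x - ?mid))\<^sup>2" by (intro low M yM)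
    ultimately show ?thesis using y[of n] y[of m] by simp
  qed
  have "Cauchy y"
  proof (rule metric_CauchyI)
    fix e :: real assume "e > 0"
    obtain N where N: "1 / real (Suc N) < e\<^sup>2 / 4"
      using nat_approx_posE[of "e\<^sup>2/4"] \<open>e > 0\<close> by auto
    have "dist (y n) (y m) < e" if "n \<ge> N" "m \<ge> N" for n m
    proof -
      have "1 / real (Suc n) \<le> 1 / real (Suc N)" "1 / real (Suc m) \<le> 1 / real (Suc N)"
        using that by (auto intro!: divide_left_mono)
      then have "(norm (y n - y m))\<^sup>2 < e\<^sup>2" using par[of n m] N by simp
      then show ?thesis unfolding dist_norm by (rule power2_less_imp_less) (use \<open>e > 0\<close> in simp)
    qed
    then show "\<exists>M. \<forall>m\<ge>M. \<forall>n\<ge>M. dist (y m) (y n) < e" by blast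
  qed
  then obtain y0 where y0: "y \<longlonglongrightarrow> y0" by (auto simp: Cauchy_convergent_iff convergent_def)
  have y0M: "y0 \<in> M" using closed_sequentially[OF cl _ y0] yM by blast
  have "(\<lambda>n. (norm (x - y n))\<^sup>2) \<longlonglongrightarrow> (norm (x - y0))\<^sup>2"
    by (intro tendsto_intros y0)
  moreover have "(\<lambda>n. \<delta> + 1 / real (Suc n)) \<longlonglongrightarrow> \<delta> + 0"
    by (intro tendsto_add tendsto_const LIMSEQ_Suc lim_1_over_n)
  ultimately have min: "(norm (x - y0))\<^sup>2 \<le> \<delta>"
    using y by (intro LIMSEQ_le[of _ _ "\<lambda>n. \<delta> + 1 / real (Suc n)"]) (auto intro: less_imp_le exI[of _ 0])
  have re: "Re (cinner z (x - y0)) = 0" if "z \<in> M" for z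
  proof -
    have "inner (x - y0) z = 0"
    proof (rule orthogonal_if_nearest)
      fix t :: real
      have "y0 + t *\<^sub>R z \<in> M" using M y0M that by (simp add: scaleR_scaleC)
      from low[OF this] min show "(norm (x - y0))\<^sup>2 \<le> (norm (x - y0 - t *\<^sub>R z))\<^sup>2"
        unfolding diff_diff_add by (rule order_trans[rotated])
    qed
    then show ?thesis by (metis inner_commute inner_eq_Re_cinner)
  qed
  \<comment> \<open>The minimality argument is over the reals; testing with
    \<open>\<i> *\<^sub>C z\<close> as well yields the imaginary part.\<close>
  have "cinner z (x - y0) = 0" if "z \<in> M" for z
    using re[OF that] re[OF M(3)[OF that, of "\<i>"]] by (simp add: cinner_scaleC_left complex_eq_iff)
  then show ?thesis using y0M by blast
qed

lemma orth_proj_eqI: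
  assumes "closed_csubspace M" "y \<in> M" "\<And>z. z \<in> M \<Longrightarrow> cinner z (x - y) = 0"
  shows "orth_proj M x = y"
  unfolding orth_proj_def
proof (rule the_equality)
  fix y' assume y': "y' \<in> M \<and> (\<forall>z\<in>M. cinner z (x - y') = 0)"
  then have "y - y' \<in> M" using assms closed_csubspace_diff by blast
  then have "cinner (y - y') (x - y') - cinner (y - y') (x - y) = 0" using y' assms(3) by simp
  then have "cinner (y - y') (y - y') = 0" by (simp add: cinner.diff_right[symmetric])
  then show "y' = y" by simp
qed (use assms in auto)

lemma orth_proj:
  assumes "closed_csubspace M"
  shows orth_proj_in: "orth_proj M x \<in> M"
    and orth_proj_orthogonal: "z \<in> M \<Longrightarrow> cinner z (x - orth_proj M x) = 0"
proof -
  obtain y where y: "y \<in> M" "\<And>z. z \<in> M \<Longrightarrow> cinner z (x - y) = 0"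
    using orthogonal_projection_exists[OF assms, of x] by blast
  have "orth_proj M x = y" by (rule orth_proj_eqI[OF assms y])
  then show "orth_proj M x \<in> M" "z \<in> M \<Longrightarrow> cinner z (x - orth_proj M x) = 0" using y by auto
qed

lemma orth_proj_cinner:
  assumes "closed_csubspace M" "z \<in> M"
  shows "cinner z (orth_proj M x) = cinner z x"
  using orth_proj_orthogonal[OF assms, of x] by (simp add: cinner.diff_right)

lemma orth_proj_selfadjoint:
  assumes "closed_csubspace M"
  shows "cinner (orth_proj M x) y = cinner x (orth_proj M y)"
proof -
  have "cinner (orth_proj M x) y = cinner (orth_proj M x) (orth_proj M y)"
    using assms by (simp add: orth_proj_cinner orth_proj_in)
  also have "\<dots> = cnj (cinner (orth_proj M y) x)"
    using assms by (subst cinner_commute) (simp add: orth_proj_cinner orth_proj_in)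
  finally show ?thesis by (simp add: cinner_commute[of x])
qed

lemma orth_proj_ident: "closed_csubspace M \<Longrightarrow> x \<in> M \<Longrightarrow> orth_proj M x = x"
  by (rule orth_proj_eqI) auto

lemma orth_proj_cinner_self:
  assumes "closed_csubspace M"
  shows "cinner (orth_proj M x) x = complex_of_real ((norm (orth_proj M x))\<^sup>2)"
  using orth_proj_cinner[OF assms orth_proj_in[OF assms], of x x] by (simp add: cinner_self)

lemma norm_orth_proj_le:
  assumes "closed_csubspace M"
  shows "norm (orth_proj M x) \<le> norm x"
proof -
  have "(norm (orth_proj M x))\<^sup>2 \<le> (norm x)\<^sup>2"
    using bessel_finite[of "{()}" "\<lambda>_. orth_proj M x" x] orth_proj_cinner_self[OF assms, of x] by simp
  then show ?thesis by (rule power2_le_imp_le) simp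
qed

lemma bounded_clinear_orth_proj:
  assumes M: "closed_csubspace M"
  shows "bounded_clinear (orth_proj M)"
proof (rule bounded_clinearI[where K=1])
  fix x y c
  have *: "orth_proj M x + orth_proj M y \<in> M" "c *\<^sub>C orth_proj M x \<in> M"
    using M orth_proj_in[OF M] by (auto simp: closed_csubspace_def)
  show "orth_proj M (x + y) = orth_proj M x + orth_proj M y"
    using M * by (intro orth_proj_eqI) (auto simp: cinner.diff_right cinner.add_right orth_proj_cinner)
  show "orth_proj M (c *\<^sub>C x) = c *\<^sub>C orth_proj M x"
    using M * by (intro orth_proj_eqI) (auto simp: cinner.diff_right cinner_scaleC_right orth_proj_cinner)
qed (simp add: norm_orth_proj_le[OF M])

section \<open>Spectral projections\<close>

lemma closed_csubspace_eigenspace: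
  assumes "bounded_clinear A"
  shows "closed_csubspace (eigenspace A a)"
proof -
  interpret bounded_linear A using assms by (rule bounded_clinear_bounded_linear)
  have "closed {x. A x = complex_of_real a *\<^sub>C x}"
    by (intro closed_Collect_eq continuous_on continuous_intros
        bounded_linear.continuous_on[OF scaleC.bounded_linear_right])
  then show ?thesis
    using bounded_clinear_scaleC[OF assms]
    by (auto simp: closed_csubspace_def eigenspace_def zero add scaleC.zero_right scaleC_add_right
        scaleC_scaleC mult.commute)
qed

lemma eigenproj_in: "bounded_clinear A \<Longrightarrow> eigenproj A a x \<in> eigenspace A a"
  by (simp add: eigenproj_def orth_proj_in closed_csubspace_eigenspace)

lemma eigenproj_eigenvector:
  "bounded_clinear A \<Longrightarrow> A (eigenproj A a x) = complex_of_real a *\<^sub>C eigenproj A a x"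
  using eigenproj_in[of A a x] by (simp add: eigenspace_def)

lemma eigenproj_ident: "bounded_clinear A \<Longrightarrow> x \<in> eigenspace A a \<Longrightarrow> eigenproj A a x = x"
  by (simp add: eigenproj_def orth_proj_ident closed_csubspace_eigenspace)

lemma eigenproj_idem: "bounded_clinear A \<Longrightarrow> eigenproj A a (eigenproj A a x) = eigenproj A a x"
  by (simp add: eigenproj_ident eigenproj_in)

lemma bounded_clinear_eigenproj: "bounded_clinear A \<Longrightarrow> bounded_clinear (eigenproj A a)"
  unfolding eigenproj_def by (intro bounded_clinear_orth_proj closed_csubspace_eigenspace)

lemma eigenproj_selfadjoint:
  "bounded_clinear A \<Longrightarrow> cinner (eigenproj A a x) y = cinner x (eigenproj A a y)"
  unfolding eigenproj_def by (intro orth_proj_selfadjoint closed_csubspace_eigenspace)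

lemma eigenproj_cinner_self:
  "bounded_clinear A \<Longrightarrow> cinner (eigenproj A a x) x = complex_of_real ((norm (eigenproj A a x))\<^sup>2)"
  unfolding eigenproj_def by (intro orth_proj_cinner_self closed_csubspace_eigenspace)

lemma eigenspaces_orthogonal:
  assumes A: "selfadjoint_op A" and "x \<in> eigenspace A a" "y \<in> eigenspace A b" "a \<noteq> b"
  shows "cinner x y = 0"
proof -
  have "complex_of_real a * cinner x y = complex_of_real b * cinner x y"
    using selfadjoint_op_cinner[OF A, of x y] assms(2,3)
    by (simp add: eigenspace_def cinner_scaleC_left cinner_scaleC_right)
  then show ?thesis using assms(4) by simp
qed

lemma eigenproj_eigenproj_neq:
  assumes A: "selfadjoint_op A" and "a \<noteq> b"
  shows "eigenproj A b (eigenproj A a x) = 0"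
proof -
  note A' = selfadjoint_op_bounded_clinear[OF A]
  show ?thesis unfolding eigenproj_def[of A b]
  proof (rule orth_proj_eqI[OF closed_csubspace_eigenspace[OF A']])
    fix z assume "z \<in> eigenspace A b"
    then show "cinner z (eigenproj A a x - 0) = 0"
      using eigenspaces_orthogonal[OF A _ eigenproj_in[OF A']] assms(2) by auto
  qed (use closed_csubspace_eigenspace[OF A'] in \<open>auto simp: closed_csubspace_def\<close>)
qed

text \<open>The remainder \<open>x - y\<close> is killed by every spectral projection, hence by
  \<open>A\<close>, so it lies in the eigenspace of 0. If it were nonzero, 0 would be an eigenvalue
  whose projection both fixes and kills it.\<close>

lemma resolution_of_identity:
  assumes A: "selfadjoint_op A" and dec: "has_spectral_decomposition A"
  shows "((\<lambda>a. eigenproj A a x) has_sum x) (eigenvalues A)"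
proof -
  note A' = selfadjoint_op_bounded_clinear[OF A]
  obtain y where y: "((\<lambda>a. eigenproj A a x) has_sum y) (eigenvalues A)"
  proof (rule orthogonal_has_sum[of "eigenvalues A" "\<lambda>a. eigenproj A a x" x])
    show "cinner (eigenproj A a x) (eigenproj A b x) = 0" if "a \<noteq> b" for a b
      using eigenspaces_orthogonal[OF A eigenproj_in[OF A'] eigenproj_in[OF A'] that] .
  qed (use eigenproj_cinner_self[OF A'] in auto)
  have P0: "eigenproj A a (x - y) = 0" if a: "a \<in> eigenvalues A" for a
  proof -
    interpret P: bounded_linear "eigenproj A a"
      by (intro bounded_clinear_bounded_linear bounded_clinear_eigenproj A')
    have "((\<lambda>b. eigenproj A a (eigenproj A b x)) has_sum eigenproj A a y) (eigenvalues A)"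
      by (rule has_sum_bounded_linear[OF P.bounded_linear_axioms y])
    moreover have "((\<lambda>b. eigenproj A a (eigenproj A b x)) has_sum eigenproj A a x) {a}"
      by (simp add: has_sum_finiteI eigenproj_idem[OF A'])
    then have "((\<lambda>b. eigenproj A a (eigenproj A b x)) has_sum eigenproj A a x) (eigenvalues A)"
      by (rule has_sum_cong_neutral[THEN iffD1, rotated -1])
         (use a eigenproj_eigenproj_neq[OF A] in auto)
    ultimately show ?thesis by (auto simp: P.diff dest: has_sum_unique)
  qed
  have "((\<lambda>a. complex_of_real a *\<^sub>C eigenproj A a (x - y)) has_sum A (x - y)) (eigenvalues A)"
    using dec by (auto simp: has_spectral_decomposition_def)
  moreover have "((\<lambda>a. complex_of_real a *\<^sub>C eigenproj A a (x - y)) has_sum 0) (eigenvalues A)"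
    by (intro has_sum_0) (simp add: P0 scaleC.zero_right)
  ultimately have "A (x - y) = 0" using has_sum_unique by blast
  then have ker: "x - y \<in> eigenspace A 0" by (simp add: eigenspace_def scaleC.zero_left)
  have "x - y = 0"
  proof (rule ccontr)
    assume "x - y \<noteq> 0"
    then have "0 \<in> eigenvalues A" using ker unfolding eigenvalues_def by blast
    then show False using P0 eigenproj_ident[OF A' ker] \<open>x - y \<noteq> 0\<close> by simp
  qed
  then show ?thesis using y by simp
qed

section \<open>Square roots, traces and exponentials\<close>

text \<open>Polarisation: the quadratic form is real at \<open>x + y\<close> and at
  \<open>x + \<i> *\<^sub>C y\<close>, which fixes the imaginary and the real part of
  \<open>cinner x (T y)\<close> in terms of \<open>cinner y (T x)\<close>.\<close>

lemma positive_op_selfadjoint: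
  assumes "positive_op T"
  shows "selfadjoint_op T"
proof -
  have T: "bounded_clinear T" and pos: "\<And>x. cinner x (T x) \<in> \<real>\<^sub>\<ge>\<^sub>0"
    using assms by (auto simp: positive_op_def)
  interpret bounded_linear T using T by (rule bounded_clinear_bounded_linear)
  have im: "Im (cinner x (T x)) = 0" for x
    using pos[of x] by (auto simp: complex_nonneg_Reals_iff)
  have "cinner (T x) y = cinner x (T y)" for x y
  proof -
    have "Im (cinner x (T y)) + Im (cinner y (T x)) = 0"
      using im[of "x + y"] im[of x] im[of y] by (simp add: add cinner.add_left cinner.add_right)
    moreover have "Re (cinner x (T y)) - Re (cinner y (T x)) = 0"
      using im[of "x + \<i> *\<^sub>C y"] im[of x] im[of y]
      by (simp add: add bounded_clinear_scaleC[OF T] cinner.add_left cinner.add_right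
          cinner_scaleC_left cinner_scaleC_right)
    ultimately show ?thesis
      by (subst cinner_commute) (simp add: complex_eq_iff)
  qed
  then show ?thesis using T by (auto simp: selfadjoint_op_def)
qed

text \<open>The scalar recursion \<open>y \<mapsto> (1 + y\<^sup>2) / 2\<close> dominates the operator recursion
  \<open>Y \<mapsto> (X + Y\<^sup>2) / 2\<close> whose limit \<open>L\<close> satisfies \<open>(1 - L)\<^sup>2 = 1 - X\<close>, so that the latter converges
  in norm.\<close>

lemma sqrt_iteration_limit:
  fixes X :: "'a::banach \<Rightarrow>\<^sub>L 'a"
  assumes X: "norm X \<le> 1"
    and Y0: "Y 0 = 0" and YSuc: "\<And>n. Y (Suc n) = (1/2) *\<^sub>R (X + (Y n o\<^sub>L Y n))"
  obtains L where "Y \<longlonglongrightarrow> L" "L = (1/2) *\<^sub>R (X + (L o\<^sub>L L))"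
proof -
  define y where "y = rec_nat (0::real) (\<lambda>_ r. (1 + r\<^sup>2) / 2)"
  have y0: "y 0 = 0" and ySuc: "y (Suc n) = (1 + (y n)\<^sup>2) / 2" for n
    by (simp_all add: y_def)
  have y01: "0 \<le> y n \<and> y n \<le> 1" for n
    by (induction n) (auto simp: y0 ySuc power_le_one)
  have inv: "norm (Y n) \<le> y n \<and> norm (Y (Suc n) - Y n) \<le> y (Suc n) - y n" for n
  proof (induction n)
    case 0
    then show ?case using X by (simp add: Y0 YSuc y0 ySuc blinfun_eqI blinfun.bilinear_simps bounded_bilinear.zero_left[OF bounded_bilinear_blinfun_compose])
  next
    case (Suc n)
    have nY: "norm (Y (Suc n)) \<le> y (Suc n)"
      using norm_triangle_sub[of "Y (Suc n)" "Y n"] Suc by simp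
    \<comment> \<open>\<open>Z\<^sup>2 - W\<^sup>2 = Z (Z - W) + (Z - W) W\<close> holds without
      commutation. The scalar version of the same identity turns the resulting norm bound into
      exactly the next increment of \<open>y\<close>.\<close>
    have factor: "(1/2) *\<^sub>R (X + (Z o\<^sub>L Z)) - (1/2) *\<^sub>R (X + (W o\<^sub>L W)) =
        (1/2) *\<^sub>R ((Z o\<^sub>L (Z - W)) + ((Z - W) o\<^sub>L W))" for Z W
      by (intro blinfun_eqI) (simp add: blinfun.bilinear_simps algebra_simps)
    have "Y (Suc (Suc n)) - Y (Suc n) =
        (1/2) *\<^sub>R ((Y (Suc n) o\<^sub>L (Y (Suc n) - Y n)) + ((Y (Suc n) - Y n) o\<^sub>L Y n))"
      using arg_cong2[where f=minus, OF YSuc[of "Suc n"] YSuc[of n]] unfolding factor .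
    then have "norm (Y (Suc (Suc n)) - Y (Suc n)) \<le>
        (1/2) * (norm (Y (Suc n)) * norm (Y (Suc n) - Y n) + norm (Y (Suc n) - Y n) * norm (Y n))"
      by (simp, intro norm_triangle_mono norm_blinfun_compose)
    also have "\<dots> \<le> (1/2) * (y (Suc n) * (y (Suc n) - y n) + (y (Suc n) - y n) * y n)"
      using Suc nY y01 order_trans[OF norm_ge_zero conjunct2[OF Suc]]
      by (intro mult_left_mono add_mono mult_mono) auto
    also have "\<dots> = (1 + (y (Suc n))\<^sup>2) / 2 - (1 + (y n)\<^sup>2) / 2"
      by (simp add: field_simps power2_eq_square)
    also have "\<dots> = y (Suc (Suc n)) - y (Suc n)"
      unfolding ySuc[of "Suc n", symmetric] ySuc[of n, symmetric] ..
    finally show ?case using nY by simp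
  qed
  have mono: "norm (Y m - Y n) \<le> y m - y n" if "n \<le> m" for m n
    using that
  proof (induction m rule: dec_induct)
    case (step m)
    have "norm (Y (Suc m) - Y n) \<le> norm (Y (Suc m) - Y m) + norm (Y m - Y n)"
      by (metis norm_triangle_ineq diff_add_cancel add_diff_eq)
    then show ?case using step inv[of m] by simp
  qed simp
  have "incseq y"
    unfolding incseq_def using order_trans[OF norm_ge_zero mono] by force
  then obtain l where "y \<longlonglongrightarrow> l"
    using incseq_convergent[of y 1] y01 by blast
  then have "Cauchy y" by (rule LIMSEQ_imp_Cauchy)
  have "Cauchy Y"
  proof (rule CauchyI)
    fix e :: real assume "0 < e"
    then obtain M where M: "\<And>m n. m \<ge> M \<Longrightarrow> n \<ge> M \<Longrightarrow> norm (y m - y n) < e"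
      using CauchyD[OF \<open>Cauchy y\<close>] by blast
    have "norm (Y m - Y n) < e" if "m \<ge> M" "n \<ge> M" for m n
    proof (cases "n \<le> m")
      case True
      then show ?thesis using mono[OF True] M[OF that] by simp
    next
      case False
      then have "n \<ge> m" by simp
      then show ?thesis using mono[of m n] M[OF that] by (simp add: norm_minus_commute)
    qed
    then show "\<exists>M. \<forall>m\<ge>M. \<forall>n\<ge>M. norm (Y m - Y n) < e" by blast
  qed
  then obtain L where L: "Y \<longlonglongrightarrow> L" by (auto simp: Cauchy_convergent_iff convergent_def)
  have "(\<lambda>n. Y (Suc n)) \<longlonglongrightarrow> (1/2) *\<^sub>R (X + (L o\<^sub>L L))"
    unfolding YSuc by (intro tendsto_intros L bounded_bilinear.tendsto[OF bounded_bilinear_blinfun_compose])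
  then have "L = (1/2) *\<^sub>R (X + (L o\<^sub>L L))"
    using LIMSEQ_Suc[OF L] LIMSEQ_unique by blast
  then show ?thesis using L that by blast
qed

text \<open>The iteration is run with \<open>X = 1 - R\<close>, so that the root is
  \<open>S = 1 - L\<close>. What has to be shown is that \<open>X\<close> is a contraction
  too.\<close>

lemma positive_op_sqrt_contraction:
  fixes R :: "'a::chilbert_space \<Rightarrow> 'a"
  assumes R: "positive_op R" and contr: "\<And>x. norm (R x) \<le> norm x"
  obtains S where "selfadjoint_op S" "\<And>x. S (S x) = R x"
proof -
  have Rc: "bounded_clinear R" and Rsa: "\<And>x y. cinner (R x) y = cinner x (R y)"
    using positive_op_selfadjoint[OF R] by (auto simp: selfadjoint_op_def)
  interpret R: bounded_linear R using Rc by (rule bounded_clinear_bounded_linear)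
  have pos: "0 \<le> inner x (R x)" for x
    using R by (auto simp: positive_op_def inner_eq_Re_cinner complex_nonneg_Reals_iff)
  have sym: "inner (R x) y = inner x (R y)" for x y
    by (simp add: inner_eq_Re_cinner Rsa)
  have bl: "bounded_linear (\<lambda>x. x - R x)" by (intro bounded_linear_intros R.bounded_linear_axioms)
  define X where "X = Blinfun (\<lambda>x. x - R x)"
  have X: "blinfun_apply X x = x - R x" for x
    by (simp add: X_def bounded_linear_Blinfun_apply[OF bl])
  have nX: "norm X \<le> 1"
  proof (rule norm_blinfun_bound)
    fix x
    \<comment> \<open>Positivity at the vector \<open>x - R x\<close>, together with the contraction
      property, gives \<open>(norm (R x))\<^sup>2 \<le> inner x (R x)\<close>, a form of
      \<open>R\<^sup>2 \<le> R\<close>.\<close>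
    have "0 \<le> inner (x - R x) (R (x - R x))" by (rule pos)
    also have "\<dots> = inner x (R x) - 2 * (norm (R x))\<^sup>2 + inner (R x) (R (R x))"
      by (simp add: R.diff inner_diff_left inner_diff_right sym power2_norm_eq_inner)
    also have "inner (R x) (R (R x)) \<le> (norm (R x))\<^sup>2"
      using norm_cauchy_schwarz[of "R x" "R (R x)"] mult_left_mono[OF contr[of "R x"] norm_ge_zero[of "R x"]]
      by (simp add: power2_eq_square)
    finally have "(norm (R x))\<^sup>2 \<le> inner x (R x)" by simp
    moreover have "(norm (x - R x))\<^sup>2 = (norm x)\<^sup>2 - 2 * inner x (R x) + (norm (R x))\<^sup>2"
      by (simp add: power2_norm_eq_inner inner_diff_left inner_diff_right inner_commute)
    ultimately have "(norm (x - R x))\<^sup>2 \<le> (norm x)\<^sup>2" using pos[of x] by simp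
    then show "norm (blinfun_apply X x) \<le> 1 * norm x"
      unfolding X mult_1_left by (rule power2_le_imp_le) simp
  qed simp
  define Y where "Y = rec_nat (0 :: 'a \<Rightarrow>\<^sub>L 'a) (\<lambda>_ Z. (1/2) *\<^sub>R (X + (Z o\<^sub>L Z)))"
  have Y: "Y 0 = 0" "\<And>n. Y (Suc n) = (1/2) *\<^sub>R (X + (Y n o\<^sub>L Y n))"
    by (simp_all add: Y_def)
  obtain L where L: "Y \<longlonglongrightarrow> L" "L = (1/2) *\<^sub>R (X + (L o\<^sub>L L))"
    using sqrt_iteration_limit[OF nX Y] by blast
  \<comment> \<open>Elements of the operator type are only real linear, so complex homogeneity and
    symmetry are carried through the iteration and then passed to the limit.\<close>
  have Yc: "blinfun_apply (Y n) (c *\<^sub>C x) = c *\<^sub>C blinfun_apply (Y n) x" for n c x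
    by (induction n arbitrary: x)
       (simp_all add: Y blinfun.bilinear_simps X bounded_clinear_scaleC[OF Rc] scaleR_scaleC[where 'a='a]
         scaleC_scaleC mult.commute scaleC.diff_right scaleC.add_right)
  have Ysa: "cinner (blinfun_apply (Y n) x) y = cinner x (blinfun_apply (Y n) y)" for n x y
    by (induction n arbitrary: x y)
       (simp_all add: Y blinfun.bilinear_simps X Rsa cinner.diff_left cinner.diff_right
         cinner.add_left cinner.add_right cinner.scaleR_left cinner.scaleR_right)
  have lim: "(\<lambda>n. blinfun_apply (Y n) x) \<longlonglongrightarrow> blinfun_apply L x" for x
    by (intro tendsto_intros L)
  have Lc: "blinfun_apply L (c *\<^sub>C x) = c *\<^sub>C blinfun_apply L x" for c x
    by (rule LIMSEQ_unique[OF lim]) (simp only: Yc, intro scaleC.tendsto tendsto_const lim)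
  have "(\<lambda>n. cinner (blinfun_apply (Y n) x) y) \<longlonglongrightarrow> cinner (blinfun_apply L x) y" for x y
    by (intro cinner.tendsto tendsto_const lim)
  moreover have "(\<lambda>n. cinner (blinfun_apply (Y n) x) y) \<longlonglongrightarrow> cinner x (blinfun_apply L y)" for x y
    unfolding Ysa by (intro cinner.tendsto tendsto_const lim)
  ultimately have Lsa: "cinner (blinfun_apply L x) y = cinner x (blinfun_apply L y)" for x y
    using LIMSEQ_unique by blast
  define S where "S = (\<lambda>x. x - blinfun_apply L x)"
  show ?thesis
  proof
    show "selfadjoint_op S"
      unfolding selfadjoint_op_def bounded_clinear_def S_def
      by (auto simp: Lc Lsa scaleC.diff_right cinner.diff_left cinner.diff_right intro!: bounded_linear_intros
          blinfun.bounded_linear_right)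
    show "S (S x) = R x" for x
    proof -
      have "2 *\<^sub>R blinfun_apply L x = blinfun_apply X x + blinfun_apply L (blinfun_apply L x)"
        by (subst L(2)) (simp add: blinfun.bilinear_simps)
      then show ?thesis by (simp add: S_def X blinfun.bilinear_simps scaleR_2 algebra_simps)
    qed
  qed
qed

text \<open>Dividing \<open>T\<close> by a norm bound \<open>K\<close> gives a contraction; its root
  is multiplied by \<open>sqrt K\<close>.\<close>

lemma positive_op_sqrt:
  fixes T :: "'a::chilbert_space \<Rightarrow> 'a"
  assumes T: "positive_op T"
  obtains S where "selfadjoint_op S" "\<And>x. S (S x) = T x"
proof -
  have Tc: "bounded_clinear T" using T by (auto simp: positive_op_def)
  obtain K where K: "K > 0" "\<And>x. norm (T x) \<le> norm x * K"
    using bounded_linear.pos_bounded[OF bounded_clinear_bounded_linear[OF Tc]] by blast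
  define R where "R = (\<lambda>x. complex_of_real (1/K) *\<^sub>C T x)"
  have "positive_op R"
    using T K(1) bounded_clinear_scale[OF Tc]
    by (auto simp: positive_op_def R_def cinner_scaleC_right complex_nonneg_Reals_iff)
  moreover have "norm (R x) \<le> norm x" for x
    using K(1) K(2)[of x] by (simp add: R_def norm_scaleC norm_divide field_simps)
  ultimately obtain S where S: "selfadjoint_op S" "\<And>x. S (S x) = R x"
    using positive_op_sqrt_contraction by blast
  define k where "k = complex_of_real (sqrt K)"
  have Sc: "S (c *\<^sub>C x) = c *\<^sub>C S x" for c x
    by (rule bounded_clinear_scaleC[OF selfadjoint_op_bounded_clinear[OF S(1)]])
  have k: "k * k * complex_of_real (1/K) = 1"
    using K(1) by (simp add: k_def flip: of_real_mult)
  show ?thesis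
  proof (rule that[of "\<lambda>x. k *\<^sub>C S x"])
    show "selfadjoint_op (\<lambda>x. k *\<^sub>C S x)"
      using S(1) bounded_clinear_scale
      by (auto simp: selfadjoint_op_def cinner_scaleC_left cinner_scaleC_right k_def)
    show "k *\<^sub>C S (k *\<^sub>C S x) = T x" for x
      by (simp only: Sc S(2) R_def scaleC_scaleC) (use k in simp)
  qed
qed

text \<open>Fubini for unordered sums with a dominating family \<open>h\<close> whose row totals
  \<open>H\<close> are summable. Summability of the row sums \<open>r\<close> and of the column sums
  \<open>s\<close> is part of the conclusion.\<close>

lemma has_sum_swap_dominated:
  fixes g :: "'i \<Rightarrow> 'j \<Rightarrow> 'b::banach"
  assumes le: "\<And>i j. i \<in> I \<Longrightarrow> j \<in> J \<Longrightarrow> norm (g i j) \<le> h i j"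
    and h: "\<And>i. i \<in> I \<Longrightarrow> (h i has_sum H i) J" "H summable_on I"
    and r: "\<And>i. i \<in> I \<Longrightarrow> (g i has_sum r i) J"
    and s: "\<And>j. j \<in> J \<Longrightarrow> ((\<lambda>i. g i j) has_sum s j) I"
  obtains t where "(r has_sum t) I" "(s has_sum t) J"
proof -
  have gabs: "(\<lambda>j. norm (g i j)) summable_on J" if "i \<in> I" for i
    by (rule summable_on_comparison_test[of "h i"]) (use le h(1) that in \<open>auto simp: summable_on_def\<close>)
  have "(\<Sum>\<^sub>\<infinity>j\<in>J. norm (g i j)) \<le> H i" if "i \<in> I" for i
    using has_sum_mono[OF has_sum_infsum[OF gabs[OF that]] h(1)[OF that]] le that by blast
  then have "(\<lambda>i. \<Sum>\<^sub>\<infinity>j\<in>J. norm (g i j)) summable_on I"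
    by (rule summable_on_comparison_test[OF h(2)]) (assumption, rule infsum_nonneg, rule norm_ge_zero)
  then have "(\<lambda>z. norm (case z of (i, j) \<Rightarrow> g i j)) summable_on I \<times> J"
    unfolding Infinite_Sum.abs_summable_on_Sigma_iff using gabs by (auto simp: infsum_nonneg)
  then have sm: "(\<lambda>(i, j). g i j) summable_on I \<times> J" by (rule abs_summable_summable)
  have sm': "(\<lambda>(j, i). g i j) summable_on J \<times> I"
  proof -
    have "(\<lambda>(j, i). g i j) summable_on J \<times> I \<longleftrightarrow> (\<lambda>(i, j). g i j) summable_on I \<times> J"
      by (rule summable_on_reindex_bij_witness[where i=prod.swap and j=prod.swap]) auto
    then show ?thesis using sm by simp
  qed
  have ri: "infsum (g i) J = r i" if "i \<in> I" for i using r[OF that] by (rule infsumI)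
  have sj: "(\<Sum>\<^sub>\<infinity>i\<in>I. g i j) = s j" if "j \<in> J" for j using s[OF that] by (rule infsumI)
  have "r summable_on I" using summable_on_Sigma_banach[OF sm] ri by (simp cong: summable_on_cong)
  moreover have "s summable_on J" using summable_on_Sigma_banach[OF sm'] sj by (simp cong: summable_on_cong)
  moreover have "infsum r I = infsum s J"
    using infsum_swap_banach[OF sm] ri sj by (simp cong: infsum_cong)
  ultimately show ?thesis using that[of "infsum r I"] has_sum_infsum[of r I] has_sum_infsum[of s J] by simp
qed

text \<open>Insert the basis: \<open>\<langle>S f, T S f\<rangle>\<close> is the sum over
  \<open>e\<close> of \<open>\<langle>S f, e\<rangle> \<langle>e, T S f\<rangle>\<close>. Summing
  over \<open>f\<close> first instead gives \<open>\<langle>e, T S S e\<rangle>\<close>, the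
  diagonal entries of \<open>T \<circ> \<rho>\<close>.\<close>

lemma density_operator_trace_formula:
  fixes \<rho> :: "'a::chilbert_space \<Rightarrow> 'a"
  assumes \<rho>: "density_operator \<rho>"
  obtains S E where "selfadjoint_op S" "\<And>x. S (S x) = \<rho> x" "is_onb E"
    "\<And>T. bounded_clinear T \<Longrightarrow> ((\<lambda>e. cinner (S e) (T (S e))) has_sum trace_op (T \<circ> \<rho>)) E"
    "((\<lambda>e. (norm (S e))\<^sup>2) has_sum 1) E"
proof -
  have "positive_op \<rho>" using \<rho> by (simp add: density_operator_def)
  then obtain S where S: "selfadjoint_op S" "\<And>x. S (S x) = \<rho> x"
    using positive_op_sqrt by blast
  note Sc = selfadjoint_op_bounded_clinear[OF S(1)] and Ssa = selfadjoint_op_cinner[OF S(1)]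
  define E :: "'a set" where "E = (SOME E. is_onb E)"
  \<comment> \<open>An orthonormal basis comes with \<open>trace_class\<close>, so the
    \<open>SOME\<close> in \<open>trace_op\<close> really denotes one.\<close>
  have "\<exists>E :: 'a set. is_onb E"
    using \<rho> unfolding density_operator_def trace_class_def by blast
  then have E: "is_onb E" unfolding E_def by (rule someI_ex)
  have tr: "trace_op T = (\<Sum>\<^sub>\<infinity>e\<in>E. cinner e (T e))" for T
    by (simp add: trace_op_def E_def)
  have "cinner e (\<rho> e) = complex_of_real ((norm (S e))\<^sup>2)" for e
    by (simp only: S(2)[symmetric] Ssa[symmetric] cinner_self)
  then have one: "(\<Sum>\<^sub>\<infinity>e\<in>E. complex_of_real ((norm (S e))\<^sup>2)) = 1"
    using \<rho> tr[of \<rho>] unfolding density_operator_def by simp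
  \<comment> \<open>\<open>infsum\<close> has the default value 0 on families that are not summable,
    so the value 1 forces summability.\<close>
  then have "(\<lambda>e. complex_of_real ((norm (S e))\<^sup>2)) summable_on E"
    using infsum_not_exists[of "\<lambda>e. complex_of_real ((norm (S e))\<^sup>2)" E] by fastforce
  from has_sum_infsum[OF this]
  have "((\<lambda>e. complex_of_real ((norm (S e))\<^sup>2)) has_sum complex_of_real 1) E"
    unfolding one by simp
  then have S1: "((\<lambda>e. (norm (S e))\<^sup>2) has_sum 1) E"
    by (simp only: has_sum_of_real_iff)
  have "((\<lambda>e. cinner (S e) (T (S e))) has_sum trace_op (T \<circ> \<rho>)) E" if T: "bounded_clinear T" for T
  proof -
    obtain K where K: "\<And>x. norm (T x) \<le> norm x * K"
      using bounded_linear.bounded[OF bounded_clinear_bounded_linear[OF T]] by blast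
    define g where "g = (\<lambda>f e. cinner (S f) e * cinner e (T (S f)))"
    have gf: "((\<lambda>e. g f e) has_sum cinner (S f) (T (S f))) E" for f
      unfolding g_def by (rule parseval[OF E])
    have ge: "((\<lambda>f. g f e) has_sum cinner e (T (\<rho> e))) E" for e
    proof -
      have "bounded_linear (\<lambda>x. cinner e (T (S x)))"
        by (rule bounded_linear_compose[OF cinner.bounded_linear_right
              bounded_clinear_bounded_linear[OF bounded_clinear_compose[OF T Sc]]])
      from has_sum_bounded_linear[OF this onb_expansion[OF E, of "S e"]] show ?thesis
        by (simp add: bounded_clinear_scaleC[OF T] bounded_clinear_scaleC[OF Sc] cinner_scaleC_right
            S(2) g_def Ssa)
    qed
    \<comment> \<open>The inequality \<open>2ab \<le> a\<^sup>2 + b\<^sup>2\<close> decouples the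
      two factors. Parseval evaluates the row totals \<open>H f\<close>, which are at most a fixed
      multiple of \<open>(norm (S f))\<^sup>2\<close>.\<close>
    define h where "h = (\<lambda>f e. ((cmod (cinner e (S f)))\<^sup>2 + (cmod (cinner e (T (S f))))\<^sup>2) / 2)"
    define H where "H = (\<lambda>f. ((norm (S f))\<^sup>2 + (norm (T (S f)))\<^sup>2) / 2)"
    have h: "(h f has_sum H f) E" for f
      unfolding h_def H_def by (intro has_sum_divide_const has_sum_add parseval_norm[OF E])
    have le: "norm (g f e) \<le> h f e" for f e
      using sum_squares_bound[of "cmod (cinner e (S f))" "cmod (cinner e (T (S f)))"]
      by (simp add: g_def h_def norm_mult cinner_commute[of "S f" e])
    have "H f \<le> (norm (S f))\<^sup>2 * ((1 + K\<^sup>2) / 2)" for f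
    proof -
      have "(norm (T (S f)))\<^sup>2 \<le> (norm (S f) * K)\<^sup>2"
        by (intro power_mono K) simp
      then show ?thesis by (simp add: H_def algebra_simps)
    qed
    moreover have "(\<lambda>f. (norm (S f))\<^sup>2 * ((1 + K\<^sup>2) / 2)) summable_on E"
      using S1 by (intro summable_on_cmult_left) (auto simp: summable_on_def)
    ultimately have "H summable_on E"
      by (intro summable_on_comparison_test[of "\<lambda>f. (norm (S f))\<^sup>2 * ((1 + K\<^sup>2) / 2)" E H])
         (auto simp: H_def)
    obtain t where t: "((\<lambda>f. cinner (S f) (T (S f))) has_sum t) E"
        "((\<lambda>e. cinner e (T (\<rho> e))) has_sum t) E"
      by (rule has_sum_swap_dominated[OF le h \<open>H summable_on E\<close> gf ge])
    have "trace_op (T \<circ> \<rho>) = t"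
      unfolding tr o_def using t(2) by (rule infsumI)
    then show ?thesis using t(1) by simp
  qed
  then show ?thesis using that S E S1 by blast
qed

section \<open>Exponentials of bounded operators\<close>

lemma exp_op_summable:
  assumes T: "bounded_clinear T"
  shows "summable (\<lambda>n. (T ^^ n) x /\<^sub>R fact n)"
    and "\<exists>K. \<forall>x. norm (exp_op T x) \<le> norm x * K"
proof -
  obtain K where K: "K > 0" "\<And>x. norm (T x) \<le> norm x * K"
    using bounded_linear.pos_bounded[OF bounded_clinear_bounded_linear[OF T]] by blast
  have pow: "norm ((T ^^ n) x) \<le> norm x * K ^ n" for n x
  proof (induction n)
    case (Suc n)
    have "norm ((T ^^ Suc n) x) \<le> norm ((T ^^ n) x) * K" using K(2) by simp
    also have "\<dots> \<le> norm x * K ^ n * K" using Suc K(1) by (intro mult_right_mono) auto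
    finally show ?case by (simp add: mult_ac)
  qed simp
  have le: "norm ((T ^^ n) x /\<^sub>R fact n) \<le> norm x * (K ^ n /\<^sub>R fact n)" for n x
    using pow[of n x] by (simp add: field_simps)
  have sums: "(\<lambda>n. norm x * (K ^ n /\<^sub>R fact n)) sums (norm x * exp K)" for x :: 'a
    by (intro sums_mult exp_converges)
  show sm: "summable (\<lambda>n. (T ^^ n) x /\<^sub>R fact n)" for x
    by (rule summable_comparison_test'[OF sums_summable[OF sums[of x]], of 0]) (use le in auto)
  have "norm (exp_op T x) \<le> norm x * exp K" for x
    unfolding exp_op_def using suminf_le_const
    by (metis (no_types, lifting) le norm_suminf_le sums sums_iff)
  then show "\<exists>K. \<forall>x. norm (exp_op T x) \<le> norm x * K" by blast
qed

lemma bounded_clinear_exp_op: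
  assumes T: "bounded_clinear T"
  shows "bounded_clinear (exp_op T)"
proof -
  obtain K where K: "\<And>x. norm (exp_op T x) \<le> norm x * K" using exp_op_summable(2)[OF T] by blast
  have p: "bounded_clinear (T ^^ n)" for n by (rule bounded_clinear_funpow[OF T])
  show ?thesis
  proof (rule bounded_clinearI[OF _ _ K])
    show "exp_op T (x + y) = exp_op T x + exp_op T y" for x y
      unfolding exp_op_def suminf_add[OF exp_op_summable(1)[OF T] exp_op_summable(1)[OF T]]
      by (simp add: linear_add[OF bounded_linear.linear[OF bounded_clinear_bounded_linear[OF p]]] scaleR_add_right)
    show "exp_op T (c *\<^sub>C x) = c *\<^sub>C exp_op T x" for c x
      unfolding exp_op_def bounded_linear.suminf[OF scaleC.bounded_linear_right exp_op_summable(1)[OF T]]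
      by (simp add: bounded_clinear_scaleC[OF p] scaleC.scaleR_right)
  qed
qed

lemma exp_op_eigenvector:
  assumes T: "bounded_clinear T" and w: "T w = c *\<^sub>C w"
  shows "exp_op T w = exp c *\<^sub>C w"
proof -
  have "(T ^^ n) w = (c ^ n) *\<^sub>C w" for n
    by (induction n) (simp_all add: w bounded_clinear_scaleC[OF T] scaleC_scaleC mult.commute)
  then have "(T ^^ n) w /\<^sub>R fact n = (c ^ n /\<^sub>R fact n) *\<^sub>C w" for n
    by (simp add: scaleC.scaleR_left)
  moreover have "(\<lambda>n. (c ^ n /\<^sub>R fact n) *\<^sub>C w) sums (exp c *\<^sub>C w)"
    by (rule bounded_linear.sums[OF scaleC.bounded_linear_left exp_converges])
  ultimately show ?thesis by (simp add: exp_op_def sums_iff)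
qed

lemma bounded_clinear_unitary_exp: "bounded_clinear A \<Longrightarrow> bounded_clinear (unitary_exp s A)"
  unfolding unitary_exp_def by (intro bounded_clinear_exp_op bounded_clinear_scale)

lemma unitary_exp_eigenvector:
  assumes "bounded_clinear A" "A w = complex_of_real a *\<^sub>C w"
  shows "unitary_exp s A w = exp (\<i> * complex_of_real (s * a)) *\<^sub>C w"
  unfolding unitary_exp_def using assms
  by (subst exp_op_eigenvector[where c="\<i> * complex_of_real (s * a)"])
     (auto simp: scaleC_scaleC mult_ac intro: bounded_clinear_scale)

lemma bounded_clinear_ordered_exp:
  assumes "bounded_clinear A" "bounded_clinear B"
  shows "bounded_clinear (ordered_exp \<omega> A B \<theta>)"
  by (cases \<omega>; cases \<theta>)
     (auto intro!: bounded_clinear_funpow bounded_clinear_add bounded_clinear_scale bounded_clinear_exp_op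
       bounded_clinear_compose[OF bounded_clinear_unitary_exp bounded_clinear_unitary_exp] assms)

text \<open>On a joint eigenvector both products in the bracket multiply by the same phase
  \<open>c\<close>, so the weights enter only through their sum 1, and the \<open>N\<close>-th power
  undoes the division of the angles by \<open>N\<close>.\<close>

lemma ordered_exp_eigenvector:
  assumes A: "bounded_clinear A" and B: "bounded_clinear B" and \<omega>: "valid_ordering \<omega>"
    and a: "A w = complex_of_real a *\<^sub>C w" and b: "B w = complex_of_real b *\<^sub>C w"
  shows "ordered_exp \<omega> A B \<theta> w = exp (\<i> * complex_of_real (\<theta> \<bullet> (a, b))) *\<^sub>C w"
proof (cases \<theta>)
  case (Pair s t)
  show ?thesis
  proof (cases \<omega>)
    case Wigner
    have "\<i> *\<^sub>C (complex_of_real s *\<^sub>C A w + complex_of_real t *\<^sub>C B w)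
        = (\<i> * complex_of_real (s * a + t * b)) *\<^sub>C w"
      by (simp add: a b scaleC_scaleC flip: scaleC_add_left)
    then show ?thesis unfolding Wigner Pair
      using A B by (simp add: exp_op_eigenvector bounded_clinear_scale bounded_clinear_add)
  next
    case (Product N w1 w2)
    have N: "N \<ge> 1" and w12: "w1 + w2 = 1" using \<omega> by (auto simp: Product)
    define F where "F = (\<lambda>x. w1 *\<^sub>C unitary_exp (s / real N) A (unitary_exp (t / real N) B x) +
          w2 *\<^sub>C unitary_exp (t / real N) B (unitary_exp (s / real N) A x))"
    define c where "c = exp (\<i> * complex_of_real ((s * a + t * b) / real N))"
    note UA = bounded_clinear_unitary_exp[OF A] and UB = bounded_clinear_unitary_exp[OF B]
    have F: "bounded_clinear F" unfolding F_def
      by (intro bounded_clinear_add bounded_clinear_scale bounded_clinear_compose[OF UA UB]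
          bounded_clinear_compose[OF UB UA])
    have e: "exp (\<i> * complex_of_real (t / real N * b)) * exp (\<i> * complex_of_real (s / real N * a)) = c"
      unfolding c_def exp_add[symmetric] by (simp add: algebra_simps add_divide_distrib)
    have "F w = (w1 * c + w2 * c) *\<^sub>C w"
      unfolding F_def unitary_exp_eigenvector[OF A a] unitary_exp_eigenvector[OF B b]
        bounded_clinear_scaleC[OF UA] bounded_clinear_scaleC[OF UB] scaleC_scaleC scaleC_add_left e[symmetric]
      by (simp only: mult_ac)
    then have Fw: "F w = c *\<^sub>C w" using w12 by (metis distrib_right mult_1)
    have "(F ^^ n) w = (c ^ n) *\<^sub>C w" for n
      by (induction n) (simp_all add: Fw bounded_clinear_scaleC[OF F] scaleC_scaleC mult.commute)
    moreover have "c ^ N = exp (\<i> * complex_of_real (s * a + t * b))"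
      unfolding c_def exp_of_nat_mult[symmetric] using N by simp
    ultimately show ?thesis by (simp add: Product Pair F_def)
  qed
qed

section \<open>Joint eigenvectors and polynomials in an operator\<close>

text \<open>The projections commute on the single vector \<open>v\<close> only. This suffices:
  \<open>P\<^sub>A(a) P\<^sub>B(b) v\<close> lies in the eigenspace of \<open>A\<close> by its outer
  factor, and in that of \<open>B\<close> after rewriting it as
  \<open>P\<^sub>B(b) P\<^sub>A(a) v\<close>.\<close>

lemma joint_eigen_decomposition:
  assumes A: "selfadjoint_op A" "has_spectral_decomposition A"
    and B: "selfadjoint_op B" "has_spectral_decomposition B"
    and comm: "\<And>a b. a \<in> eigenvalues A \<Longrightarrow> b \<in> eigenvalues B \<Longrightarrow>
        eigenproj A a (eigenproj B b v) = eigenproj B b (eigenproj A a v)"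
  shows "((\<lambda>(a, b). eigenproj A a (eigenproj B b v)) has_sum v) (eigenvalues A \<times> eigenvalues B)"
    and "a \<in> eigenvalues A \<Longrightarrow> b \<in> eigenvalues B \<Longrightarrow>
        cinner v (eigenproj A a (eigenproj B b v)) =
        complex_of_real ((norm (eigenproj A a (eigenproj B b v)))\<^sup>2)"
    and "a \<in> eigenvalues A \<Longrightarrow> b \<in> eigenvalues B \<Longrightarrow>
        A (eigenproj A a (eigenproj B b v)) = complex_of_real a *\<^sub>C eigenproj A a (eigenproj B b v)"
    and "a \<in> eigenvalues A \<Longrightarrow> b \<in> eigenvalues B \<Longrightarrow>
        B (eigenproj A a (eigenproj B b v)) = complex_of_real b *\<^sub>C eigenproj A a (eigenproj B b v)"
proof -
  note Ac = selfadjoint_op_bounded_clinear[OF A(1)] and Bc = selfadjoint_op_bounded_clinear[OF B(1)]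
  let ?Z = "eigenvalues A \<times> eigenvalues B"
  define w where "w = (\<lambda>(a, b). eigenproj A a (eigenproj B b v))"
  have w: "w (a, b) = eigenproj A a (eigenproj B b v)" for a b by (simp add: w_def)
  have wA: "w (a, b) \<in> eigenspace A a" for a b
    unfolding w by (rule eigenproj_in[OF Ac])
  have w': "w (a, b) = eigenproj B b (eigenproj A a v)" if "(a, b) \<in> ?Z" for a b
    using comm that by (simp add: w)
  then have wB: "w (a, b) \<in> eigenspace B b" if "(a, b) \<in> ?Z" for a b
    using eigenproj_in[OF Bc] that by simp
  have norm: "cinner (w (a, b)) v = complex_of_real ((norm (w (a, b)))\<^sup>2)" if z: "(a, b) \<in> ?Z" for a b
  proof -
    \<comment> \<open>Both projections fix \<open>w (a, b)\<close>; moving them to the other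
      argument turns \<open>v\<close> into \<open>w (a, b)\<close>.\<close>
    have "cinner (w (a, b)) v = cinner (eigenproj B b (eigenproj A a (w (a, b)))) v"
      using eigenproj_ident[OF Ac wA] eigenproj_ident[OF Bc wB[OF z]] by simp
    also have "\<dots> = cinner (w (a, b)) (w (a, b))"
      by (simp add: eigenproj_selfadjoint[OF Ac] eigenproj_selfadjoint[OF Bc] w)
    finally show ?thesis by (simp add: cinner_self)
  qed
  obtain y where y: "(w has_sum y) ?Z"
  proof (rule orthogonal_has_sum[of ?Z w v])
    fix z z' assume zz: "z \<in> ?Z" "z' \<in> ?Z" "z \<noteq> z'"
    obtain a b a' b' where eq: "z = (a, b)" "z' = (a', b')" by (cases z; cases z')
    show "cinner (w z) (w z') = 0"
    proof (cases "a = a'")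
      case True
      then have "b \<noteq> b'" using zz(3) eq by simp
      then show ?thesis
        using eigenspaces_orthogonal[OF B(1) wB wB] zz eq by blast
    next
      case False
      then show ?thesis using eigenspaces_orthogonal[OF A(1) wA wA] eq by blast
    qed
  next
    fix z assume "z \<in> ?Z"
    then show "cinner (w z) v = complex_of_real ((norm (w z))\<^sup>2)"
      using norm by (cases z) auto
  qed blast
  \<comment> \<open>The total \<open>y\<close> is identified by iterated summation: over
    \<open>b\<close> the sum is \<open>P\<^sub>A(a) v\<close>, and over \<open>a\<close> it is then
    \<open>v\<close>.\<close>
  have "((\<lambda>b. w (a, b)) has_sum eigenproj A a v) (eigenvalues B)" if "a \<in> eigenvalues A" for a
    using has_sum_bounded_linear[OF bounded_clinear_bounded_linear[OF bounded_clinear_eigenproj[OF Ac]]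
        resolution_of_identity[OF B, of v], of a]
    by (simp add: w)
  from has_sum_Sigma[OF isUCont_plus y this] have "((\<lambda>a. eigenproj A a v) has_sum y) (eigenvalues A)" .
  with resolution_of_identity[OF A, of v] have "y = v" using has_sum_unique by blast
  then show "((\<lambda>(a, b). eigenproj A a (eigenproj B b v)) has_sum v) ?Z"
    using y by (simp add: w_def)
  assume z: "a \<in> eigenvalues A" "b \<in> eigenvalues B"
  have "cinner v (w (a, b)) = cnj (cinner (w (a, b)) v)" by (rule cinner_commute)
  also have "\<dots> = complex_of_real ((norm (w (a, b)))\<^sup>2)" using norm z by simp
  finally show "cinner v (eigenproj A a (eigenproj B b v)) =
        complex_of_real ((norm (eigenproj A a (eigenproj B b v)))\<^sup>2)" unfolding w .
  show "A (eigenproj A a (eigenproj B b v)) = complex_of_real a *\<^sub>C eigenproj A a (eigenproj B b v)"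
    using wA[of a b] by (simp add: eigenspace_def w)
  show "B (eigenproj A a (eigenproj B b v)) = complex_of_real b *\<^sub>C eigenproj A a (eigenproj B b v)"
    using wB[of a b] z by (simp add: eigenspace_def w)
qed

section \<open>Spectral projections as strong limits of polynomials\<close>

lemma eigenvalue_bound:
  assumes "\<And>x. norm (A x) \<le> norm x * K" "a \<in> eigenvalues A"
  shows "\<bar>a\<bar> \<le> K"
proof -
  obtain x where x: "A x = complex_of_real a *\<^sub>C x" "x \<noteq> 0"
    using assms(2) by (auto simp: eigenvalues_def eigenspace_def)
  have "\<bar>a\<bar> * norm x \<le> norm x * K" using assms(1)[of x] by (simp add: x(1) norm_scaleC)
  then show ?thesis using x(2) by (simp add: mult.commute)
qed

lemma funpow_eigenspace:
  assumes T: "bounded_linear (T :: 'a::chilbert_space \<Rightarrow> 'a)" and x: "T x = d *\<^sub>R x"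
  shows "(T ^^ n) x = d ^ n *\<^sub>R x"
  by (induction n) (simp_all add: x linear_simps[OF T] mult.commute)

text \<open>On the spectrum of \<open>A\<close>, the powers of \<open>t \<mapsto> 1 - (t - a)\<^sup>2 / c\<close> tend to the indicator of
  \<open>{a}\<close> when \<open>c\<close> is large, so that \<open>P\<^sub>A(a)\<close> is a strong limit of polynomials in \<open>A\<close>.\<close>

lemma eigenproj_strong_limit_induct:
  fixes A :: "'a::chilbert_space \<Rightarrow> 'a"
  assumes A: "selfadjoint_op A" and dec: "has_spectral_decomposition A" and a: "a \<in> eigenvalues A"
    and pow: "\<And>k. Q (A ^^ k)"
    and lin: "\<And>f g r s. Q f \<Longrightarrow> Q g \<Longrightarrow> Q (\<lambda>x. r *\<^sub>R f x + s *\<^sub>R g x)"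
    and lim: "\<And>F f. (\<And>n. Q (F n)) \<Longrightarrow> (\<And>x. (\<lambda>n. F n x) \<longlonglongrightarrow> f x) \<Longrightarrow> Q f"
  shows "Q (eigenproj A a)"
proof -
  note Ac = selfadjoint_op_bounded_clinear[OF A]
  interpret A: bounded_linear A by (rule bounded_clinear_bounded_linear[OF Ac])
  obtain K where K: "K > 0" "\<And>x. norm (A x) \<le> norm x * K" using A.pos_bounded by blast
  define X where "X = (\<lambda>x. A x - a *\<^sub>R x)"
  \<comment> \<open>\<open>K + \<bar>a\<bar>\<close> bounds the norm of \<open>X = A - a\<close>.
    Hence \<open>D = 1 - X\<^sup>2 / c\<close> is a contraction, and its value \<open>d a'\<close>
    at any other eigenvalue lies in \<open>[0, 1)\<close>, while \<open>d a = 1\<close>.\<close>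
  define c where "c = (K + \<bar>a\<bar>)\<^sup>2"
  have c: "c > 0" using K(1) by (simp add: c_def add_pos_nonneg)
  define D where "D = (\<lambda>x. x - (1/c) *\<^sub>R X (X x))"
  have X: "bounded_linear X" unfolding X_def by (intro bounded_linear_intros A.bounded_linear_axioms)
  have D: "bounded_linear D" unfolding D_def by (intro bounded_linear_intros bounded_linear_compose[OF X X])
  have "inner (A x) y = inner x (A y)" for x y
    by (simp add: inner_eq_Re_cinner selfadjoint_op_cinner[OF A])
  then have Xsym: "inner (X x) y = inner x (X y)" for x y
    by (simp add: X_def inner_diff_left inner_diff_right)
  have Xn: "(norm (X x))\<^sup>2 \<le> c * (norm x)\<^sup>2" for x
  proof -
    have "norm (X x) \<le> norm (A x) + \<bar>a\<bar> * norm x"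
      unfolding X_def using norm_triangle_ineq4[of "A x" "a *\<^sub>R x"] by simp
    also have "\<dots> \<le> (K + \<bar>a\<bar>) * norm x" using K(2)[of x] by (simp add: algebra_simps)
    finally have "(norm (X x))\<^sup>2 \<le> ((K + \<bar>a\<bar>) * norm x)\<^sup>2" by (intro power_mono) auto
    then show ?thesis by (simp add: c_def power_mult_distrib)
  qed
  have Dn: "norm (D x) \<le> norm x" for x
  proof -
    have "(norm (D x))\<^sup>2 = (norm x)\<^sup>2 - 2 * (1/c) * (norm (X x))\<^sup>2 + (1/c)\<^sup>2 * (norm (X (X x)))\<^sup>2"
      unfolding D_def power2_norm_eq_inner
      by (simp add: inner_diff_left inner_diff_right inner_commute Xsym[of x "X x", symmetric]
          power2_eq_square)
    also have "(1/c)\<^sup>2 * (norm (X (X x)))\<^sup>2 \<le> (1/c)\<^sup>2 * (c * (norm (X x))\<^sup>2)"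
      by (intro mult_left_mono Xn) simp
    also have "(1/c)\<^sup>2 * (c * (norm (X x))\<^sup>2) = (1/c) * (norm (X x))\<^sup>2"
      using c by (simp add: power2_eq_square)
    finally have "(norm (D x))\<^sup>2 \<le> (norm x)\<^sup>2 - (1/c) * (norm (X x))\<^sup>2" by simp
    also have "\<dots> \<le> (norm x)\<^sup>2" using c by simp
    finally show ?thesis by (rule power2_le_imp_le) simp
  qed
  have Dnn: "norm ((D ^^ n) x) \<le> norm x" for n x
    by (induction n) (use Dn order_trans in auto)
  have Dlin: "bounded_linear (D ^^ n)" for n
    by (induction n) (auto simp: id_def o_def intro: bounded_linear_ident bounded_linear_compose[OF D])
  define d where "d = (\<lambda>a'. 1 - (a' - a)\<^sup>2 / c)"
  have Deig: "(D ^^ n) (eigenproj A a' x) = d a' ^ n *\<^sub>R eigenproj A a' x" for n a' x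
  proof (rule funpow_eigenspace[OF D])
    let ?y = "eigenproj A a' x"
    have "A ?y = a' *\<^sub>R ?y" using eigenproj_eigenvector[OF Ac] by (simp add: scaleR_scaleC)
    then have "X (r *\<^sub>R ?y) = (r * (a' - a)) *\<^sub>R ?y" for r
      by (simp add: X_def A.scaleR algebra_simps)
    from this[of 1] this[of "a' - a"] have "X (X ?y) = (a' - a)\<^sup>2 *\<^sub>R ?y"
      by (simp add: power2_eq_square)
    then show "D ?y = d a' *\<^sub>R ?y" by (simp add: D_def d_def scaleR_diff_left)
  qed
  have d: "0 \<le> d a' \<and> d a' < 1" if "a' \<in> eigenvalues A" "a' \<noteq> a" for a'
  proof -
    have "\<bar>a' - a\<bar> \<le> K + \<bar>a\<bar>" using eigenvalue_bound[OF K(2) that(1)] by simp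
    then have "(a' - a)\<^sup>2 \<le> c" unfolding c_def by (metis abs_ge_zero power2_abs power_mono)
    then show ?thesis using that(2) c by (simp add: d_def)
  qed
  \<comment> \<open>Only \<open>k = 0\<close> is wanted in the end. The induction needs every
    \<open>k\<close>, because \<open>A ^^ k\<close> followed by one more \<open>D\<close> mixes the
    powers \<open>k\<close>, \<open>k + 1\<close> and \<open>k + 2\<close>. The nested two-term sums
    below match the binary closure rule \<open>lin\<close>.\<close>
  have Qpow: "Q (\<lambda>x. (A ^^ k) ((D ^^ n) x))" for k n
  proof (induction n arbitrary: k)
    case 0
    then show ?case using pow[of k] by simp
  next
    case (Suc n)
    have Ak: "bounded_linear (A ^^ k)"
      by (rule bounded_clinear_bounded_linear[OF bounded_clinear_funpow[OF Ac]])
    have D': "(A ^^ k) (D y) = 1 *\<^sub>R (1 *\<^sub>R (A ^^ k) y + (- 1/c) *\<^sub>R (A ^^ (k + 2)) y) +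
        1 *\<^sub>R ((2 * a / c) *\<^sub>R (A ^^ (k + 1)) y + (- a\<^sup>2 / c) *\<^sub>R (A ^^ k) y)" for y
    proof -
      have "X (X y) = A (A y) - (2 * a) *\<^sub>R A y + a\<^sup>2 *\<^sub>R y"
        by (simp add: X_def A.diff A.scaleR algebra_simps power2_eq_square scaleR_2[symmetric])
      then have "D y = y - (1/c) *\<^sub>R A (A y) + (2 * a / c) *\<^sub>R A y - (a\<^sup>2 / c) *\<^sub>R y"
        by (simp add: D_def scaleR_diff_right scaleR_add_right)
      moreover have "(A ^^ (k + 2)) y = (A ^^ k) (A (A y))" "(A ^^ (k + 1)) y = (A ^^ k) (A y)"
        by (simp_all add: funpow_add numeral_2_eq_2 funpow_swap1)
      ultimately show ?thesis by (simp add: linear_simps[OF Ak])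
    qed
    have "Q (\<lambda>x. 1 *\<^sub>R (1 *\<^sub>R (A ^^ k) ((D ^^ n) x) + (- 1/c) *\<^sub>R (A ^^ (k + 2)) ((D ^^ n) x)) +
        1 *\<^sub>R ((2 * a / c) *\<^sub>R (A ^^ (k + 1)) ((D ^^ n) x) + (- a\<^sup>2 / c) *\<^sub>R (A ^^ k) ((D ^^ n) x)))"
      by (intro lin Suc.IH)
    then show ?case unfolding D'[symmetric] by simp
  qed
  have conv: "(\<lambda>n. (D ^^ n) x) \<longlonglongrightarrow> eigenproj A a x" for x
  proof (rule tendstoI)
    fix e :: real assume e: "e > 0"
    have "\<forall>\<^sub>F F in finite_subsets_at_top (eigenvalues A). dist (\<Sum>b\<in>F. eigenproj A b x) x < e/2"
      using tendstoD[OF resolution_of_identity[OF A dec, of x, unfolded has_sum_def], of "e/2"] e by simp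
    then obtain F0 where "finite F0 \<and> F0 \<subseteq> eigenvalues A \<and> (\<forall>F. finite F \<and> F0 \<subseteq> F \<and> F \<subseteq> eigenvalues A
        \<longrightarrow> dist (\<Sum>b\<in>F. eigenproj A b x) x < e/2)"
      unfolding eventually_finite_subsets_at_top by (rule exE)
    then have F0: "finite F0" "F0 \<subseteq> eigenvalues A" "dist (\<Sum>b\<in>insert a F0. eigenproj A b x) x < e/2"
      using a by auto
    define G where "G = F0 - {a}"
    have ins: "insert a F0 = insert a G" and G: "finite G" "a \<notin> G" "G \<subseteq> eigenvalues A"
      using F0 by (auto simp: G_def)
    \<comment> \<open>The tail \<open>?r\<close> is small and stays small under the contractions
      \<open>D ^^ n\<close>; on the finitely many components in \<open>G\<close> the factors
      \<open>d b ^ n\<close> tend to 0.\<close>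
    let ?r = "x - (eigenproj A a x + (\<Sum>b\<in>G. eigenproj A b x))"
    have r: "norm ?r < e/2"
      using F0(3) G unfolding ins dist_norm by (simp add: norm_minus_commute)
    have "d a = 1" by (simp add: d_def)
    have split: "(D ^^ n) x - eigenproj A a x = (D ^^ n) ?r + (\<Sum>b\<in>G. d b ^ n *\<^sub>R eigenproj A b x)" for n
      by (simp add: linear_simps[OF Dlin] linear_sum[OF bounded_linear.linear[OF Dlin]] Deig \<open>d a = 1\<close>)
    have "(\<lambda>n. \<Sum>b\<in>G. d b ^ n *\<^sub>R eigenproj A b x) \<longlonglongrightarrow> (\<Sum>b\<in>G. 0 *\<^sub>R eigenproj A b x)"
      by (intro tendsto_sum tendsto_scaleR tendsto_const LIMSEQ_realpow_zero) (use d G in blast)+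
    then have "(\<lambda>n. \<Sum>b\<in>G. d b ^ n *\<^sub>R eigenproj A b x) \<longlonglongrightarrow> 0" by simp
    then have "\<forall>\<^sub>F n in sequentially. norm (\<Sum>b\<in>G. d b ^ n *\<^sub>R eigenproj A b x) < e/2"
      using tendstoD[of _ 0 sequentially "e/2"] e unfolding dist_norm by fastforce
    then show "\<forall>\<^sub>F n in sequentially. dist ((D ^^ n) x) (eigenproj A a x) < e"
    proof eventually_elim
      case (elim n)
      have "norm ((D ^^ n) x - eigenproj A a x) \<le> norm ((D ^^ n) ?r) + norm (\<Sum>b\<in>G. d b ^ n *\<^sub>R eigenproj A b x)"
        unfolding split by (rule norm_triangle_ineq)
      then show ?case using elim r Dnn[of n ?r] unfolding dist_norm by linarith
    qed
  qed
  show ?thesis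
    by (rule lim[OF _ conv]) (use Qpow[of 0] in simp)
qed

section \<open>Words and polynomials in two operators\<close>

lemma word_op_append: "word_op A B (w @ w') = word_op A B w \<circ> word_op A B w'"
  by (induction w) (auto simp: word_op_def)

lemma word_op_replicate: "word_op A B (replicate k LX) = A ^^ k" "word_op A B (replicate k LY) = B ^^ k"
  by (induction k) (auto simp: word_op_def)

lemma bounded_clinear_word_op:
  assumes "bounded_clinear A" "bounded_clinear B"
  shows "bounded_clinear (word_op A B w)"
proof (induction w)
  case Nil
  then show ?case by (simp add: word_op_def id_def bounded_clinear_ident)
next
  case (Cons l w)
  have "word_op A B (l # w) = (\<lambda>x. (case l of LX \<Rightarrow> A | LY \<Rightarrow> B) (word_op A B w x))"
    by (auto simp: word_op_def)
  then show ?case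
    using Cons assms by (cases l) (auto intro: bounded_clinear_compose)
qed

lemma bounded_clinear_ncpoly_op:
  assumes "bounded_clinear A" "bounded_clinear B"
  shows "bounded_clinear (ncpoly_op p A B)"
  unfolding ncpoly_op_def
  by (intro bounded_clinear_sum bounded_clinear_scale bounded_clinear_word_op assms)

lemma ncpoly_op_eigenvector:
  assumes A: "bounded_clinear A" and B: "bounded_clinear B"
    and a: "A w = complex_of_real a *\<^sub>C w" and b: "B w = complex_of_real b *\<^sub>C w"
  shows "ncpoly_op p A B w = ncpoly_fun p (a, b) *\<^sub>C w"
proof -
  have "word_op A B u w = (\<Prod>l\<leftarrow>u. complex_of_real (case l of LX \<Rightarrow> a | LY \<Rightarrow> b)) *\<^sub>C w" for u
  proof (induction u)
    case (Cons l u)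
    have "word_op A B (l # u) w = (case l of LX \<Rightarrow> A | LY \<Rightarrow> B) (word_op A B u w)"
      by (simp add: word_op_def)
    then show ?case
      unfolding Cons.IH using a b
      by (cases l) (simp_all add: bounded_clinear_scaleC[OF A] bounded_clinear_scaleC[OF B] scaleC_scaleC mult.commute)
  qed (simp add: word_op_def)
  then show ?thesis
    by (simp add: ncpoly_op_def ncpoly_fun_def scaleC_scaleC scaleC.sum_left)
qed

section \<open>Two observables in a state\<close>

lemma has_sum_in_nonneg_Reals:
  fixes f :: "'i \<Rightarrow> complex"
  assumes "(f has_sum s) I" "\<And>i. i \<in> I \<Longrightarrow> f i \<in> \<real>\<^sub>\<ge>\<^sub>0"
  shows "s \<in> \<real>\<^sub>\<ge>\<^sub>0"
proof -
  have "0 \<le> Re s"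
    using has_sum_Re[OF assms(1)] by (rule has_sum_nonneg) (use assms(2) in \<open>auto simp: complex_nonneg_Reals_iff\<close>)
  moreover have "((\<lambda>i. Im (f i)) has_sum 0) I"
    by (rule has_sum_0) (use assms(2) in \<open>auto simp: complex_nonneg_Reals_iff\<close>)
  then have "Im s = 0" using has_sum_Im[OF assms(1)] has_sum_unique by blast
  ultimately show ?thesis by (simp add: complex_nonneg_Reals_iff)
qed

text \<open>\<open>S\<close> and \<open>E\<close> are the objects delivered by
  \<open>density_operator_trace_formula\<close>; \<open>norm1\<close> expresses that the state has
  trace one.\<close>

locale observables_in_state =
  fixes A B \<rho> S :: "'a::chilbert_space \<Rightarrow> 'a" and E :: "'a set"
  assumes A: "selfadjoint_op A" "has_spectral_decomposition A"
    and B: "selfadjoint_op B" "has_spectral_decomposition B"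
    and S: "selfadjoint_op S" "S (S x) = \<rho> x"
    and onb: "is_onb E"
    and trace: "bounded_clinear T \<Longrightarrow> ((\<lambda>e. cinner (S e) (T (S e))) has_sum trace_op (T \<circ> \<rho>)) E"
    and norm1: "((\<lambda>e. (norm (S e))\<^sup>2) has_sum 1) E"
begin

lemmas Ac = selfadjoint_op_bounded_clinear[OF A(1)]
lemmas Bc = selfadjoint_op_bounded_clinear[OF B(1)]
lemmas Sc = selfadjoint_op_bounded_clinear[OF S(1)]
lemmas Ssa = selfadjoint_op_cinner[OF S(1)]

abbreviation "P \<equiv> eigenproj A"
abbreviation "Q \<equiv> eigenproj B"
abbreviation "spec \<equiv> eigenvalues A \<times> eigenvalues B"

lemma bounded_clinear_PQ: "bounded_clinear (\<lambda>x. P a (Q b x))" "bounded_clinear (\<lambda>x. Q b (P a x))"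
  by (rule bounded_clinear_compose[OF bounded_clinear_eigenproj bounded_clinear_eigenproj], (rule Ac Bc)+)+

text \<open>The commutator \<open>K\<close> of two self-adjoint projections is skew-adjoint. From
  \<open>K S S = 0\<close> follows \<open>norm (S (K y)) = 0\<close>, so \<open>S K = 0\<close>, and
  taking adjoints \<open>K S = 0\<close>. The other direction expands \<open>S x\<close> in the
  basis \<open>E\<close> and applies \<open>S\<close> and the projections termwise.\<close>

lemma commute_in_state_iff:
  "commute_in_state A B \<rho> \<longleftrightarrow>
     (\<forall>a\<in>eigenvalues A. \<forall>b\<in>eigenvalues B. \<forall>x\<in>E. P a (Q b (S x)) = Q b (P a (S x)))" (is "?L \<longleftrightarrow> ?R")
proof
  assume L: ?L
  show ?R
  proof (intro ballI)
    fix a b x assume ab: "a \<in> eigenvalues A" "b \<in> eigenvalues B"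
    define K where "K = (\<lambda>x. P a (Q b x) - Q b (P a x))"
    have K: "cinner (K x) y = - cinner x (K y)" for x y
      by (simp add: K_def cinner.diff_left cinner.diff_right eigenproj_selfadjoint[OF Ac]
          eigenproj_selfadjoint[OF Bc])
    have K0: "K (S (S x)) = 0" for x
      using L ab by (auto simp: commute_in_state_def K_def S(2) fun_eq_iff)
    have "cinner (S (K y)) (S (K y)) = 0" for y
    proof -
      have "cinner (S (K y)) (S (K y)) = cinner (K y) (S (S (K y)))" by (simp add: Ssa)
      also have "\<dots> = - cinner y (K (S (S (K y))))" by (rule K)
      finally show ?thesis by (simp add: K0)
    qed
    then have SK: "S (K y) = 0" for y by simp
    have "cinner (K (S x)) (K (S x)) = - cinner (S x) (K (K (S x)))" by (rule K)
    also have "\<dots> = 0" by (simp add: Ssa SK)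
    finally show "P a (Q b (S x)) = Q b (P a (S x))" by (simp add: K_def)
  qed
next
  assume R: ?R
  show ?L
    unfolding commute_in_state_def
  proof (intro ballI ext)
    fix a b x assume ab: "a \<in> eigenvalues A" "b \<in> eigenvalues B"
    have "bounded_linear (\<lambda>x. P a (Q b (S x)))" "bounded_linear (\<lambda>x. Q b (P a (S x)))"
      by (rule bounded_clinear_bounded_linear[OF bounded_clinear_compose[OF _ Sc]], rule bounded_clinear_PQ)+
    note h = this[THEN has_sum_bounded_linear, OF onb_expansion[OF onb, of "S x"]]
    have "((\<lambda>e. P a (Q b (S (cinner e (S x) *\<^sub>C e)))) has_sum Q b (P a (S (S x)))) E"
      by (rule has_sum_cong[THEN iffD1, OF _ h(2)])
         (use R ab bounded_clinear_scaleC[OF Sc] bounded_clinear_scaleC[OF bounded_clinear_PQ(1)]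
           bounded_clinear_scaleC[OF bounded_clinear_PQ(2)] in simp)
    with h(1) have "P a (Q b (S (S x))) = Q b (P a (S (S x)))" by (rule has_sum_unique)
    then show "(P a \<circ> Q b \<circ> \<rho>) x = (Q b \<circ> P a \<circ> \<rho>) x" by (simp add: S(2))
  qed
qed

text \<open>Of \<open>u\<close> only the equality of its values on equal polynomial functions is
  used: words that differ by a permutation of letters then have equal traces.\<close>

lemma commute_if_reproduces_moments:
  assumes u: "reproduces_moments u A B \<rho>"
  shows "commute_in_state A B \<rho>"
proof -
  have word: "trace_op (word_op A B w \<circ> \<rho>) = u (ncpoly_fun (Poly_Mapping.single w 1))" for w
  proof -
    have "ncpoly_op (Poly_Mapping.single w 1) A B = word_op A B w"
      by (auto simp: ncpoly_op_def)
    then show ?thesis using u unfolding reproduces_moments_def by metis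
  qed
  have An: "cinner ((A ^^ k) x) y = cinner x ((A ^^ k) y)" for k x y
    by (induction k arbitrary: x y) (simp_all add: selfadjoint_op_cinner[OF A(1)] funpow_swap1)
  have Bn: "cinner ((B ^^ k) x) y = cinner x ((B ^^ k) y)" for k x y
    by (induction k arbitrary: x y) (simp_all add: selfadjoint_op_cinner[OF B(1)] funpow_swap1)
  have powers: "(A ^^ k) ((B ^^ l) (S e)) = (B ^^ l) ((A ^^ k) (S e))" if e: "e \<in> E" for k l e
  proof -
    define X Y where "X = replicate k LX" and "Y = replicate l LY"
    define C where "C = (\<lambda>x. (A ^^ k) ((B ^^ l) x) - (B ^^ l) ((A ^^ k) x))"
    have fn: "ncpoly_fun (Poly_Mapping.single w 1) = ncpoly_fun (Poly_Mapping.single (Y @ X @ X @ Y) 1)"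
      if "w \<in> {Y @ X @ Y @ X, X @ Y @ X @ Y, X @ Y @ Y @ X}" for w
      using that by (auto simp: ncpoly_fun_def X_def Y_def fun_eq_iff mult_ac)
    define \<tau> where "\<tau> = trace_op (word_op A B (Y @ X @ X @ Y) \<circ> \<rho>)"
    have \<tau>: "((\<lambda>e. cinner (S e) (word_op A B w (S e))) has_sum \<tau>) E"
      if "w \<in> {Y @ X @ X @ Y, Y @ X @ Y @ X, X @ Y @ X @ Y, X @ Y @ Y @ X}" for w
      using trace[OF bounded_clinear_word_op[OF Ac Bc], of w] that fn[of w]
      by (auto simp: word \<tau>_def)
    have expand: "complex_of_real ((norm (C v))\<^sup>2) =
        cinner v (word_op A B (Y @ X @ X @ Y) v) - cinner v (word_op A B (Y @ X @ Y @ X) v) -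
        cinner v (word_op A B (X @ Y @ X @ Y) v) + cinner v (word_op A B (X @ Y @ Y @ X) v)" for v
      unfolding cinner_self[symmetric]
      by (simp add: C_def cinner.diff_left cinner.diff_right word_op_append X_def Y_def
          word_op_replicate An Bn)
    \<comment> \<open>The signs of the four words cancel the common trace \<open>\<tau>\<close>. A
      sum of nonnegative terms equal to 0 has only zero terms, so the trace identity becomes a
      statement about each single \<open>S e\<close>.\<close>
    have "((\<lambda>e. complex_of_real ((norm (C (S e)))\<^sup>2)) has_sum (\<tau> + - \<tau> + - \<tau> + \<tau>)) E"
      unfolding expand diff_conv_add_uminus by (intro has_sum_add has_sum_uminus[THEN iffD2]) (simp_all add: \<tau>)
    then have "((\<lambda>e. complex_of_real ((norm (C (S e)))\<^sup>2)) has_sum complex_of_real 0) E" by simp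
    then have "((\<lambda>e. (norm (C (S e)))\<^sup>2) has_sum 0) E" unfolding has_sum_of_real_iff .
    then have "(norm (C (S e)))\<^sup>2 = 0"
      by (rule nonneg_has_sum_le_0D) (use e in auto)
    then show ?thesis by (simp add: C_def)
  qed
  have lin: "bounded_linear (B ^^ l)" "bounded_linear (P a)" for l a
    by (rule bounded_clinear_bounded_linear[OF bounded_clinear_funpow[OF Bc]])
       (rule bounded_clinear_bounded_linear[OF bounded_clinear_eigenproj[OF Ac]])
  \<comment> \<open>Passage from powers to projections, one operator at a time: with
    \<open>B ^^ l\<close> kept fixed the powers of \<open>A\<close> are replaced by
    \<open>P a\<close>, and afterwards those of \<open>B\<close> by \<open>Q b\<close>. Boundedness
    of the operator kept fixed makes the commutation property stable under strong limits.\<close>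
  have step: "P a ((B ^^ l) (S e)) = (B ^^ l) (P a (S e))" if a: "a \<in> eigenvalues A" and e: "e \<in> E" for a l e
  proof (rule eigenproj_strong_limit_induct[OF A a, where Q="\<lambda>T. T ((B ^^ l) (S e)) = (B ^^ l) (T (S e))"])
    fix F f assume F: "\<And>n. F n ((B ^^ l) (S e)) = (B ^^ l) (F n (S e))"
      and f: "\<And>x. (\<lambda>n. F n x) \<longlonglongrightarrow> f x"
    have "(\<lambda>n. F n ((B ^^ l) (S e))) \<longlonglongrightarrow> (B ^^ l) (f (S e))"
      unfolding F by (rule bounded_linear.tendsto[OF lin(1) f])
    then show "f ((B ^^ l) (S e)) = (B ^^ l) (f (S e))" using f LIMSEQ_unique by blast
  qed (use powers[OF e] in \<open>auto simp: linear_simps[OF lin(1)]\<close>)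
  have "Q b (P a (S e)) = P a (Q b (S e))"
    if a: "a \<in> eigenvalues A" and b: "b \<in> eigenvalues B" and e: "e \<in> E" for a b e
  proof (rule eigenproj_strong_limit_induct[OF B b, where Q="\<lambda>T. T (P a (S e)) = P a (T (S e))"])
    fix F f assume F: "\<And>n. F n (P a (S e)) = P a (F n (S e))"
      and f: "\<And>x. (\<lambda>n. F n x) \<longlonglongrightarrow> f x"
    have "(\<lambda>n. F n (P a (S e))) \<longlonglongrightarrow> P a (f (S e))"
      unfolding F by (rule bounded_linear.tendsto[OF lin(2) f])
    then show "f (P a (S e)) = P a (f (S e))" using f LIMSEQ_unique by blast
  qed (use step[OF a e] in \<open>auto simp: linear_simps[OF lin(2)]\<close>)
  then show ?thesis unfolding commute_in_state_iff by simp
qed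

section \<open>Consequences of commutation in the state\<close>

context
  assumes comm: "commute_in_state A B \<rho>"
begin

lemma comm_S: "e \<in> E \<Longrightarrow> a \<in> eigenvalues A \<Longrightarrow> b \<in> eigenvalues B \<Longrightarrow> P a (Q b (S e)) = Q b (P a (S e))"
  using comm unfolding commute_in_state_iff by blast

text \<open>The trace formula turns \<open>Tr[P\<^sub>A(a) P\<^sub>B(b) \<rho>]\<close>, a priori
  complex, into a sum of squared norms of joint components; nonnegativity is read off from
  this.\<close>

lemma joint_prob_has_sum:
  "((\<lambda>e. complex_of_real ((norm (P a (Q b (S e))))\<^sup>2)) has_sum joint_prob A B \<rho> (a, b)) E"
  if ab: "(a, b) \<in> spec"
proof -
  have jp: "joint_prob A B \<rho> (a, b) = trace_op ((\<lambda>x. P a (Q b x)) \<circ> \<rho>)"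
    by (simp add: joint_prob_def o_def)
  show ?thesis
    unfolding jp
  proof (rule has_sum_cong[THEN iffD1, OF _ trace[OF bounded_clinear_PQ(1)]])
    fix e assume "e \<in> E"
    then show "cinner (S e) (P a (Q b (S e))) = complex_of_real ((norm (P a (Q b (S e))))\<^sup>2)"
      using joint_eigen_decomposition(2)[OF A B, of "S e" a b] comm_S ab by auto
  qed
qed

lemma joint_prob_nonneg:
  assumes "z \<in> spec"
  shows "joint_prob A B \<rho> z \<in> \<real>\<^sub>\<ge>\<^sub>0"
proof -
  obtain a b where "z = (a, b)" by (cases z)
  then show ?thesis
    using assms by (intro has_sum_in_nonneg_Reals[OF joint_prob_has_sum[of a b, folded \<open>z = (a, b)\<close>]]) auto
qed

lemma joint_prob_eq_cmod: "z \<in> spec \<Longrightarrow> joint_prob A B \<rho> z = complex_of_real (cmod (joint_prob A B \<rho> z))"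
  using joint_prob_nonneg[of z] by (auto simp: nonneg_Reals_def Reals_def)

text \<open>The common source of the normalisation, the characteristic functions and the moments.
  Each \<open>\<langle>S e, T S e\<rangle>\<close> is a sum over the joint spectrum of
  \<open>n e z * c z\<close>; the sums over \<open>e\<close> and \<open>z\<close> are interchanged
  under the dominating family \<open>n e z * M\<close>, with totals
  \<open>(norm (S e))\<^sup>2 * M\<close>.\<close>

lemma trace_joint_eigen:
  assumes T: "bounded_clinear T"
    and eig: "\<And>a b w. A w = complex_of_real a *\<^sub>C w \<Longrightarrow> B w = complex_of_real b *\<^sub>C w \<Longrightarrow> T w = c (a, b) *\<^sub>C w"
    and bound: "\<And>z. z \<in> spec \<Longrightarrow> cmod (c z) \<le> M"
  shows "((\<lambda>z. joint_prob A B \<rho> z * c z) has_sum trace_op (T \<circ> \<rho>)) spec"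
proof -
  define n where "n = (\<lambda>e (a, b). (norm (P a (Q b (S e))))\<^sup>2)"
  define g where "g = (\<lambda>e z. complex_of_real (n e z) * c z)"
  note dec = joint_eigen_decomposition[OF A B comm_S]
  have vw: "((\<lambda>z. cinner (S e) ((\<lambda>(a, b). R (P a (Q b (S e)))) z)) has_sum cinner (S e) (R (S e))) spec"
    if e: "e \<in> E" and R: "bounded_clinear R" for e R
    using has_sum_bounded_linear[OF bounded_linear_compose[OF cinner.bounded_linear_right
          bounded_clinear_bounded_linear[OF R]] dec(1)[OF e]] by (simp add: case_prod_unfold)
  have ne: "(n e has_sum (norm (S e))\<^sup>2) spec" if e: "e \<in> E" for e
  proof -
    have "((\<lambda>z. complex_of_real (n e z)) has_sum complex_of_real ((norm (S e))\<^sup>2)) spec"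
      unfolding cinner_self[symmetric]
      by (rule has_sum_cong[THEN iffD1, OF _ vw[OF e bounded_clinear_ident]])
         (use dec(2)[OF e] in \<open>auto simp: n_def\<close>)
    then show ?thesis unfolding has_sum_of_real_iff .
  qed
  have ge: "(g e has_sum cinner (S e) (T (S e))) spec" if e: "e \<in> E" for e
  proof (rule has_sum_cong[THEN iffD1, OF _ vw[OF e T]])
    fix z assume z: "z \<in> spec"
    obtain a b where ab: "z = (a, b)" by (cases z)
    have "T (P a (Q b (S e))) = c (a, b) *\<^sub>C P a (Q b (S e))"
      using dec(3,4)[OF e] z ab by (intro eig) auto
    then show "cinner (S e) ((\<lambda>(a, b). T (P a (Q b (S e)))) z) = g e z"
      using dec(2)[OF e, of a b] z by (simp add: ab g_def n_def cinner_scaleC_right)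
  qed
  have gz: "((\<lambda>e. g e z) has_sum joint_prob A B \<rho> z * c z) E" if z: "z \<in> spec" for z
  proof -
    obtain a b where ab: "z = (a, b)" by (cases z)
    show ?thesis
      unfolding g_def using has_sum_cmult_left[OF joint_prob_has_sum, of a b "c z"] z
      by (simp add: ab n_def)
  qed
  have le: "norm (g e z) \<le> n e z * M" if "z \<in> spec" for e z
  proof -
    have "0 \<le> n e z" by (simp add: n_def split: prod.splits)
    then show ?thesis using bound[OF that] by (simp add: g_def norm_mult mult_left_mono)
  qed
  have H: "((\<lambda>z. n e z * M) has_sum (norm (S e))\<^sup>2 * M) spec" if "e \<in> E" for e
    by (intro has_sum_cmult_left ne that)
  have Hs: "(\<lambda>e. (norm (S e))\<^sup>2 * M) summable_on E"
    using has_sum_cmult_left[OF norm1, of M] by (auto simp: summable_on_def)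
  obtain t where t: "((\<lambda>e. cinner (S e) (T (S e))) has_sum t) E"
      "((\<lambda>z. joint_prob A B \<rho> z * c z) has_sum t) spec"
    by (rule has_sum_swap_dominated[OF le H Hs ge gz])
  show ?thesis using t(2) has_sum_unique[OF t(1) trace[OF T]] by simp
qed

lemma joint_prob_sum: "(joint_prob A B \<rho> has_sum 1) spec"
proof -
  have "((\<lambda>z. joint_prob A B \<rho> z * 1) has_sum trace_op ((\<lambda>x. x) \<circ> \<rho>)) spec"
    by (rule trace_joint_eigen[where M=1]) (auto simp: bounded_clinear_ident)
  moreover have "trace_op ((\<lambda>x. x) \<circ> \<rho>) = 1"
  proof (rule has_sum_unique[OF trace[OF bounded_clinear_ident]])
    have "((\<lambda>e. complex_of_real ((norm (S e))\<^sup>2)) has_sum complex_of_real 1) E"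
      unfolding has_sum_of_real_iff by (rule norm1)
    then show "((\<lambda>e. cinner (S e) (S e)) has_sum 1) E"
      by (simp add: cinner_self)
  qed
  ultimately show ?thesis by simp
qed

lemma charfun_has_sum:
  assumes "valid_ordering \<omega>"
  shows "((\<lambda>z. joint_prob A B \<rho> z * exp (\<i> * complex_of_real (\<theta> \<bullet> z))) has_sum charfun \<omega> A B \<rho> \<theta>) spec"
  unfolding charfun_def
  by (rule trace_joint_eigen[where M=1])
     (auto simp: bounded_clinear_ordered_exp[OF Ac Bc] ordered_exp_eigenvector[OF Ac Bc assms])

end

end

section \<open>Smooth functions on the plane\<close>

text \<open>Smoothness as a greatest fixed point: a family of differentiable functions closed under
  both partial derivatives passes the test \<open>Ck k\<close> for every \<open>k\<close>. A
  smoothness proof thus only needs a suitable family \<open>F\<close>.\<close>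

lemma smooth_coinduct:
  assumes "f \<in> F"
    and "\<And>g. g \<in> F \<Longrightarrow> g differentiable_on UNIV \<and> partial1 g \<in> F \<and> partial2 g \<in> F"
  shows "smooth f"
proof -
  have "\<forall>g\<in>F. Ck k g" for k
    by (induction k) (use assms(2) differentiable_imp_continuous_on in auto)
  then show ?thesis using assms(1) by (auto simp: smooth_def)
qed

lemma smoothD:
  assumes "smooth f"
  shows "f differentiable_on UNIV" "smooth (partial1 f)" "smooth (partial2 f)" "continuous_on UNIV f"
proof -
  have "Ck (Suc k) f" for k using assms by (auto simp: smooth_def)
  then show "f differentiable_on UNIV" "smooth (partial1 f)" "smooth (partial2 f)" by (auto simp: smooth_def)
  show "continuous_on UNIV f" using assms by (metis Ck.simps(1) smooth_def)
qed

lemma partial1_has_vector_derivative: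
  assumes "f differentiable_on UNIV"
  shows "((\<lambda>s. f (s, y)) has_vector_derivative partial1 f (x, y)) (at x within S)"
proof -
  obtain f' where f': "(f has_derivative f') (at (x, y))"
    using assms by (auto simp: differentiable_on_def differentiable_def)
  have "((\<lambda>s. (s, y)) has_derivative (\<lambda>s. (s, 0))) (at x)"
    by (intro has_derivative_Pair has_derivative_ident has_derivative_const)
  from has_derivative_compose[OF this f'] have "(\<lambda>s. f (s, y)) differentiable at x"
    by (auto simp: differentiable_def)
  then show ?thesis
    unfolding partial1_def by (simp add: vector_derivative_works has_vector_derivative_at_within)
qed

lemma partial2_has_vector_derivative:
  assumes "f differentiable_on UNIV"
  shows "((\<lambda>s. f (x, s)) has_vector_derivative partial2 f (x, y)) (at y within S)"
proof -
  obtain f' where f': "(f has_derivative f') (at (x, y))"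
    using assms by (auto simp: differentiable_on_def differentiable_def)
  have "((\<lambda>s. (x, s)) has_derivative (\<lambda>s. (0, s))) (at y)"
    by (intro has_derivative_Pair has_derivative_ident has_derivative_const)
  from has_derivative_compose[OF this f'] have "(\<lambda>s. f (x, s)) differentiable at y"
    by (auto simp: differentiable_def)
  then show ?thesis
    unfolding partial2_def by (simp add: vector_derivative_works has_vector_derivative_at_within)
qed

lemma partial1_eqI:
  assumes "\<And>x y. ((\<lambda>s. f (s, y)) has_vector_derivative g (x, y)) (at x)"
  shows "partial1 f = g"
  using vector_derivative_at[OF assms] by (auto simp: partial1_def fun_eq_iff)

lemma partial2_eqI:
  assumes "\<And>x y. ((\<lambda>s. f (x, s)) has_vector_derivative g (x, y)) (at y)"
  shows "partial2 f = g"
  using vector_derivative_at[OF assms] by (auto simp: partial2_def fun_eq_iff)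

lemma partial_add:
  assumes "f differentiable_on UNIV" "g differentiable_on UNIV"
  shows "partial1 (\<lambda>z. f z + g z) = (\<lambda>z. partial1 f z + partial1 g z)"
    and "partial2 (\<lambda>z. f z + g z) = (\<lambda>z. partial2 f z + partial2 g z)"
  by (intro partial1_eqI partial2_eqI has_vector_derivative_add partial1_has_vector_derivative
      partial2_has_vector_derivative assms)+

lemma partial_cmult:
  assumes "f differentiable_on UNIV"
  shows "partial1 (\<lambda>z. c * f z) = (\<lambda>z. c * partial1 f z)"
    and "partial2 (\<lambda>z. c * f z) = (\<lambda>z. c * partial2 f z)"
  by (intro partial1_eqI partial2_eqI has_vector_derivative_mult_right partial1_has_vector_derivative
      partial2_has_vector_derivative assms)+

lemma smooth_add:
  assumes "smooth f" "smooth g"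
  shows "smooth (\<lambda>z. f z + g z)"
proof (rule smooth_coinduct)
  show "(\<lambda>z. f z + g z) \<in> {\<lambda>z. f z + g z |f g. smooth f \<and> smooth g}" using assms by blast
  fix h assume "h \<in> {\<lambda>z. f z + g z |f g. smooth f \<and> smooth g}"
  then obtain f g where h: "h = (\<lambda>z. f z + g z)" and fg: "smooth f" "smooth g" by blast
  show "h differentiable_on UNIV \<and> partial1 h \<in> {\<lambda>z. f z + g z |f g. smooth f \<and> smooth g} \<and>
      partial2 h \<in> {\<lambda>z. f z + g z |f g. smooth f \<and> smooth g}"
    unfolding h partial_add[OF smoothD(1)[OF fg(1)] smoothD(1)[OF fg(2)]]
    using smoothD(1-3)[OF fg(1)] smoothD(1-3)[OF fg(2)] by (auto intro: differentiable_on_add)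
qed

lemma smooth_cmult:
  assumes "smooth f"
  shows "smooth (\<lambda>z. c * f z)"
proof (rule smooth_coinduct)
  show "(\<lambda>z. c * f z) \<in> {\<lambda>z. c * f z |f. smooth f}" using assms by blast
  fix h assume "h \<in> {\<lambda>z. c * f z |f. smooth f}"
  then obtain f where h: "h = (\<lambda>z. c * f z)" and f: "smooth f" by blast
  show "h differentiable_on UNIV \<and> partial1 h \<in> {\<lambda>z. c * f z |f. smooth f} \<and>
      partial2 h \<in> {\<lambda>z. c * f z |f. smooth f}"
    unfolding h partial_cmult[OF smoothD(1)[OF f]]
    using smoothD(1-3)[OF f] by (auto intro: differentiable_on_mult)
qed

lemma smooth_zero: "smooth (\<lambda>z. 0)"
proof -
  have "partial1 (\<lambda>z. 0) = (\<lambda>z. 0)" "partial2 (\<lambda>z. 0) = (\<lambda>z. 0)"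
    by (auto intro!: partial1_eqI partial2_eqI)
  then show ?thesis by (intro smooth_coinduct[of _ "{\<lambda>z. 0}"]) auto
qed

lemma smooth_diff: "smooth f \<Longrightarrow> smooth g \<Longrightarrow> smooth (\<lambda>z. f z - g z)"
  using smooth_add[of f "\<lambda>z. (-1) * g z"] smooth_cmult[of g "-1"] by simp

lemma partial_diff:
  assumes "smooth f" "smooth g"
  shows "partial1 (\<lambda>z. f z - g z) = (\<lambda>z. partial1 f z - partial1 g z)"
    and "partial2 (\<lambda>z. f z - g z) = (\<lambda>z. partial2 f z - partial2 g z)"
  by (intro partial1_eqI partial2_eqI has_vector_derivative_diff partial1_has_vector_derivative
      partial2_has_vector_derivative smoothD(1) assms)+

abbreviation deriv2 :: "nat \<Rightarrow> nat \<Rightarrow> (real \<times> real \<Rightarrow> complex) \<Rightarrow> real \<times> real \<Rightarrow> complex" where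
  "deriv2 i j f \<equiv> (partial1 ^^ i) ((partial2 ^^ j) f)"

lemma smooth_iterates: "smooth f \<Longrightarrow> smooth ((partial1 ^^ i) f)" "smooth f \<Longrightarrow> smooth ((partial2 ^^ j) f)"
  by (induction i, simp_all add: smoothD) (induction j, simp_all add: smoothD)

lemma partial_iterates_diff:
  assumes "smooth f" "smooth g"
  shows "(partial1 ^^ i) (\<lambda>z. f z - g z) = (\<lambda>z. (partial1 ^^ i) f z - (partial1 ^^ i) g z)"
    and "(partial2 ^^ j) (\<lambda>z. f z - g z) = (\<lambda>z. (partial2 ^^ j) f z - (partial2 ^^ j) g z)"
  by (induction i, simp_all add: partial_diff smooth_iterates assms)
     (induction j, simp_all add: partial_diff smooth_iterates assms)

lemma deriv2_diff:
  assumes "smooth f" "smooth g"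
  shows "deriv2 i j (\<lambda>z. f z - g z) = (\<lambda>z. deriv2 i j f z - deriv2 i j g z)"
  by (simp add: partial_iterates_diff smooth_iterates assms)

text \<open>Symmetry of the second derivatives: write \<open>f (x, y) = f (x, c) + \<integral>\<^sub>c\<^sup>y \<partial>\<^sub>2 f (x, t) dt\<close>, and
  differentiate under the integral.\<close>

lemma partial_commute:
  assumes f: "smooth f"
  shows "partial2 (partial1 f) = partial1 (partial2 f)"
proof (rule partial2_eqI)
  fix x y :: real
  \<comment> \<open>Any base point below \<open>y\<close> would do. It makes \<open>y\<close> an
    interior point of \<open>{c..y+1}\<close>, where the integral formula holds, so the derivative
    within this interval is the full derivative.\<close>
  define c where "c = y - 1"
  define g where "g = partial2 f"
  have g: "smooth g" unfolding g_def by (rule smoothD(3)[OF f])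
  have slice: "continuous_on S (\<lambda>t. h (x, t))" if "smooth h" for h S x
    by (rule continuous_on_compose2[OF smoothD(4)[OF that], where f="\<lambda>t. (x, t)"])
       (intro continuous_on_Pair continuous_on_const continuous_on_id, simp)
  have FTC: "f (x, s) = f (x, c) + integral {c..s} (\<lambda>t. g (x, t))" if "c \<le> s" for x s
    using fundamental_theorem_of_calculus[OF that, of "\<lambda>t. f (x, t)" "\<lambda>t. g (x, t)"]
      partial2_has_vector_derivative[OF smoothD(1)[OF f]]
    by (simp add: g_def has_integral_iff)
  have p1: "partial1 f (x, s) = partial1 f (x, c) + integral {c..s} (\<lambda>t. partial1 g (x, t))" if "c \<le> s" for s
  proof -
    have "((\<lambda>x. integral (cbox c s) (\<lambda>t. g (x, t))) has_vector_derivative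
            integral (cbox c s) (\<lambda>t. partial1 g (x, t))) (at x within UNIV)"
    proof (rule leibniz_rule_vector_derivative)
      show "continuous_on (UNIV \<times> cbox c s) (\<lambda>(x, t). partial1 g (x, t))"
        using continuous_on_subset[OF smoothD(4)[OF smoothD(2)[OF g]]] by (simp add: case_prod_eta)
      show "(\<lambda>t. g (x, t)) integrable_on cbox c s" for x
        by (intro integrable_continuous slice g)
    qed (use partial1_has_vector_derivative[OF smoothD(1)[OF g]] in auto)
    then have "((\<lambda>x. f (x, c) + integral {c..s} (\<lambda>t. g (x, t))) has_vector_derivative
            partial1 f (x, c) + integral {c..s} (\<lambda>t. partial1 g (x, t))) (at x)"
      by (intro has_vector_derivative_add partial1_has_vector_derivative smoothD(1) f) simp
    then have "((\<lambda>x. f (x, s)) has_vector_derivative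
            partial1 f (x, c) + integral {c..s} (\<lambda>t. partial1 g (x, t))) (at x)"
      unfolding FTC[OF that, symmetric] .
    with partial1_has_vector_derivative[OF smoothD(1)[OF f]] show ?thesis
      by (rule vector_derivative_unique_at)
  qed
  have "((\<lambda>s. partial1 f (x, c) + integral {c..s} (\<lambda>t. partial1 g (x, t))) has_vector_derivative
      0 + partial1 g (x, y)) (at y within {c..y+1})"
    by (intro has_vector_derivative_add has_vector_derivative_const integral_has_vector_derivative slice
        smoothD(2) g) (auto simp: c_def)
  then have "((\<lambda>s. partial1 f (x, s)) has_vector_derivative partial1 g (x, y)) (at y within {c..y+1})"
    unfolding add_0 by (rule has_vector_derivative_transform[rotated 2]) (simp add: c_def, rule p1, simp)
  moreover have "at y within {c..y+1} = at y"
    by (rule at_within_interior) (simp add: c_def interior_atLeastAtMost_real)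
  ultimately show "((\<lambda>s. partial1 f (x, s)) has_vector_derivative partial1 (partial2 f) (x, y)) (at y)"
    by (simp only: g_def)
qed

lemma partial2_partial1_iterates:
  "smooth f \<Longrightarrow> partial2 ((partial1 ^^ i) f) = (partial1 ^^ i) (partial2 f)"
  by (induction i) (simp_all add: partial_commute smooth_iterates)

section \<open>Polynomial functions on the plane\<close>

inductive_set bipoly :: "(real \<times> real \<Rightarrow> complex) set" where
  monom: "(\<lambda>(x, y). c * complex_of_real x ^ k * complex_of_real y ^ l) \<in> bipoly"
| add: "p \<in> bipoly \<Longrightarrow> q \<in> bipoly \<Longrightarrow> (\<lambda>z. p z + q z) \<in> bipoly"

lemma bipoly_const: "(\<lambda>z. c) \<in> bipoly"
  using bipoly.monom[of c 0 0] by (simp add: case_prod_unfold)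

lemma bipoly_mult:
  assumes "p \<in> bipoly" "q \<in> bipoly"
  shows "(\<lambda>z. p z * q z) \<in> bipoly"
  using assms(1)
proof induction
  case (monom c k l)
  show ?case using assms(2)
  proof induction
    case (monom c' k' l')
    show ?case using bipoly.monom[of "c * c'" "k + k'" "l + l'"]
      by (simp add: case_prod_unfold power_add mult_ac)
  next
    case (add p q)
    then show ?case using bipoly.add by (fastforce simp: distrib_left)
  qed
next
  case (add p q)
  then show ?case using bipoly.add by (fastforce simp: distrib_right)
qed

lemma bipoly_sum: "(\<And>i. i \<in> I \<Longrightarrow> p i \<in> bipoly) \<Longrightarrow> (\<lambda>z. \<Sum>i\<in>I. p i z) \<in> bipoly"
  by (induction I rule: infinite_finite_induct) (auto intro: bipoly_const bipoly.add)

lemma bipoly_power: "p \<in> bipoly \<Longrightarrow> (\<lambda>z. p z ^ n) \<in> bipoly"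
  by (induction n) (auto intro: bipoly_const bipoly_mult)

lemma partial_monom:
  "partial1 (\<lambda>(x, y). c * complex_of_real x ^ k * complex_of_real y ^ l) =
     (\<lambda>(x, y). (c * of_nat k) * complex_of_real x ^ (k - 1) * complex_of_real y ^ l)"
  "partial2 (\<lambda>(x, y). c * complex_of_real x ^ k * complex_of_real y ^ l) =
     (\<lambda>(x, y). (c * of_nat l) * complex_of_real x ^ k * complex_of_real y ^ (l - 1))"
proof -
  have d: "((\<lambda>s. complex_of_real s ^ k) has_vector_derivative of_nat k * complex_of_real x ^ (k - 1)) (at x)"
    for x k
  proof -
    have "((\<lambda>z. z ^ k) has_field_derivative of_nat k * complex_of_real x ^ (k - 1)) (at (complex_of_real x))"
      by (auto intro!: derivative_eq_intros)
    moreover have "(complex_of_real has_vector_derivative 1) (at x)"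
      using has_vector_derivative_of_real[OF DERIV_ident] by simp
    ultimately show ?thesis using field_vector_diff_chain_at[of complex_of_real 1 x "\<lambda>z. z ^ k"]
      by (simp add: o_def)
  qed
  show "partial1 (\<lambda>(x, y). c * complex_of_real x ^ k * complex_of_real y ^ l) =
     (\<lambda>(x, y). (c * of_nat k) * complex_of_real x ^ (k - 1) * complex_of_real y ^ l)"
    using has_vector_derivative_mult_right[OF d, of "c * complex_of_real y ^ l" for y]
    by (intro partial1_eqI) (simp add: mult_ac)
  show "partial2 (\<lambda>(x, y). c * complex_of_real x ^ k * complex_of_real y ^ l) =
     (\<lambda>(x, y). (c * of_nat l) * complex_of_real x ^ k * complex_of_real y ^ (l - 1))"
    using has_vector_derivative_mult_right[OF d, of "c * complex_of_real x ^ k" for x]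
    by (intro partial2_eqI) (simp add: mult_ac)
qed

lemma smooth_bipoly: "p \<in> bipoly \<Longrightarrow> smooth p"
proof (induction rule: bipoly.induct)
  case (monom c k l)
  let ?F = "{\<lambda>(x, y). c * complex_of_real x ^ k * complex_of_real y ^ l |c k l. True}"
  show ?case
  proof (rule smooth_coinduct[where F="?F"])
    fix g assume "g \<in> ?F"
    then obtain c k l where g: "g = (\<lambda>(x, y). c * complex_of_real x ^ k * complex_of_real y ^ l)" by blast
    have "bounded_linear (\<lambda>z. complex_of_real (fst z))" "bounded_linear (\<lambda>z. complex_of_real (snd z))"
      by (rule bounded_linear_compose[OF bounded_linear_of_real], rule bounded_linear_fst bounded_linear_snd)+
    then have "g differentiable_on UNIV"
      unfolding g case_prod_unfold differentiable_on_def
      by (intro ballI differentiable_mult differentiable_power bounded_linear_imp_differentiable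
          differentiable_const)
    then show "g differentiable_on UNIV \<and> partial1 g \<in> ?F \<and> partial2 g \<in> ?F"
      unfolding g partial_monom by blast
  qed blast
qed (rule smooth_add)

lemma bipoly_antiderivative:
  assumes "p \<in> bipoly"
  shows "\<exists>q\<in>bipoly. partial1 q = p" "\<exists>q\<in>bipoly. partial2 q = p"
proof -
  have nz: "complex_of_nat (Suc k) \<noteq> 0" for k by (rule of_nat_neq_0)
  have "(\<exists>q\<in>bipoly. partial1 q = p) \<and> (\<exists>q\<in>bipoly. partial2 q = p)"
    using assms
  proof induction
    case (monom c k l)
    show ?case
      using bipoly.monom[of "c / of_nat (Suc k)" "Suc k" l] bipoly.monom[of "c / of_nat (Suc l)" k "Suc l"]
        partial_monom(1)[of "c / of_nat (Suc k)" "Suc k" l] partial_monom(2)[of "c / of_nat (Suc l)" k "Suc l"] nz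
      by (simp del: of_nat_Suc) blast
  next
    case (add p q)
    then obtain p1 p2 q1 q2 where "p1 \<in> bipoly" "partial1 p1 = p" "p2 \<in> bipoly" "partial2 p2 = p"
      "q1 \<in> bipoly" "partial1 q1 = q" "q2 \<in> bipoly" "partial2 q2 = q" by blast
    then show ?case
      using bipoly.add[of p1 q1] bipoly.add[of p2 q2] partial_add(1)[of p1 q1] partial_add(2)[of p2 q2]
        smoothD(1)[OF smooth_bipoly] by metis
  qed
  then show "\<exists>q\<in>bipoly. partial1 q = p" "\<exists>q\<in>bipoly. partial2 q = p" by auto
qed

lemma real_polynomial_function_bipoly:
  fixes p :: "real \<times> real \<Rightarrow> real"
  assumes "real_polynomial_function p"
  shows "(\<lambda>z. complex_of_real (p z)) \<in> bipoly"
  using assms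
proof induction
  case (linear p)
  interpret bounded_linear p by fact
  obtain a b where ab: "\<And>z. p z = fst z * a + snd z * b"
  proof
    fix z
    show "p z = fst z * p (1, 0) + snd z * p (0, 1)"
      using add[of "fst z *\<^sub>R (1, 0)" "snd z *\<^sub>R (0, 1)"] scaleR[of "fst z" "(1, 0)"] scaleR[of "snd z" "(0, 1)"]
      by simp
  qed
  show ?case
    using bipoly.add[OF bipoly.monom[of a 1 0] bipoly.monom[of b 0 1]]
    by (simp add: ab case_prod_unfold mult.commute)
qed (auto intro: bipoly_const bipoly.add bipoly_mult)

text \<open>Stone-Weierstrass on the square; real and imaginary parts of the approximating function
  are real polynomial functions, which lie in \<open>bipoly\<close>.\<close>

lemma bipoly_uniform_approximation:
  assumes f: "continuous_on UNIV f" and e: "e > 0"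
  obtains p where "p \<in> bipoly" "\<And>x y. \<bar>x\<bar> \<le> R \<Longrightarrow> \<bar>y\<bar> \<le> R \<Longrightarrow> cmod (f (x, y) - p (x, y)) \<le> e"
proof -
  have "continuous_on (cbox (-R, -R) (R, R)) f" using f continuous_on_subset by blast
  then obtain g where g: "polynomial_function g" "\<forall>x\<in>cbox (-R, -R) (R, R). norm (f x - g x) < e"
    using Stone_Weierstrass_polynomial_function[OF compact_cbox _ e] by blast
  have "real_polynomial_function (\<lambda>z. Re (g z))" "real_polynomial_function (\<lambda>z. Im (g z))"
    using g(1) bounded_linear_Re bounded_linear_Im unfolding polynomial_function_def o_def by blast+
  then have "(\<lambda>z. complex_of_real (Re (g z)) + \<i> * complex_of_real (Im (g z))) \<in> bipoly"
    by (intro bipoly.add bipoly_mult bipoly_const real_polynomial_function_bipoly)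
  then have "g \<in> bipoly" by (simp add: complex_eq[symmetric])
  moreover have "cmod (f (x, y) - g (x, y)) \<le> e" if "\<bar>x\<bar> \<le> R" "\<bar>y\<bar> \<le> R" for x y
    using g(2) that by (auto intro!: less_imp_le simp: cbox_Pair_eq abs_le_iff minus_le_iff)
  ultimately show ?thesis using that by blast
qed

section \<open>Density of the polynomials in the smooth functions\<close>

text \<open>Separate orders for the two variables allow induction on one variable at a time; a
  square around the origin lets errors be integrated from the coordinate axes.\<close>

definition Ck_close :: "nat \<Rightarrow> nat \<Rightarrow> real \<Rightarrow> real \<Rightarrow> (real \<times> real \<Rightarrow> complex) \<Rightarrow> (real \<times> real \<Rightarrow> complex) \<Rightarrow> bool" where
  "Ck_close m n R e f g \<longleftrightarrow> (\<forall>i\<le>m. \<forall>j\<le>n. \<forall>x y. \<bar>x\<bar> \<le> R \<longrightarrow> \<bar>y\<bar> \<le> R \<longrightarrow>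
     cmod (deriv2 i j f (x, y) - deriv2 i j g (x, y)) \<le> e)"

lemma Ck_closeD:
  "Ck_close m n R e f g \<Longrightarrow> i \<le> m \<Longrightarrow> j \<le> n \<Longrightarrow> \<bar>x\<bar> \<le> R \<Longrightarrow> \<bar>y\<bar> \<le> R \<Longrightarrow>
     cmod (deriv2 i j f (x, y) - deriv2 i j g (x, y)) \<le> e"
  unfolding Ck_close_def by blast

lemma norm_le_from_derivative_bound:
  fixes h :: "real \<Rightarrow> complex"
  assumes d: "\<And>s. (h has_vector_derivative h' s) (at s within {-R..R})"
    and B: "\<And>s. \<bar>s\<bar> \<le> R \<Longrightarrow> norm (h' s) \<le> B" and t: "\<bar>t\<bar> \<le> R"
  shows "norm (h t) \<le> norm (h 0) + B * R"
proof -
  have R: "0 \<le> R" using t by simp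
  have B0: "0 \<le> B" using order_trans[OF norm_ge_zero B[of 0]] R by simp
  have "norm (h t - h 0) \<le> B * norm (t - 0)"
  proof (rule differentiable_bound[where S="{-R..R}" and f'="\<lambda>s x. x *\<^sub>R h' s"])
    fix s assume s: "s \<in> {-R..R}"
    show "(h has_derivative (\<lambda>x. x *\<^sub>R h' s)) (at s within {-R..R})"
      using d[of s] by (simp add: has_vector_derivative_def)
    show "onorm (\<lambda>x. x *\<^sub>R h' s) \<le> B"
    proof (rule onorm_le)
      fix x :: real
      show "norm (x *\<^sub>R h' s) \<le> B * norm x"
        using mult_right_mono[OF B[of s], of "\<bar>x\<bar>"] s by (simp add: mult.commute abs_le_iff)
    qed
  qed (use t R in auto)
  also have "\<dots> \<le> B * R" using B0 t by (simp add: mult_left_mono)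
  finally show ?thesis using norm_triangle_sub[of "h t" "h 0"] by simp
qed

text \<open>The function is frozen at \<open>y = 0\<close> and extended constantly in
  \<open>y\<close>: this is the shape of the integration constant of an antiderivative in the second
  variable.\<close>

definition restrict_axis1 :: "(real \<times> real \<Rightarrow> complex) \<Rightarrow> real \<times> real \<Rightarrow> complex" where
  "restrict_axis1 f = (\<lambda>(x, y). f (x, 0))"

lemma partial_restrict_axis1:
  assumes "f differentiable_on UNIV"
  shows "partial1 (restrict_axis1 f) = restrict_axis1 (partial1 f)"
    and "partial2 (restrict_axis1 f) = (\<lambda>z. 0)"
  using partial1_has_vector_derivative[OF assms]
  by (auto intro!: partial1_eqI partial2_eqI simp: restrict_axis1_def)

lemma partial1_iterates_restrict_axis1:
  "smooth f \<Longrightarrow> (partial1 ^^ i) (restrict_axis1 f) = restrict_axis1 ((partial1 ^^ i) f)"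
  by (induction i) (simp_all add: partial_restrict_axis1 smoothD(1) smooth_iterates)

lemma bipoly_restrict_axis1: "p \<in> bipoly \<Longrightarrow> restrict_axis1 p \<in> bipoly"
proof (induction rule: bipoly.induct)
  case (monom c k l)
  show ?case using bipoly.monom[of "c * 0 ^ l" k 0] by (simp add: restrict_axis1_def mult_ac)
next
  case (add p q)
  then show ?case using bipoly.add[OF add.IH] by (simp add: restrict_axis1_def case_prod_unfold)
qed

lemma bipoly_restrict_axis2: "p \<in> bipoly \<Longrightarrow> (\<lambda>(x, y). p (0, y)) \<in> bipoly"
proof (induction rule: bipoly.induct)
  case (monom c k l)
  show ?case using bipoly.monom[of "c * 0 ^ k" 0 l] by (simp add: mult_ac)
next
  case (add p q)
  then show ?case using bipoly.add[OF add.IH] by (simp add: case_prod_unfold)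
qed

text \<open>Approximate the derivative by a polynomial \<open>q\<close> and integrate it to
  \<open>Q\<close>. Then \<open>f - Q\<close> has a small derivative in \<open>x\<close>, so it is
  close to its values on the axis \<open>x = 0\<close>, and these are approximated by a polynomial
  in \<open>y\<close> alone.\<close>

lemma bipoly_dense_partial1:
  assumes "smooth f" "e > 0" "R \<ge> 0"
  obtains p where "p \<in> bipoly" "Ck_close n 0 R e f p"
proof -
  have "\<exists>p\<in>bipoly. Ck_close n 0 R e f p"
    using assms(1,2)
  proof (induction n arbitrary: f e)
    case 0
    obtain p where "p \<in> bipoly" "\<And>x y. \<bar>x\<bar> \<le> R \<Longrightarrow> \<bar>y\<bar> \<le> R \<Longrightarrow> cmod (f (x, y) - p (x, y)) \<le> e"
      using bipoly_uniform_approximation[OF smoothD(4)[OF 0(1)] 0(2)] by metis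
    then show ?case by (intro bexI[of _ p]) (auto simp: Ck_close_def)
  next
    case (Suc n)
    \<comment> \<open>Half of \<open>e\<close> pays for the derivative error integrated over a
      length of at most \<open>R\<close>, the other half for the correction on the axis; the 1
      covers \<open>R = 0\<close> and gives \<open>e' \<le> e\<close>.\<close>
    define e' where "e' = e / (2 * (1 + R))"
    have e': "e' > 0" "e' * R \<le> e / 2" "e' \<le> e"
      using Suc.prems assms(3) by (auto simp: e'_def field_simps)
    obtain q where q: "q \<in> bipoly" "Ck_close n 0 R e' (partial1 f) q"
      using Suc.IH[OF smoothD(2)[OF Suc.prems(1)] e'(1)] by blast
    obtain Q where Q: "Q \<in> bipoly" "partial1 Q = q" using bipoly_antiderivative(1)[OF q(1)] by blast
    have fQ: "smooth (\<lambda>z. f z - Q z)" by (intro smooth_diff Suc.prems smooth_bipoly Q)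
    obtain r where r: "r \<in> bipoly" "\<And>x y. \<bar>x\<bar> \<le> R \<Longrightarrow> \<bar>y\<bar> \<le> R \<Longrightarrow> cmod (f (x, y) - Q (x, y) - r (x, y)) \<le> e / 2"
      using bipoly_uniform_approximation[OF smoothD(4)[OF fQ], of "e/2" R] Suc.prems(2) by (metis half_gt_zero)
    \<comment> \<open>Freezing \<open>x = 0\<close> makes the correction independent of
      \<open>x\<close>, so adding it leaves \<open>partial1 Q = q\<close> unchanged.\<close>
    define r0 where "r0 = (\<lambda>(x::real, y). r (0, y))"
    have r0: "r0 \<in> bipoly" unfolding r0_def by (rule bipoly_restrict_axis2[OF r(1)])
    have "partial1 r0 = (\<lambda>z. 0)" by (auto intro!: partial1_eqI simp: r0_def)
    define p where "p = (\<lambda>z. Q z + r0 z)"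
    have p: "p \<in> bipoly" unfolding p_def by (intro bipoly.add Q r0)
    have p': "partial1 p = q"
      unfolding p_def using partial_add(1)[OF smoothD(1)[OF smooth_bipoly[OF Q(1)]] smoothD(1)[OF smooth_bipoly[OF r0]]]
      by (simp add: \<open>partial1 r0 = _\<close> Q(2))
    have "Ck_close (Suc n) 0 R e f p"
      unfolding Ck_close_def
    proof (intro allI impI)
      fix i j :: nat and x y assume ij: "i \<le> Suc n" "j \<le> 0" and xy: "\<bar>x\<bar> \<le> R" "\<bar>y\<bar> \<le> R"
      show "cmod (deriv2 i j f (x, y) - deriv2 i j p (x, y)) \<le> e"
      proof (cases i)
        case 0
        have "cmod (f (x, y) - p (x, y)) \<le> cmod (f (0, y) - p (0, y)) + e' * R"
        proof (rule norm_le_from_derivative_bound[of "\<lambda>s. f (s, y) - p (s, y)" "\<lambda>s. partial1 f (s, y) - q (s, y)"])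
          show "((\<lambda>s. f (s, y) - p (s, y)) has_vector_derivative partial1 f (s, y) - q (s, y)) (at s within {-R..R})" for s
            unfolding p'[symmetric] by (intro has_vector_derivative_diff partial1_has_vector_derivative
                smoothD(1) Suc.prems(1) smooth_bipoly p)
          show "cmod (partial1 f (s, y) - q (s, y)) \<le> e'" if "\<bar>s\<bar> \<le> R" for s
            using Ck_closeD[OF q(2), of 0 0 s y] that xy by simp
        qed (rule xy)
        also have "cmod (f (0, y) - p (0, y)) \<le> e / 2"
          using r(2)[of 0 y] xy assms(3) by (simp add: p_def r0_def algebra_simps)
        finally show ?thesis using 0 ij e' by simp
      next
        case (Suc k)
        have "cmod (deriv2 k 0 (partial1 f) (x, y) - deriv2 k 0 q (x, y)) \<le> e'"
          by (rule Ck_closeD[OF q(2)]) (use Suc ij xy in auto)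
        then show ?thesis using ij e' by (simp add: Suc funpow_swap1 p' del: funpow.simps) (simp add: funpow_Suc_right p' del: funpow.simps)
      qed
    qed
    then show ?case using p by blast
  qed
  then show ?thesis using that by blast
qed

text \<open>The same integration argument in \<open>y\<close>, except that the correction on the
  axis \<open>y = 0\<close> must also match the \<open>x\<close>-derivatives, which is what the
  one-variable version provides. For \<open>j = 0\<close> the \<open>y\<close>-derivative of
  \<open>(partial1 ^^ i) f\<close> is needed, and symmetry of the mixed derivatives reduces it to
  \<open>partial2 f\<close>.\<close>

lemma bipoly_dense:
  assumes "smooth f" "e > 0" "R \<ge> 0"
  obtains p where "p \<in> bipoly" "Ck_close n m R e f p"
proof -
  have "\<exists>p\<in>bipoly. Ck_close n m R e f p"
    using assms(1,2)
  proof (induction m arbitrary: f e)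
    case 0
    then show ?case using bipoly_dense_partial1[OF _ _ assms(3)] by metis
  next
    case (Suc m)
    define e' where "e' = e / (2 * (1 + R))"
    have e': "e' > 0" "e' * R \<le> e / 2" "e' \<le> e"
      using Suc.prems assms(3) by (auto simp: e'_def field_simps)
    obtain q where q: "q \<in> bipoly" "Ck_close n m R e' (partial2 f) q"
      using Suc.IH[OF smoothD(3)[OF Suc.prems(1)] e'(1)] by blast
    obtain Q where Q: "Q \<in> bipoly" "partial2 Q = q" using bipoly_antiderivative(2)[OF q(1)] by blast
    have fQ: "smooth (\<lambda>z. f z - Q z)" by (intro smooth_diff Suc.prems smooth_bipoly Q)
    obtain r where r: "r \<in> bipoly" "Ck_close n 0 R (e/2) (\<lambda>z. f z - Q z) r"
      using bipoly_dense_partial1[OF fQ _ assms(3), of "e/2"] Suc.prems(2) by (metis half_gt_zero)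
    define r0 where "r0 = restrict_axis1 r"
    have r0: "r0 \<in> bipoly" unfolding r0_def by (rule bipoly_restrict_axis1[OF r(1)])
    have r0': "partial2 r0 = (\<lambda>z. 0)"
      unfolding r0_def by (rule partial_restrict_axis1(2)[OF smoothD(1)[OF smooth_bipoly[OF r(1)]]])
    define p where "p = (\<lambda>z. Q z + r0 z)"
    have p: "p \<in> bipoly" unfolding p_def by (intro bipoly.add Q r0)
    have p': "partial2 p = q"
      unfolding p_def using partial_add(2)[OF smoothD(1)[OF smooth_bipoly[OF Q(1)]] smoothD(1)[OF smooth_bipoly[OF r0]]]
      by (simp add: r0' Q(2))
    have fp: "smooth (\<lambda>z. f z - p z)" by (intro smooth_diff Suc.prems smooth_bipoly p)
    have "Ck_close n (Suc m) R e f p"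
      unfolding Ck_close_def
    proof (intro allI impI)
      fix i j :: nat and x y assume ij: "i \<le> n" "j \<le> Suc m" and xy: "\<bar>x\<bar> \<le> R" "\<bar>y\<bar> \<le> R"
      show "cmod (deriv2 i j f (x, y) - deriv2 i j p (x, y)) \<le> e"
      proof (cases j)
        case 0
        define h where "h = (partial1 ^^ i) (\<lambda>z. f z - p z)"
        have h: "smooth h" unfolding h_def by (rule smooth_iterates(1)[OF fp])
        have h': "partial2 h = (\<lambda>z. deriv2 i 0 (partial2 f) z - deriv2 i 0 q z)"
          unfolding h_def partial2_partial1_iterates[OF fp] partial_diff(2)[OF Suc.prems(1) smooth_bipoly[OF p]] p'
          using partial_iterates_diff(1)[OF smoothD(3)[OF Suc.prems(1)] smooth_bipoly[OF q(1)]] by simp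
        have "cmod (h (x, y)) \<le> cmod (h (x, 0)) + e' * R"
        proof (rule norm_le_from_derivative_bound[of "\<lambda>s. h (x, s)" "\<lambda>s. partial2 h (x, s)"])
          show "cmod (partial2 h (x, s)) \<le> e'" if "\<bar>s\<bar> \<le> R" for s
            unfolding h' using Ck_closeD[OF q(2), of i 0 x s] that xy ij by simp
        qed (intro partial2_has_vector_derivative smoothD(1) h, rule xy)
        moreover have "cmod (h (x, 0)) \<le> e / 2"
        proof -
          have "h = (partial1 ^^ i) (\<lambda>z. (f z - Q z) - r0 z)"
            unfolding h_def p_def by (simp add: algebra_simps)
          then have "h = (\<lambda>z. deriv2 i 0 (\<lambda>z. f z - Q z) z - deriv2 i 0 r0 z)"
            using partial_iterates_diff(1)[OF fQ smooth_bipoly[OF r0]] by simp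
          moreover have "deriv2 i 0 r0 (x, 0) = deriv2 i 0 r (x, 0)"
            unfolding r0_def using partial1_iterates_restrict_axis1[OF smooth_bipoly[OF r(1)]]
            by (simp add: restrict_axis1_def)
          ultimately show ?thesis using Ck_closeD[OF r(2), of i 0 x 0] ij xy assms(3) by simp
        qed
        moreover have "h (x, y) = deriv2 i 0 f (x, y) - deriv2 i 0 p (x, y)"
          unfolding h_def using partial_iterates_diff(1)[OF Suc.prems(1) smooth_bipoly[OF p]] by simp
        ultimately show ?thesis using 0 e' by simp
      next
        case (Suc k)
        have "cmod (deriv2 i k (partial2 f) (x, y) - deriv2 i k q (x, y)) \<le> e'"
          by (rule Ck_closeD[OF q(2)]) (use Suc ij xy in auto)
        then show ?thesis using e' by (simp add: Suc funpow_Suc_right p' del: funpow.simps)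
      qed
    qed
    then show ?case using p by blast
  qed
  then show ?thesis using that by blast
qed

section \<open>Continuity of distributions in the seminorms\<close>

lemma cs_distribution_diff:
  assumes u: "cs_distribution u" and f: "smooth f" and g: "smooth g"
  shows "u (\<lambda>z. f z - g z) = u f - u g"
proof -
  have a: "u (\<lambda>z. f z + h z) = u f + u h" if "smooth h" for h
    using u f that unfolding cs_distribution_def by blast
  have m: "u (\<lambda>z. (-1) * g z) = (-1) * u g"
    using u g unfolding cs_distribution_def by blast
  show ?thesis using a[OF smooth_cmult[OF g, of "-1"]] m by simp
qed

text \<open>The freedom to take a larger order \<open>n'\<close> and a larger square
  \<open>R'\<close> lets a single approximant serve two distributions.\<close>

definition Ck_Lipschitz :: "((real \<times> real \<Rightarrow> complex) \<Rightarrow> complex) \<Rightarrow> nat \<Rightarrow> real \<Rightarrow> real \<Rightarrow> bool" where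
  "Ck_Lipschitz u n R D \<longleftrightarrow> R \<ge> 0 \<and> D \<ge> 0 \<and>
     (\<forall>f g e n' R'. smooth f \<longrightarrow> smooth g \<longrightarrow> 0 \<le> e \<longrightarrow> n \<le> n' \<longrightarrow> R \<le> R' \<longrightarrow> Ck_close n' n' R' e f g \<longrightarrow>
       cmod (u f - u g) \<le> D * e)"

lemma Ck_LipschitzD:
  assumes "Ck_Lipschitz u n R D"
  shows "R \<ge> 0" "D \<ge> 0"
    "smooth f \<Longrightarrow> smooth g \<Longrightarrow> 0 \<le> e \<Longrightarrow> n \<le> n' \<Longrightarrow> R \<le> R' \<Longrightarrow> Ck_close n' n' R' e f g \<Longrightarrow>
       cmod (u f - u g) \<le> D * e"
  using assms unfolding Ck_Lipschitz_def by blast+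

lemma cs_distribution_Ck_Lipschitz:
  assumes u: "cs_distribution u"
  shows "\<exists>n R D. Ck_Lipschitz u n R D"
proof -
  obtain K n C where K: "compact K" "K \<noteq> {}" and C: "\<And>f. smooth f \<Longrightarrow>
      cmod (u f) \<le> C * (\<Sum>i\<le>n. \<Sum>j\<le>n. SUP z\<in>K. cmod (deriv2 i j f z))"
    using u unfolding cs_distribution_def by blast
  obtain R where R: "R > 0" "\<And>z. z \<in> K \<Longrightarrow> norm z \<le> R"
    using compact_imp_bounded[OF K(1)] by (auto simp: bounded_pos)
  \<comment> \<open>The seminorm has \<open>(n + 1)\<^sup>2\<close> summands, each between 0 and
    \<open>e\<close>; the absolute value is taken because \<open>C\<close> may be negative.\<close>
  have "Ck_Lipschitz u n R (\<bar>C\<bar> * (real (Suc n))\<^sup>2)"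
    unfolding Ck_Lipschitz_def
  proof (intro conjI allI impI)
    fix f g e n' R' assume f: "smooth f" and g: "smooth g" and e: "0 \<le> e" and n': "n \<le> n'" and R': "R \<le> R'"
      and close: "Ck_close n' n' R' e f g"
    have S: "0 \<le> (SUP z\<in>K. cmod (deriv2 i j (\<lambda>z. f z - g z) z)) \<and>
        (SUP z\<in>K. cmod (deriv2 i j (\<lambda>z. f z - g z) z)) \<le> e" if ij: "i \<le> n" "j \<le> n" for i j
    proof -
      have le: "cmod (deriv2 i j (\<lambda>z. f z - g z) z) \<le> e" if "z \<in> K" for z
      proof -
        obtain x y where z: "z = (x, y)" by (cases z)
        have "\<bar>x\<bar> \<le> R'" "\<bar>y\<bar> \<le> R'"
          using R(2)[OF that] R' norm_fst_le[of x y] norm_snd_le[of y x] by (auto simp: z)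
        then show ?thesis
          unfolding deriv2_diff[OF f g] z using Ck_closeD[OF close, of i j x y] ij n' by simp
      qed
      obtain z0 where z0: "z0 \<in> K" using K(2) by blast
      have "bdd_above ((\<lambda>z. cmod (deriv2 i j (\<lambda>z. f z - g z) z)) ` K)"
        using le by (rule bdd_aboveI2)
      then have "cmod (deriv2 i j (\<lambda>z. f z - g z) z0) \<le> (SUP z\<in>K. cmod (deriv2 i j (\<lambda>z. f z - g z) z))"
        using z0 by (intro cSUP_upper)
      then have "0 \<le> (SUP z\<in>K. cmod (deriv2 i j (\<lambda>z. f z - g z) z))"
        by (rule order_trans[OF norm_ge_zero])
      moreover have "(SUP z\<in>K. cmod (deriv2 i j (\<lambda>z. f z - g z) z)) \<le> e"
        by (rule cSUP_least[OF K(2) le])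
      ultimately show ?thesis by (rule conjI)
    qed
    let ?S = "\<Sum>i\<le>n. \<Sum>j\<le>n. SUP z\<in>K. cmod (deriv2 i j (\<lambda>z. f z - g z) z)"
    have "?S \<le> (\<Sum>i\<le>n. \<Sum>j\<le>n. e)" by (intro sum_mono) (use S in simp)
    also have "\<dots> = (real (Suc n))\<^sup>2 * e" by (simp add: power2_eq_square algebra_simps)
    finally have S': "?S \<le> (real (Suc n))\<^sup>2 * e" "0 \<le> ?S" using S by (auto intro!: sum_nonneg)
    have "cmod (u f - u g) \<le> C * ?S"
      using C[OF smooth_diff[OF f g]] cs_distribution_diff[OF u f g] by simp
    also have "\<dots> \<le> \<bar>C\<bar> * ?S" using S'(2) by (intro mult_right_mono) auto
    also have "\<dots> \<le> \<bar>C\<bar> * ((real (Suc n))\<^sup>2 * e)" using S'(1) by (intro mult_left_mono) auto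
    finally show "cmod (u f - u g) \<le> \<bar>C\<bar> * (real (Suc n))\<^sup>2 * e" by (simp add: mult.assoc)
  qed (use R in auto)
  then show ?thesis by blast
qed

lemma cs_distribution_eq_if_eq_on_bipoly:
  assumes u: "cs_distribution u" and v: "cs_distribution v" and eq: "\<And>p. p \<in> bipoly \<Longrightarrow> u p = v p"
  shows "u = v"
proof
  fix f
  show "u f = v f"
  proof (cases "smooth f")
    case False
    then show ?thesis using u v by (simp add: cs_distribution_def)
  next
    case f: True
    obtain n R D where nRD: "Ck_Lipschitz u n R D" using cs_distribution_Ck_Lipschitz[OF u] by blast
    obtain n2 R2 D2 where nRD2: "Ck_Lipschitz v n2 R2 D2" using cs_distribution_Ck_Lipschitz[OF v] by blast
    \<comment> \<open>The summand 1 keeps the factor positive even if both Lipschitz constants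
      vanish, so that it can be divided out.\<close>
    have "cmod (u f - v f) \<le> (D + D2 + 1) * e" if e: "e > 0" for e
    proof -
      obtain p where p: "p \<in> bipoly" "Ck_close (max n n2) (max n n2) (max R R2) e f p"
        using bipoly_dense[OF f e, of "max R R2"] Ck_LipschitzD(1)[OF nRD] by (metis max.coboundedI1)
      have "cmod (u f - u p) \<le> D * e"
        by (rule Ck_LipschitzD(3)[OF nRD f smooth_bipoly[OF p(1)] _ _ _ p(2)]) (use e in auto)
      moreover have "cmod (v f - v p) \<le> D2 * e"
        by (rule Ck_LipschitzD(3)[OF nRD2 f smooth_bipoly[OF p(1)] _ _ _ p(2)]) (use e in auto)
      ultimately have "cmod ((u f - u p) - (v f - v p)) \<le> D * e + D2 * e"
        using norm_triangle_ineq4[of "u f - u p" "v f - v p"] by linarith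
      then show ?thesis using eq[OF p(1)] e by (simp add: algebra_simps)
    qed
    moreover have D: "D + D2 + 1 > 0" using Ck_LipschitzD(2)[OF nRD] Ck_LipschitzD(2)[OF nRD2] by simp
    ultimately have "cmod (u f - v f) \<le> t" if "t > 0" for t
      using that by (metis D divide_pos_pos less_irrefl nonzero_mult_div_cancel_left times_divide_eq_right)
    then have "cmod (u f - v f) \<le> 0" using field_le_epsilon[of "cmod (u f - v f)" 0] by simp
    then show ?thesis by simp
  qed
qed

section \<open>The Fourier transform determines a distribution\<close>

definition plane_wave :: "real \<times> real \<Rightarrow> real \<times> real \<Rightarrow> complex" where
  "plane_wave \<theta> = (\<lambda>z. exp (\<i> * complex_of_real (\<theta> \<bullet> z)))"

text \<open>With the cut at \<open>n < M\<close>, a partial derivative takes the polynomial for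
  \<open>Suc M\<close> exactly to a multiple of the one for \<open>M\<close>.\<close>

definition plane_wave_Taylor :: "real \<times> real \<Rightarrow> nat \<Rightarrow> real \<times> real \<Rightarrow> complex" where
  "plane_wave_Taylor \<theta> M = (\<lambda>z. \<Sum>n<M. (\<i> ^ n / fact n) * complex_of_real (\<theta> \<bullet> z) ^ n)"

lemma bipoly_inner_power: "(\<lambda>z. complex_of_real (\<theta> \<bullet> z) ^ n) \<in> bipoly"
proof (rule bipoly_power)
  have "(\<lambda>z. complex_of_real (\<theta> \<bullet> z)) = (\<lambda>z.
      (\<lambda>(x, y). complex_of_real (fst \<theta>) * complex_of_real x ^ 1 * complex_of_real y ^ 0) z +
      (\<lambda>(x, y). complex_of_real (snd \<theta>) * complex_of_real x ^ 0 * complex_of_real y ^ 1) z)"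
    by (auto simp: fun_eq_iff inner_prod_def)
  then show "(\<lambda>z. complex_of_real (\<theta> \<bullet> z)) \<in> bipoly"
    using bipoly.add[OF bipoly.monom[of "complex_of_real (fst \<theta>)" 1 0] bipoly.monom[of "complex_of_real (snd \<theta>)" 0 1]]
    by simp
qed

lemma bipoly_plane_wave_Taylor: "plane_wave_Taylor \<theta> M \<in> bipoly"
  unfolding plane_wave_Taylor_def by (intro bipoly_sum bipoly_mult bipoly_const bipoly_inner_power)

lemma has_vector_derivative_inner:
  "((\<lambda>s. complex_of_real (\<theta> \<bullet> (s, y))) has_vector_derivative complex_of_real (fst \<theta>)) (at x)"
  "((\<lambda>s. complex_of_real (\<theta> \<bullet> (x, s))) has_vector_derivative complex_of_real (snd \<theta>)) (at y)"
  by (rule has_vector_derivative_of_real; auto intro!: derivative_eq_intros simp: inner_prod_def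
      has_real_derivative_iff_has_vector_derivative[symmetric])+

lemma partial_plane_wave:
  "partial1 (\<lambda>z. c * plane_wave \<theta> z) = (\<lambda>z. (c * (\<i> * complex_of_real (fst \<theta>))) * plane_wave \<theta> z)"
  "partial2 (\<lambda>z. c * plane_wave \<theta> z) = (\<lambda>z. (c * (\<i> * complex_of_real (snd \<theta>))) * plane_wave \<theta> z)"
proof -
  have e: "((\<lambda>w. c * exp (\<i> * w)) has_field_derivative c * (\<i> * exp (\<i> * w))) (at w)" for w
    by (auto intro!: derivative_eq_intros)
  show "partial1 (\<lambda>z. c * plane_wave \<theta> z) = (\<lambda>z. (c * (\<i> * complex_of_real (fst \<theta>))) * plane_wave \<theta> z)"
    using field_vector_diff_chain_at[OF has_vector_derivative_inner(1) e]
    by (intro partial1_eqI) (simp add: plane_wave_def o_def mult_ac)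
  show "partial2 (\<lambda>z. c * plane_wave \<theta> z) = (\<lambda>z. (c * (\<i> * complex_of_real (snd \<theta>))) * plane_wave \<theta> z)"
    using field_vector_diff_chain_at[OF has_vector_derivative_inner(2) e]
    by (intro partial2_eqI) (simp add: plane_wave_def o_def mult_ac)
qed

lemma smooth_plane_wave: "smooth (plane_wave \<theta>)"
proof (rule smooth_coinduct)
  let ?F = "{\<lambda>z. c * plane_wave \<theta> z |c. True}"
  have "plane_wave \<theta> = (\<lambda>z. 1 * plane_wave \<theta> z)" by simp
  then show "plane_wave \<theta> \<in> ?F" by blast
  fix g assume "g \<in> ?F"
  then obtain c where g: "g = (\<lambda>z. c * plane_wave \<theta> z)" by blast
  have exp: "exp differentiable (at w)" for w :: complex
    unfolding differentiable_def using DERIV_exp[of w] has_field_derivative_imp_has_derivative by blast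
  have bl: "bounded_linear (\<lambda>z. \<i> * complex_of_real (\<theta> \<bullet> z))"
    by (rule bounded_linear_compose[OF bounded_linear_mult_right
          bounded_linear_compose[OF bounded_linear_of_real bounded_linear_inner_right]])
  have "g differentiable (at z)" for z
    unfolding g plane_wave_def
    by (rule differentiable_mult[OF differentiable_const
          differentiable_compose[OF exp bounded_linear_imp_differentiable[OF bl]]])
  then show "g differentiable_on UNIV \<and> partial1 g \<in> ?F \<and> partial2 g \<in> ?F"
    unfolding g partial_plane_wave differentiable_on_def by blast
qed

lemma deriv2_plane_wave:
  "deriv2 i j (\<lambda>z. c * plane_wave \<theta> z) =
     (\<lambda>z. (c * (\<i> * complex_of_real (fst \<theta>)) ^ i * (\<i> * complex_of_real (snd \<theta>)) ^ j) * plane_wave \<theta> z)"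
proof -
  have p2: "(partial2 ^^ j) (\<lambda>z. c * plane_wave \<theta> z) =
     (\<lambda>z. (c * (\<i> * complex_of_real (snd \<theta>)) ^ j) * plane_wave \<theta> z)"
    by (induction j) (simp_all only: funpow.simps id_apply o_apply partial_plane_wave power_0 power_Suc2 mult_1_right mult.assoc[symmetric])
  have p1: "(partial1 ^^ i) (\<lambda>z. d * plane_wave \<theta> z) =
     (\<lambda>z. (d * (\<i> * complex_of_real (fst \<theta>)) ^ i) * plane_wave \<theta> z)" for d
    by (induction i) (simp_all only: funpow.simps id_apply o_apply partial_plane_wave power_0 power_Suc2 mult_1_right mult.assoc[symmetric])
  show ?thesis unfolding p2 p1 by (rule ext) (simp add: mult_ac)
qed

text \<open>The term \<open>n = 0\<close>, where \<open>n - 1\<close> is truncated to 0, is removed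
  by the factor \<open>of_nat n\<close>; the rest is an index shift.\<close>

lemma plane_wave_Taylor_derivative_coeff:
  "(\<Sum>n<Suc M. (\<i> ^ n / fact n) * (of_nat n * w ^ (n - 1) * a)) =
     (\<i> * a) * (\<Sum>n<M. (\<i> ^ n / fact n) * (w :: complex) ^ n)"
proof -
  have "(\<Sum>n<Suc M. (\<i> ^ n / fact n) * (of_nat n * w ^ (n - 1) * a)) =
      (\<Sum>n<M. (\<i> ^ Suc n / fact (Suc n)) * (of_nat (Suc n) * w ^ n * a))"
    by (subst sum.lessThan_Suc_shift) simp
  also have "\<dots> = (\<Sum>n<M. (\<i> * a) * ((\<i> ^ n / fact n) * w ^ n))"
  proof (rule sum.cong[OF refl])
    fix n
    have "\<i> ^ Suc n / fact (Suc n) * complex_of_nat (Suc n) = \<i> * (\<i> ^ n / fact n)"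
      by (simp add: divide_simps del: of_nat_Suc)
    then show "(\<i> ^ Suc n / fact (Suc n)) * (of_nat (Suc n) * w ^ n * a) = (\<i> * a) * ((\<i> ^ n / fact n) * w ^ n)"
      by (metis mult.assoc mult.commute)
  qed
  finally show ?thesis by (simp add: sum_distrib_left)
qed

lemma partial_plane_wave_Taylor:
  "partial1 (\<lambda>z. c * plane_wave_Taylor \<theta> (Suc M) z) =
     (\<lambda>z. (c * (\<i> * complex_of_real (fst \<theta>))) * plane_wave_Taylor \<theta> M z)"
  "partial2 (\<lambda>z. c * plane_wave_Taylor \<theta> (Suc M) z) =
     (\<lambda>z. (c * (\<i> * complex_of_real (snd \<theta>))) * plane_wave_Taylor \<theta> M z)"
proof -
  have e: "((\<lambda>w. c * (\<Sum>n<Suc M. (\<i> ^ n / fact n) * w ^ n)) has_field_derivative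
      c * (\<Sum>n<Suc M. (\<i> ^ n / fact n) * (of_nat n * w ^ (n - 1) * 1))) (at w)" for w
    by (intro DERIV_cmult DERIV_sum) (auto intro!: derivative_eq_intros)
  note e' = e[unfolded plane_wave_Taylor_derivative_coeff]
  show "partial1 (\<lambda>z. c * plane_wave_Taylor \<theta> (Suc M) z) =
     (\<lambda>z. (c * (\<i> * complex_of_real (fst \<theta>))) * plane_wave_Taylor \<theta> M z)"
    using field_vector_diff_chain_at[OF has_vector_derivative_inner(1) e']
    by (intro partial1_eqI) (simp add: plane_wave_Taylor_def o_def mult_ac del: sum.lessThan_Suc)
  show "partial2 (\<lambda>z. c * plane_wave_Taylor \<theta> (Suc M) z) =
     (\<lambda>z. (c * (\<i> * complex_of_real (snd \<theta>))) * plane_wave_Taylor \<theta> M z)"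
    using field_vector_diff_chain_at[OF has_vector_derivative_inner(2) e']
    by (intro partial2_eqI) (simp add: plane_wave_Taylor_def o_def mult_ac del: sum.lessThan_Suc)
qed

lemma deriv2_plane_wave_Taylor:
  "deriv2 i j (\<lambda>z. c * plane_wave_Taylor \<theta> (M + i + j) z) =
     (\<lambda>z. (c * (\<i> * complex_of_real (fst \<theta>)) ^ i * (\<i> * complex_of_real (snd \<theta>)) ^ j) * plane_wave_Taylor \<theta> M z)"
proof -
  have p2: "(partial2 ^^ j) (\<lambda>z. c * plane_wave_Taylor \<theta> (M + j) z) =
     (\<lambda>z. (c * (\<i> * complex_of_real (snd \<theta>)) ^ j) * plane_wave_Taylor \<theta> M z)" for c M j
    by (induction j arbitrary: c)
       (simp_all only: funpow_Suc_right funpow_0 o_apply add_Suc_right add_0_right partial_plane_wave_Taylor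
         power_0 power_Suc mult_1_right mult.assoc[symmetric])
  have p1: "(partial1 ^^ i) (\<lambda>z. c * plane_wave_Taylor \<theta> (M + i) z) =
     (\<lambda>z. (c * (\<i> * complex_of_real (fst \<theta>)) ^ i) * plane_wave_Taylor \<theta> M z)" for c M i
    by (induction i arbitrary: c)
       (simp_all only: funpow_Suc_right funpow_0 o_apply add_Suc_right add_0_right partial_plane_wave_Taylor
         power_0 power_Suc mult_1_right mult.assoc[symmetric])
  show ?thesis unfolding p2 p1 by (rule ext) (simp add: mult_ac)
qed

lemma plane_wave_Taylor_error:
  assumes "\<bar>\<theta> \<bullet> z\<bar> \<le> B"
  shows "cmod (plane_wave \<theta> z - plane_wave_Taylor \<theta> (Suc n) z) \<le> B ^ Suc n / fact n"
proof -
  \<comment> \<open>The exponent is purely imaginary, so the exponential factor in the Taylor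
    remainder bound equals 1.\<close>
  have "cmod (exp (\<i> * complex_of_real (\<theta> \<bullet> z)) - (\<Sum>k\<le>n. (\<i> * complex_of_real (\<theta> \<bullet> z)) ^ k / fact k))
      \<le> \<bar>\<theta> \<bullet> z\<bar> ^ Suc n / fact n"
    using Taylor_exp[of "\<i> * complex_of_real (\<theta> \<bullet> z)" n] by (simp add: norm_mult)
  also have "\<dots> \<le> B ^ Suc n / fact n" using assms by (intro divide_right_mono power_mono) auto
  finally show ?thesis
    by (simp add: plane_wave_def plane_wave_Taylor_def lessThan_Suc_atMost power_mult_distrib)
qed

text \<open>A derivative of order \<open>(i, j)\<close> multiplies the plane wave and a Taylor
  polynomial shorter by \<open>i + j\<close> terms by the same constant, so every derivative error
  is a multiple of an ordinary Taylor error.\<close>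

lemma Ck_close_plane_wave_Taylor:
  assumes "e > 0"
  shows "\<forall>\<^sub>F M in sequentially. Ck_close m m R e (plane_wave \<theta>) (plane_wave_Taylor \<theta> M)"
proof -
  \<comment> \<open>Keeping \<open>L\<close> at least 1 bounds \<open>L ^ (i + j)\<close> by
    \<open>L ^ (2 * m)\<close> uniformly in \<open>i\<close> and \<open>j\<close>. The constant
    \<open>B\<close> bounds \<open>\<theta> \<bullet> z\<close> on the square, where
    \<open>norm z \<le> 2 * \<bar>R\<bar>\<close>.\<close>
  define L where "L = max 1 (norm \<theta>)"
  define B where "B = norm \<theta> * (2 * \<bar>R\<bar>)"
  have L: "L \<ge> 1" "norm \<theta> \<le> L" by (auto simp: L_def)
  have th: "\<bar>fst \<theta>\<bar> \<le> L" "\<bar>snd \<theta>\<bar> \<le> L"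
    using norm_fst_le[of "fst \<theta>" "snd \<theta>"] norm_snd_le[of "snd \<theta>" "fst \<theta>"] L(2) by auto
  have "(\<lambda>n. B ^ n / fact n) \<longlonglongrightarrow> 0" 
    using summable_LIMSEQ_zero[OF summable_exp[of B]] by (simp add: divide_inverse mult.commute)
  then have "(\<lambda>n. L ^ (2 * m) * (B * (B ^ n / fact n))) \<longlonglongrightarrow> L ^ (2 * m) * (B * 0)"
    by (intro tendsto_mult tendsto_const)
  then have "\<forall>\<^sub>F n in sequentially. L ^ (2 * m) * (B * (B ^ n / fact n)) < e"
    using assms by (intro order_tendstoD(2)) auto
  then obtain N where N: "\<And>n. n \<ge> N \<Longrightarrow> L ^ (2 * m) * (B * (B ^ n / fact n)) < e"
    unfolding eventually_sequentially by blast
  have "Ck_close m m R e (plane_wave \<theta>) (plane_wave_Taylor \<theta> M)" if M: "M \<ge> N + 2 * m + 1" for M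
    unfolding Ck_close_def
  proof (intro allI impI)
    fix i j x y assume ij: "i \<le> m" "j \<le> m" and xy: "\<bar>x\<bar> \<le> R" "\<bar>y\<bar> \<le> R"
    \<comment> \<open>\<open>Suc n\<close> terms of the Taylor polynomial are left after
      \<open>i + j\<close> differentiations.\<close>
    define n where "n = M - i - j - 1"
    have n: "M = Suc n + i + j" "n \<ge> N" using M ij by (auto simp: n_def)
    define c where "c = (\<i> * complex_of_real (fst \<theta>)) ^ i * (\<i> * complex_of_real (snd \<theta>)) ^ j"
    have "norm (x, y) \<le> 2 * \<bar>R\<bar>" using norm_Pair_le[of x y] xy by simp
    then have "\<bar>\<theta> \<bullet> (x, y)\<bar> \<le> B"
      unfolding B_def by (intro order_trans[OF Cauchy_Schwarz_ineq2] mult_left_mono) auto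
    then have err: "cmod (plane_wave \<theta> (x, y) - plane_wave_Taylor \<theta> (Suc n) (x, y)) \<le> B ^ Suc n / fact n"
      by (rule plane_wave_Taylor_error)
    have "cmod c \<le> L ^ i * L ^ j"
      unfolding c_def norm_mult norm_power using th by (intro mult_mono power_mono) auto
    also have "\<dots> \<le> L ^ (2 * m)"
      unfolding power_add[symmetric] using ij L(1) by (intro power_increasing) auto
    finally have c: "cmod c \<le> L ^ (2 * m)" .
    have "deriv2 i j (plane_wave \<theta>) (x, y) - deriv2 i j (plane_wave_Taylor \<theta> M) (x, y) =
        c * (plane_wave \<theta> (x, y) - plane_wave_Taylor \<theta> (Suc n) (x, y))"
      using deriv2_plane_wave[of i j 1 \<theta>] deriv2_plane_wave_Taylor[of i j 1 \<theta> "Suc n"]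
      by (simp add: n(1) c_def algebra_simps)
    then have "cmod (deriv2 i j (plane_wave \<theta>) (x, y) - deriv2 i j (plane_wave_Taylor \<theta> M) (x, y)) =
        cmod c * cmod (plane_wave \<theta> (x, y) - plane_wave_Taylor \<theta> (Suc n) (x, y))"
      by (simp only: norm_mult)
    also have "\<dots> \<le> L ^ (2 * m) * (B ^ Suc n / fact n)"
      using L(1) by (intro mult_mono c err) auto
    also have "\<dots> \<le> e" using N[OF n(2)] by simp
    finally show "cmod (deriv2 i j (plane_wave \<theta>) (x, y) - deriv2 i j (plane_wave_Taylor \<theta> M) (x, y)) \<le> e" .
  qed
  then show ?thesis unfolding eventually_sequentially by blast
qed

lemma cs_distribution_cmult: "cs_distribution u \<Longrightarrow> smooth f \<Longrightarrow> u (\<lambda>z. c * f z) = c * u f"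
  and cs_distribution_add: "cs_distribution u \<Longrightarrow> smooth f \<Longrightarrow> smooth g \<Longrightarrow> u (\<lambda>z. f z + g z) = u f + u g"
  unfolding cs_distribution_def by blast+

lemma cs_distribution_sum:
  assumes u: "cs_distribution u" and f: "\<And>i. i \<in> I \<Longrightarrow> f i \<in> bipoly"
  shows "u (\<lambda>z. \<Sum>i\<in>I. f i z) = (\<Sum>i\<in>I. u (f i))"
proof -
  have zero: "u (\<lambda>z. 0) = 0" using cs_distribution_cmult[OF u smooth_zero, of 0] by simp
  show ?thesis using f
    by (induction I rule: infinite_finite_induct)
       (simp_all add: zero cs_distribution_add[OF u] smooth_bipoly bipoly_sum)
qed

text \<open>The Taylor polynomials converge to the plane wave in the seminorms controlling
  \<open>u\<close>, so \<open>u\<close> may be applied termwise. Evaluated at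
  \<open>r *\<^sub>R \<theta>\<close>, the terms form a power series in \<open>r\<close>.\<close>

lemma fourier_sums:
  assumes u: "cs_distribution u"
  shows "(\<lambda>n. (\<i> ^ n / fact n) * u (\<lambda>z. complex_of_real (\<theta> \<bullet> z) ^ n)) sums fourier u \<theta>"
proof -
  obtain n R D where nRD: "Ck_Lipschitz u n R D" using cs_distribution_Ck_Lipschitz[OF u] by blast
  have "(\<lambda>M. u (plane_wave_Taylor \<theta> M)) \<longlonglongrightarrow> u (plane_wave \<theta>)"
  proof (rule tendstoI)
    fix e :: real assume e: "e > 0"
    \<comment> \<open>\<open>D + 1\<close> is used because \<open>D\<close> may be 0.\<close>
    define d where "d = e / (2 * (D + 1))"
    have D: "D \<ge> 0" by (rule Ck_LipschitzD(2)[OF nRD])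
    have d: "d > 0" "D * d < e" using e D by (auto simp: d_def field_simps intro: add_nonneg_pos)
    show "\<forall>\<^sub>F M in sequentially. dist (u (plane_wave_Taylor \<theta> M)) (u (plane_wave \<theta>)) < e"
      using Ck_close_plane_wave_Taylor[OF d(1), of n R \<theta>]
    proof eventually_elim
      case (elim M)
      have "cmod (u (plane_wave \<theta>) - u (plane_wave_Taylor \<theta> M)) \<le> D * d"
        by (rule Ck_LipschitzD(3)[OF nRD smooth_plane_wave smooth_bipoly[OF bipoly_plane_wave_Taylor] _ _ _ elim])
           (use d in auto)
      then show ?case using d by (simp add: dist_norm norm_minus_commute)
    qed
  qed
  moreover have "u (plane_wave_Taylor \<theta> M) = (\<Sum>n<M. (\<i> ^ n / fact n) * u (\<lambda>z. complex_of_real (\<theta> \<bullet> z) ^ n))" for M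
    unfolding plane_wave_Taylor_def
    by (subst cs_distribution_sum[OF u])
       (rule bipoly_mult[OF bipoly_const bipoly_inner_power],
        simp only: cs_distribution_cmult[OF u smooth_bipoly[OF bipoly_inner_power]])
  moreover have "fourier u \<theta> = u (plane_wave \<theta>)" by (simp add: fourier_def plane_wave_def)
  ultimately show ?thesis by (simp add: sums_def)
qed

text \<open>For real coefficients, once those below \<open>n\<close> are known to vanish, division
  by \<open>r ^ n\<close> and the limit \<open>r\<close> to 0 isolate the \<open>n\<close>-th. Real
  arguments allow a split into real and imaginary parts.\<close>

lemma powser_eq_0_imp_coeff_eq_0:
  fixes a :: "nat \<Rightarrow> complex"
  assumes "\<And>r. (\<lambda>n. a n * complex_of_real r ^ n) sums 0"
  shows "a n = 0"
proof -
  have real: "b n = 0" if b: "\<And>r. (\<lambda>n. b n * r ^ n) sums 0" for b :: "nat \<Rightarrow> real" and n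
  proof (induction n rule: less_induct)
    case (less n)
    have "(\<lambda>k. b (k + n) * r ^ k) sums 0" if "r \<noteq> 0" for r
    proof -
      have "(\<lambda>k. b (k + n) * r ^ (k + n)) sums (0 - (\<Sum>i<n. b i * r ^ i))"
        using b[of r] by (rule sums_split_initial_segment)
      then have "(\<lambda>k. b (k + n) * r ^ (k + n)) sums 0" using less by simp
      then have "(\<lambda>k. b (k + n) * r ^ (k + n) / r ^ n) sums (0 / r ^ n)" by (rule sums_divide)
      then show ?thesis using that by (simp add: power_add)
    qed
    then have "((\<lambda>r. 0) \<longlongrightarrow> b (0 + n)) (at (0::real))"
      by (intro powser_limit_0_strong[where s=1 and a="\<lambda>k. b (k + n)" and f="\<lambda>_. 0"]) auto
    then show ?case using tendsto_unique[OF at_neq_bot _ tendsto_const[of 0 "at (0::real)"]] by fastforce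
  qed
  have "Re (a n) = 0"
    by (rule real) (use sums_Re[OF assms] in \<open>simp flip: of_real_power\<close>)
  moreover have "Im (a n) = 0"
    by (rule real) (use sums_Im[OF assms] in \<open>simp flip: of_real_power\<close>)
  ultimately show ?thesis by (simp add: complex_eq_iff)
qed

text \<open>Comparing power series along the ray of \<open>\<theta>\<close> gives equal values on
  \<open>(\<theta> \<bullet> z) ^ n\<close>. For \<open>\<theta> = (s, 1)\<close> these are
  polynomials in \<open>s\<close>, whose coefficient at \<open>s ^ k\<close> is a nonzero binomial
  multiple of the moment of \<open>x ^ k * y ^ l\<close>, where \<open>n = k + l\<close>.\<close>

theorem cs_distribution_eq_if_fourier_eq:
  assumes u: "cs_distribution u" and v: "cs_distribution v" and eq: "\<And>\<theta>. fourier u \<theta> = fourier v \<theta>"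
  shows "u = v"
proof (rule cs_distribution_eq_if_eq_on_bipoly[OF u v])
  have inner: "u (\<lambda>z. complex_of_real (\<theta> \<bullet> z) ^ n) = v (\<lambda>z. complex_of_real (\<theta> \<bullet> z) ^ n)" for \<theta> n
  proof -
    define a where "a = (\<lambda>n. (\<i> ^ n / fact n) *
        (u (\<lambda>z. complex_of_real (\<theta> \<bullet> z) ^ n) - v (\<lambda>z. complex_of_real (\<theta> \<bullet> z) ^ n)))"
    have scale: "w (\<lambda>z. complex_of_real ((r *\<^sub>R \<theta>) \<bullet> z) ^ n) = complex_of_real r ^ n * w (\<lambda>z. complex_of_real (\<theta> \<bullet> z) ^ n)"
      if "cs_distribution w" for w r n
      using cs_distribution_cmult[OF that smooth_bipoly[OF bipoly_inner_power[of \<theta> n]], of "complex_of_real r ^ n"]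
      by (simp add: power_mult_distrib)
    have "(\<lambda>n. a n * complex_of_real r ^ n) sums 0" for r
      using sums_diff[OF fourier_sums[OF u, of "r *\<^sub>R \<theta>"] fourier_sums[OF v, of "r *\<^sub>R \<theta>"]]
      unfolding scale[OF u] scale[OF v] a_def eq by (simp add: algebra_simps)
    then have "a n = 0" by (rule powser_eq_0_imp_coeff_eq_0)
    then show ?thesis by (simp add: a_def)
  qed
  have monom_eq: "u (\<lambda>(x, y). 1 * complex_of_real x ^ k * complex_of_real y ^ l) =
      v (\<lambda>(x, y). 1 * complex_of_real x ^ k * complex_of_real y ^ l)" for k l
  proof -
    define m where "m = (\<lambda>k l (x, y). 1 * complex_of_real x ^ k * complex_of_real y ^ l)"
    \<comment> \<open>The polynomial in \<open>s\<close> is padded with zero coefficients so that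
      the power series lemma applies a second time.\<close>
    define a where "a = (\<lambda>i. if i \<le> k + l then of_nat ((k + l) choose i) * (u (m i (k + l - i)) - v (m i (k + l - i))) else 0)"
    have mb: "m i j \<in> bipoly" for i j unfolding m_def by (rule bipoly.monom)
    have expand: "w (\<lambda>z. complex_of_real ((s, 1) \<bullet> z) ^ (k + l)) =
        (\<Sum>i\<le>k + l. (of_nat ((k + l) choose i) * complex_of_real s ^ i) * w (m i (k + l - i)))"
      if w: "cs_distribution w" for w s
    proof -
      have "(\<lambda>z. complex_of_real ((s, 1) \<bullet> z) ^ (k + l)) =
          (\<lambda>z. \<Sum>i\<le>k + l. (of_nat ((k + l) choose i) * complex_of_real s ^ i) * m i (k + l - i) z)"
        by (auto simp: fun_eq_iff binomial_ring m_def power_mult_distrib intro!: sum.cong)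
      then show ?thesis
        by (simp add: cs_distribution_sum[OF w] bipoly_mult bipoly_const mb cs_distribution_cmult[OF w] smooth_bipoly)
    qed
    have "(\<lambda>n. a n * complex_of_real s ^ n) sums 0" for s
    proof -
      have "(\<lambda>n. a n * complex_of_real s ^ n) sums (\<Sum>n\<le>k + l. a n * complex_of_real s ^ n)"
        by (rule sums_finite) (auto simp: a_def)
      moreover have "(\<Sum>n\<le>k + l. a n * complex_of_real s ^ n) = 0"
        using inner[of "(s, 1)" "k + l"] unfolding expand[OF u] expand[OF v]
        by (simp add: a_def algebra_simps sum_subtractf)
      ultimately show ?thesis by simp
    qed
    then have "a k = 0" by (rule powser_eq_0_imp_coeff_eq_0)
    then show ?thesis by (simp add: a_def m_def)
  qed
  fix p assume "p \<in> bipoly"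
  then show "u p = v p"
  proof induction
    case (monom c k l)
    have cm: "w (\<lambda>(x, y). c * complex_of_real x ^ k * complex_of_real y ^ l) =
        c * w (\<lambda>(x, y). 1 * complex_of_real x ^ k * complex_of_real y ^ l)" if "cs_distribution w" for w
      using cs_distribution_cmult[OF that smooth_bipoly[OF bipoly.monom[of 1 k l]], of c]
      by (simp add: case_prod_unfold mult.assoc)
    show ?case by (simp only: cm[OF u] cm[OF v] monom_eq)
  next
    case (add p q)
    then show ?case using u v by (simp add: cs_distribution_add smooth_bipoly)
  qed
qed

section \<open>The joint distribution\<close>

lemma has_sum_finite_sum:
  fixes f :: "'i \<Rightarrow> 'j \<Rightarrow> complex"
  assumes "\<And>i. i \<in> F \<Longrightarrow> (f i has_sum s i) J"
  shows "((\<lambda>j. \<Sum>i\<in>F. f i j) has_sum (\<Sum>i\<in>F. s i)) J"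
  using assms by (induction F rule: infinite_finite_induct) (auto intro: has_sum_add)

lemma norm_exp_i_diff_le: "cmod (exp (\<i> * complex_of_real a) - exp (\<i> * complex_of_real b)) \<le> \<bar>a - b\<bar>"
proof -
  have "exp (\<i> * complex_of_real a) - exp (\<i> * complex_of_real b) =
      exp (\<i> * complex_of_real b) * (exp (\<i> * complex_of_real (a - b)) - 1)"
    by (simp add: exp_add[symmetric] algebra_simps)
  then have "cmod (exp (\<i> * complex_of_real a) - exp (\<i> * complex_of_real b)) =
      cmod (exp (\<i> * complex_of_real (a - b)) - 1)"
    by (simp only: norm_mult norm_exp_i_times mult_1)
  also have "\<dots> \<le> \<bar>a - b\<bar>"
    using Taylor_exp[of "\<i> * complex_of_real (a - b)" 0] by (simp add: norm_mult flip: of_real_diff)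
  finally show ?thesis .
qed

lemma ncpoly_fun_bipoly: "ncpoly_fun p \<in> bipoly"
proof -
  have coord: "(\<lambda>z. complex_of_real (case l of LX \<Rightarrow> fst z | LY \<Rightarrow> snd z)) \<in> bipoly" for l
    using bipoly.monom[of 1 1 0] bipoly.monom[of 1 0 1] by (cases l) (simp_all add: case_prod_unfold)
  have "(\<lambda>z. \<Prod>l\<leftarrow>w. complex_of_real (case l of LX \<Rightarrow> fst z | LY \<Rightarrow> snd z)) \<in> bipoly" for w
    by (induction w) (simp_all add: bipoly_const bipoly_mult coord)
  then have "(\<lambda>z. \<Sum>w\<in>Poly_Mapping.keys p. Poly_Mapping.lookup p w *
      (\<Prod>l\<leftarrow>w. complex_of_real (case l of LX \<Rightarrow> fst z | LY \<Rightarrow> snd z))) \<in> bipoly"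
    by (intro bipoly_sum bipoly_mult bipoly_const)
  then show ?thesis by (simp add: ncpoly_fun_def case_prod_unfold)
qed

context observables_in_state
begin

text \<open>Test functions may be unbounded on the plane; on a square containing the joint spectrum
  they are bounded.\<close>

lemma spec_bounded: "\<exists>R>0. \<forall>z\<in>spec. z \<in> cbox (-R, -R) (R, R)"
proof -
  obtain K where K: "K > 0" "\<And>x. norm (A x) \<le> norm x * K"
    using bounded_linear.pos_bounded[OF bounded_clinear_bounded_linear[OF Ac]] by blast
  obtain L where L: "L > 0" "\<And>x. norm (B x) \<le> norm x * L"
    using bounded_linear.pos_bounded[OF bounded_clinear_bounded_linear[OF Bc]] by blast
  have "z \<in> cbox (- max K L, - max K L) (max K L, max K L)" if "z \<in> spec" for z
    using eigenvalue_bound[OF K(2), of "fst z"] eigenvalue_bound[OF L(2), of "snd z"] that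
    by (auto simp: cbox_Pair_eq abs_le_iff)
  then show ?thesis using K(1) by (intro exI[of _ "max K L"]) auto
qed

context
  assumes comm: "commute_in_state A B \<rho>"
begin

abbreviation "\<mu> \<equiv> joint_prob A B \<rho>"

lemma cmod_joint_prob_sum: "((\<lambda>z. cmod (\<mu> z)) has_sum 1) spec"
proof -
  have "((\<lambda>z. complex_of_real (cmod (\<mu> z))) has_sum complex_of_real 1) spec"
    by (rule has_sum_cong[THEN iffD1, OF joint_prob_eq_cmod[OF comm]]) (use joint_prob_sum[OF comm] in auto)
  then show ?thesis unfolding has_sum_of_real_iff .
qed

lemma joint_prob_summable:
  assumes "\<And>z. z \<in> spec \<Longrightarrow> cmod (f z) \<le> M"
  shows "(\<lambda>z. \<mu> z * f z) summable_on spec"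
proof (rule abs_summable_summable, rule summable_on_comparison_test)
  show "(\<lambda>z. cmod (\<mu> z) * M) summable_on spec"
    using has_sum_cmult_left[OF cmod_joint_prob_sum, of M] by (auto simp: summable_on_def)
qed (auto simp: norm_mult intro: mult_left_mono assms)

text \<open>The weights have total mass 1. The bound yields both the continuity of
  \<open>joint_dist\<close> and the Lipschitz estimate for the characteristic function.\<close>

lemma joint_prob_expectation_bound:
  assumes s: "((\<lambda>z. \<mu> z * f z) has_sum s) spec" and M: "\<And>z. z \<in> spec \<Longrightarrow> cmod (f z) \<le> M"
  shows "cmod s \<le> M"
proof -
  have M': "((\<lambda>z. cmod (\<mu> z) * M) has_sum M) spec"
    using has_sum_cmult_left[OF cmod_joint_prob_sum, of M] by simp
  have le: "cmod (\<mu> z * f z) \<le> cmod (\<mu> z) * M" if "z \<in> spec" for z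
    unfolding norm_mult using M[OF that] by (rule mult_left_mono) simp
  have n: "(\<lambda>z. cmod (\<mu> z * f z)) summable_on spec"
    by (rule summable_on_comparison_test[of "\<lambda>z. cmod (\<mu> z) * M"]) (use M' le in \<open>auto simp: summable_on_def\<close>)
  have "cmod s \<le> (\<Sum>\<^sub>\<infinity>z\<in>spec. cmod (\<mu> z * f z))"
    using norm_infsum_bound[OF n] infsumI[OF s] by simp
  also have "\<dots> \<le> M" by (rule has_sum_mono[OF has_sum_infsum[OF n] M' le])
  finally show ?thesis .
qed

text \<open>The measure with weights \<open>\<mu>\<close>, viewed as a distribution; the
  \<open>else\<close> branch follows the convention of \<open>cs_distribution\<close> for functions
  that are not smooth.\<close>

definition joint_dist :: "(real \<times> real \<Rightarrow> complex) \<Rightarrow> complex" where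
  "joint_dist f = (if smooth f then \<Sum>\<^sub>\<infinity>z\<in>spec. \<mu> z * f z else 0)"

lemma smooth_bounded_on_cbox:
  assumes "smooth f"
  shows "bdd_above ((\<lambda>z. cmod (f z)) ` cbox a b)"
proof -
  have "continuous_on (cbox a b) (\<lambda>z. cmod (f z))"
    using smoothD(4)[OF assms] by (intro continuous_on_norm) (rule continuous_on_subset, auto)
  then show ?thesis
    by (intro bounded_imp_bdd_above compact_imp_bounded compact_continuous_image compact_cbox)
qed

lemma joint_dist_has_sum:
  assumes f: "smooth f"
  shows "((\<lambda>z. \<mu> z * f z) has_sum joint_dist f) spec"
proof -
  obtain R where R: "\<forall>z\<in>spec. z \<in> cbox (-R, -R) (R, R)" using spec_bounded by blast
  obtain M where M: "\<And>z. z \<in> cbox (-R, -R) (R, R) \<Longrightarrow> cmod (f z) \<le> M"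
    using smooth_bounded_on_cbox[OF f, of "(-R, -R)" "(R, R)"] by (auto simp: bdd_above_def)
  have "(\<lambda>z. \<mu> z * f z) summable_on spec"
    by (rule joint_prob_summable) (use R M in blast)
  from has_sum_infsum[OF this] show ?thesis using f by (simp add: joint_dist_def)
qed

lemma cs_distribution_joint_dist: "cs_distribution joint_dist"
  unfolding cs_distribution_def
proof (intro conjI allI impI)
  fix f g assume f: "smooth f" and g: "smooth g"
  have "((\<lambda>z. \<mu> z * (f z + g z)) has_sum joint_dist f + joint_dist g) spec"
    unfolding distrib_left by (intro has_sum_add joint_dist_has_sum f g)
  with joint_dist_has_sum[OF smooth_add[OF f g]]
  show "joint_dist (\<lambda>z. f z + g z) = joint_dist f + joint_dist g" by (rule has_sum_unique)
next
  fix c f assume f: "smooth f"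
  have "((\<lambda>z. \<mu> z * (c * f z)) has_sum c * joint_dist f) spec"
    using has_sum_cmult_right[OF joint_dist_has_sum[OF f], of c] by (simp only: mult.left_commute)
  with joint_dist_has_sum[OF smooth_cmult[OF f]]
  show "joint_dist (\<lambda>z. c * f z) = c * joint_dist f" by (rule has_sum_unique)
next
  obtain R where R: "R > 0" "\<forall>z\<in>spec. z \<in> cbox (-R, -R) (R, R)" using spec_bounded by blast
  let ?K = "cbox (-R, -R) (R, R)"
  \<comment> \<open>A measure has order 0: the supremum over the square suffices, with constant
    1.\<close>
  have "cmod (joint_dist f) \<le> (SUP z\<in>?K. cmod (f z))" if "smooth f" for f
    by (rule joint_prob_expectation_bound[OF joint_dist_has_sum[OF that]])
       (rule cSUP_upper[OF _ smooth_bounded_on_cbox[OF that]], use R(2) in blast)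
  moreover have "(0, 0) \<in> ?K" using R(1) by (simp add: cbox_Pair_eq)
  then have "?K \<noteq> {}" by blast
  ultimately have "compact ?K \<and> ?K \<noteq> {} \<and> (\<forall>f. smooth f \<longrightarrow>
      cmod (joint_dist f) \<le> 1 * (\<Sum>i\<le>0. \<Sum>j\<le>0. SUP z\<in>?K. cmod (deriv2 i j f z)))"
    by (simp add: compact_cbox)
  then show "\<exists>K n C. compact K \<and> K \<noteq> {} \<and> (\<forall>f. smooth f \<longrightarrow>
      cmod (joint_dist f) \<le> C * (\<Sum>i\<le>n. \<Sum>j\<le>n. SUP z\<in>K. cmod (deriv2 i j f z)))"
    by (intro exI)
next
  fix f assume "\<not> smooth f"
  then show "joint_dist f = 0" by (simp add: joint_dist_def)
qed

text \<open>Every valid ordering has the Fourier transform of \<open>\<mu>\<close> as its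
  characteristic function; injectivity of the Fourier transform then resolves the definite
  description.\<close>

lemma quasiprob_eq_joint_dist:
  assumes \<omega>: "valid_ordering \<omega>"
  shows "quasiprob \<omega> A B \<rho> = joint_dist"
proof -
  have F: "fourier joint_dist \<theta> = charfun \<omega> A B \<rho> \<theta>" for \<theta>
    using has_sum_unique[OF joint_dist_has_sum[OF smooth_plane_wave[of \<theta>], unfolded plane_wave_def]
        charfun_has_sum[OF comm \<omega>, of \<theta>]]
    by (simp add: fourier_def)
  show ?thesis
    unfolding quasiprob_def
  proof (rule the_equality)
    show "cs_distribution joint_dist \<and> (\<forall>\<theta>. fourier joint_dist \<theta> = charfun \<omega> A B \<rho> \<theta>)"
      using cs_distribution_joint_dist F by blast
    show "u = joint_dist" if "cs_distribution u \<and> (\<forall>\<theta>. fourier u \<theta> = charfun \<omega> A B \<rho> \<theta>)" for u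
      using that F by (intro cs_distribution_eq_if_fourier_eq cs_distribution_joint_dist) auto
  qed
qed

lemma nonneg_joint_dist: "nonneg_distribution joint_dist"
  unfolding nonneg_distribution_def
  using has_sum_in_nonneg_Reals[OF joint_dist_has_sum] joint_prob_nonneg[OF comm] nonneg_Reals_mult_I by blast

lemma joint_dist_reproduces_moments: "reproduces_moments joint_dist A B \<rho>"
  unfolding reproduces_moments_def
proof
  fix p
  have p: "smooth (ncpoly_fun p)" by (rule smooth_bipoly[OF ncpoly_fun_bipoly])
  obtain R where R: "\<forall>z\<in>spec. z \<in> cbox (-R, -R) (R, R)" using spec_bounded by blast
  obtain M where M: "\<And>z. z \<in> cbox (-R, -R) (R, R) \<Longrightarrow> cmod (ncpoly_fun p z) \<le> M"
    using smooth_bounded_on_cbox[OF p, of "(-R, -R)" "(R, R)"] by (auto simp: bdd_above_def)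
  have "((\<lambda>z. \<mu> z * ncpoly_fun p z) has_sum trace_op (ncpoly_op p A B \<circ> \<rho>)) spec"
  proof (rule trace_joint_eigen[where M=M, OF comm bounded_clinear_ncpoly_op[OF Ac Bc]])
    show "cmod (ncpoly_fun p z) \<le> M" if "z \<in> spec" for z using R M that by blast
  qed (rule ncpoly_op_eigenvector[OF Ac Bc])
  then show "trace_op (ncpoly_op p A B \<circ> \<rho>) = joint_dist (ncpoly_fun p)"
    using joint_dist_has_sum[OF p] by (rule has_sum_unique)
qed

text \<open>The easy half of Bochner's theorem: the quadratic form equals the
  \<open>\<mu>\<close>-expectation of \<open>\<bar>S' z\<bar>\<^sup>2\<close> for a trigonometric
  polynomial \<open>S'\<close>.\<close>

lemma positive_definite_charfun:
  assumes \<omega>: "valid_ordering \<omega>"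
  shows "positive_definite (charfun \<omega> A B \<rho>)"
  unfolding positive_definite_def
proof (intro conjI allI)
  let ?g = "charfun \<omega> A B \<rho>"
  note g = charfun_has_sum[OF comm \<omega>]
  obtain R where R: "R > 0" "\<forall>z\<in>spec. z \<in> cbox (-R, -R) (R, R)" using spec_bounded by blast
  \<comment> \<open>On the joint spectrum \<open>norm z \<le> 2 * R\<close>, so each phase is
    Lipschitz in \<open>\<theta>\<close> with constant \<open>2 * R\<close>, and averaging preserves
    this.\<close>
  have "dist (?g \<theta>) (?g \<theta>') \<le> (2 * R) * dist \<theta> \<theta>'" for \<theta> \<theta>'
    unfolding dist_norm
  proof (rule joint_prob_expectation_bound)
    show "((\<lambda>z. \<mu> z * (exp (\<i> * complex_of_real (\<theta> \<bullet> z)) - exp (\<i> * complex_of_real (\<theta>' \<bullet> z)))) has_sum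
        ?g \<theta> - ?g \<theta>') spec"
      using has_sum_add[OF g[of \<theta>] has_sum_cmult_right[OF g[of \<theta>'], of "-1"]]
      by (simp add: algebra_simps)
  next
    fix z assume "z \<in> spec"
    then have z: "norm z \<le> 2 * R"
      using R(2) norm_Pair_le[of "fst z" "snd z"] by (fastforce simp: cbox_Pair_eq abs_le_iff)
    have "cmod (exp (\<i> * complex_of_real (\<theta> \<bullet> z)) - exp (\<i> * complex_of_real (\<theta>' \<bullet> z))) \<le> \<bar>\<theta> \<bullet> z - \<theta>' \<bullet> z\<bar>"
      by (rule norm_exp_i_diff_le)
    also have "\<dots> = \<bar>(\<theta> - \<theta>') \<bullet> z\<bar>" by (simp add: inner_diff_left)
    also have "\<dots> \<le> norm (\<theta> - \<theta>') * norm z" by (rule Cauchy_Schwarz_ineq2)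
    also have "\<dots> \<le> norm (\<theta> - \<theta>') * (2 * R)" using z by (rule mult_left_mono) simp
    finally show "cmod (exp (\<i> * complex_of_real (\<theta> \<bullet> z)) - exp (\<i> * complex_of_real (\<theta>' \<bullet> z)))
        \<le> (2 * R) * norm (\<theta> - \<theta>')" by (simp add: mult.commute)
  qed
  then have "(2 * R)-lipschitz_on UNIV ?g" using R(1) by (intro lipschitz_onI) auto
  then show "continuous_on UNIV ?g" by (rule lipschitz_on_continuous_on)
next
  fix m and t :: "nat \<Rightarrow> real \<times> real" and c :: "nat \<Rightarrow> complex"
  define S' where "S' = (\<lambda>z. \<Sum>j<m. c j * exp (\<i> * complex_of_real (t j \<bullet> z)))"
  have "((\<lambda>z. \<Sum>j<m. \<Sum>k<m. c j * cnj (c k) * (\<mu> z * exp (\<i> * complex_of_real ((t j - t k) \<bullet> z)))) has_sum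
      (\<Sum>j<m. \<Sum>k<m. c j * cnj (c k) * charfun \<omega> A B \<rho> (t j - t k))) spec"
    by (intro has_sum_finite_sum has_sum_cmult_right charfun_has_sum[OF comm \<omega>])
  moreover have "(\<Sum>j<m. \<Sum>k<m. c j * cnj (c k) * (\<mu> z * exp (\<i> * complex_of_real ((t j - t k) \<bullet> z)))) =
      \<mu> z * complex_of_real ((cmod (S' z))\<^sup>2)" for z
  proof -
    have "complex_of_real ((cmod (S' z))\<^sup>2) = S' z * cnj (S' z)" by (rule complex_norm_square)
    also have "\<dots> = (\<Sum>j<m. \<Sum>k<m. (c j * exp (\<i> * complex_of_real (t j \<bullet> z))) *
        (cnj (c k) * exp (- (\<i> * complex_of_real (t k \<bullet> z)))))"
      by (simp add: S'_def sum_product exp_cnj)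
    also have "\<dots> = (\<Sum>j<m. \<Sum>k<m. c j * cnj (c k) * exp (\<i> * complex_of_real ((t j - t k) \<bullet> z)))"
    proof (intro sum.cong refl)
      fix j k
      have "exp (\<i> * complex_of_real ((t j - t k) \<bullet> z)) =
          exp (\<i> * complex_of_real (t j \<bullet> z)) * exp (- (\<i> * complex_of_real (t k \<bullet> z)))"
        by (simp add: inner_diff_left right_diff_distrib flip: exp_add)
      then show "(c j * exp (\<i> * complex_of_real (t j \<bullet> z))) * (cnj (c k) * exp (- (\<i> * complex_of_real (t k \<bullet> z)))) =
          c j * cnj (c k) * exp (\<i> * complex_of_real ((t j - t k) \<bullet> z))"
        by (simp only: mult_ac)
    qed
    finally show ?thesis by (simp only: sum_distrib_left mult_ac)
  qed
  ultimately have "((\<lambda>z. \<mu> z * complex_of_real ((cmod (S' z))\<^sup>2)) has_sum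
      (\<Sum>j<m. \<Sum>k<m. c j * cnj (c k) * charfun \<omega> A B \<rho> (t j - t k))) spec" by simp
  then show "(\<Sum>j<m. \<Sum>k<m. c j * cnj (c k) * charfun \<omega> A B \<rho> (t j - t k)) \<in> \<real>\<^sub>\<ge>\<^sub>0"
    by (rule has_sum_in_nonneg_Reals)
       (intro nonneg_Reals_mult_I joint_prob_nonneg[OF comm], simp_all)
qed

end

end

text \<open>The identity of the quasiprobability with the sum of point masses is stated by testing
  against each smooth \<open>f\<close>. The clauses on \<open>joint_prob\<close> say that it is a
  probability distribution on the product of the two sets of eigenvalues.\<close>

theorem corollary1:
  fixes A B \<rho> :: "'a::chilbert_space \<Rightarrow> 'a"
  assumes "selfadjoint_op A" and "has_spectral_decomposition A"
    and "selfadjoint_op B" and "has_spectral_decomposition B"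
    and "density_operator \<rho>"
  shows "(commute_in_state A B \<rho> \<longrightarrow>
            (\<forall>z\<in>eigenvalues A \<times> eigenvalues B. joint_prob A B \<rho> z \<in> \<real>\<^sub>\<ge>\<^sub>0) \<and>
            (joint_prob A B \<rho> has_sum 1) (eigenvalues A \<times> eigenvalues B) \<and>
            (\<forall>\<omega>. valid_ordering \<omega> \<longrightarrow>
               cs_distribution (quasiprob \<omega> A B \<rho>) \<and>
               (\<forall>f. smooth f \<longrightarrow>
                  ((\<lambda>z. joint_prob A B \<rho> z * f z) has_sum quasiprob \<omega> A B \<rho> f)
                    (eigenvalues A \<times> eigenvalues B)) \<and>
               nonneg_distribution (quasiprob \<omega> A B \<rho>) \<and>
               positive_definite (charfun \<omega> A B \<rho>))) \<and>
         ((nonneg_distribution (quasiprob KD A B \<rho>) \<and> reproduces_moments (quasiprob KD A B \<rho>) A B \<rho>)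
            \<longleftrightarrow> commute_in_state A B \<rho>)"
proof -
  obtain S E where "observables_in_state A B \<rho> S E"
  proof (rule density_operator_trace_formula[OF assms(5)])
    fix S E
    assume "selfadjoint_op S" "\<And>x. S (S x) = \<rho> x" "is_onb E"
      "\<And>T. bounded_clinear T \<Longrightarrow> ((\<lambda>e. cinner (S e) (T (S e))) has_sum trace_op (T \<circ> \<rho>)) E"
      "((\<lambda>e. (norm (S e))\<^sup>2) has_sum 1) E"
    then show thesis by (intro that[of S E] observables_in_state.intro assms(1-4))
  qed
  then interpret observables_in_state A B \<rho> S E .
  show ?thesis
  proof (intro conjI impI)
    assume c: "commute_in_state A B \<rho>"
    show "\<forall>z\<in>spec. joint_prob A B \<rho> z \<in> \<real>\<^sub>\<ge>\<^sub>0" by (intro ballI joint_prob_nonneg[OF c])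
    show "(joint_prob A B \<rho> has_sum 1) spec" by (rule joint_prob_sum[OF c])
    show "\<forall>\<omega>. valid_ordering \<omega> \<longrightarrow>
               cs_distribution (quasiprob \<omega> A B \<rho>) \<and>
               (\<forall>f. smooth f \<longrightarrow>
                  ((\<lambda>z. joint_prob A B \<rho> z * f z) has_sum quasiprob \<omega> A B \<rho> f) spec) \<and>
               nonneg_distribution (quasiprob \<omega> A B \<rho>) \<and>
               positive_definite (charfun \<omega> A B \<rho>)"
      using quasiprob_eq_joint_dist[OF c] cs_distribution_joint_dist[OF c] joint_dist_has_sum[OF c]
        nonneg_joint_dist[OF c] positive_definite_charfun[OF c] by simp
  next
    \<comment> \<open>The equality is available only under commutation, so it serves one direction;
      the other applies the moment argument to \<open>quasiprob KD A B \<rho>\<close> as it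
      stands.\<close>
    have "quasiprob KD A B \<rho> = joint_dist" if "commute_in_state A B \<rho>"
      by (rule quasiprob_eq_joint_dist[OF that]) (simp add: KD_def)
    then show "(nonneg_distribution (quasiprob KD A B \<rho>) \<and> reproduces_moments (quasiprob KD A B \<rho>) A B \<rho>)
            \<longleftrightarrow> commute_in_state A B \<rho>"
      using nonneg_joint_dist joint_dist_reproduces_moments commute_if_reproduces_moments by metis
  qed
qed

end
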